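(* Let $V$ be a simple Euclidean Jordan algebra with symmetric cone $\Omega$, and let $\sigma$ be an involutive Jordan automorphism of $V$. Let $\Omega_\sigma^+=\{a\in\Omega:\sigma(a)=a\}$ and $\Omega_\sigma^-=\{b\in\Omega:\sigma(b)=b^{-1}\}$. Then the map $$f_\sigma:\Omega_\sigma^+\times\Omega_\sigma^-\to\Omega,\qquad f_\sigma(a,b)=P(a^{1/2})\,b,$$ is a real-analytic diffeomorphism, with inverse $$f_\sigma^{-1}(x)=\bigl(x\mathbin{\#}\sigma(x),\ x\mathbin{\natural}\sigma(x^{-1})\bigr),\qquad x\in\Omega.$$
   Context: A Euclidean Jordan algebra is a finite-dimensional real inner product space $V$ with a bilinear product $(x,y)\mapsto xy$ satisfying $xy=yx$, $x(x^2y)=x^2(xy)$, $\langle xy,z\rangle=\langle y,xz\rangle$, and having a unit element $e$; it is simple if it has no nontrivial ideals. Its symmetric cone is $\Omega=\operatorname{int}\{x^2:x\in V\}$. For $x\in V$, $L(x)y=xy$ and $P(x)=2L(x)^2-L(x^2)$ (quadratic representation). Every $x\in V$ has a spectral decomposition $x=\sum_{j=1}^r\lambda_jc_j$, with $(c_1,\dots,c_r)$ a Jordan frame (pairwise orthogonal primitive idempotents with sum $e$) and $\lambda_j\in\mathbb R$ the spectral values; for $x\in\Omega$ all $\lambda_j>0$ and $x^\alpha=\sum_j\lambda_j^\alpha c_j$ for $\alpha\in\mathbb R$ (so $x^{-1}$ is the Jordan inverse). For $a,b\in\Omega$, the metric geometric mean is $a\mathbin{\#}b=P(a^{1/2})\bigl(P(a^{-1/2})b\bigr)^{1/2}$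 and the spectral geometric mean is $a\mathbin{\natural}b=P\bigl((a^{-1}\mathbin{\#}b)^{1/2}\bigr)a$. An involutive Jordan automorphism is a linear bijection $\sigma:V\to V$ with $\sigma(xy)=\sigma(x)\sigma(y)$ and $\sigma^2=\operatorname{id}$. The sets $\Omega_\sigma^\pm$ are regarded as embedded (real-analytic) submanifolds of $\Omega$: $\Omega_\sigma^\pm=\exp(V^\pm)$, where $V^\pm=\{x\in V:\sigma(x)=\pm x\}$ and $\exp$ is the Jordan exponential. *)

theory Defs
  imports "HOL-Analysis.Analysis"
begin

section \<open>Euclidean Jordan algebras\<close>

text \<open>The superclass \<^class>\<open>euclidean_space\<close> supplies the finite-dimensional real inner product
  space; it also forces the dimension to be positive. Bilinearity of the product
  follows from the left-hand laws and commutativity.\<close>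

class euclidean_jordan_algebra = euclidean_space +
  fixes jmult :: "'a \<Rightarrow> 'a \<Rightarrow> 'a" (infixl \<open>\<odot>\<close> 70)
    and jone :: 'a
  assumes jmult_add_left: "(x + y) \<odot> z = x \<odot> z + y \<odot> z"
    and jmult_scaleR_left: "(r *\<^sub>R x) \<odot> y = r *\<^sub>R (x \<odot> y)"
    and jmult_commute: "x \<odot> y = y \<odot> x"
    and jordan_identity: "x \<odot> ((x \<odot> x) \<odot> y) = (x \<odot> x) \<odot> (x \<odot> y)"
    and inner_jmult: "inner (x \<odot> y) z = inner y (x \<odot> z)"
    and jone_jmult: "jone \<odot> x = x"

definition (in euclidean_jordan_algebra) jordan_ideal :: "'a set \<Rightarrow> bool" where
  "jordan_ideal I \<longleftrightarrow> 0 \<in> I \<and> (\<forall>x\<in>I. \<forall>y\<in>I. x + y \<in> I) \<and> (\<forall>r. \<forall>x\<in>I. r *\<^sub>R x \<in> I) \<and>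
     (\<forall>x. \<forall>y\<in>I. x \<odot> y \<in> I)"

class simple_euclidean_jordan_algebra = euclidean_jordan_algebra +
  assumes simple: "jordan_ideal I \<Longrightarrow> I = {0} \<or> I = UNIV"

definition symmetric_cone :: "'a::euclidean_jordan_algebra set" (\<open>\<Omega>\<close>) where
  "\<Omega> = interior {x \<odot> x | x. True}"

definition quad_rep :: "'a::euclidean_jordan_algebra \<Rightarrow> 'a \<Rightarrow> 'a" where
  "quad_rep x y = 2 *\<^sub>R (x \<odot> (x \<odot> y)) - (x \<odot> x) \<odot> y"

definition jidempotent :: "'a::euclidean_jordan_algebra \<Rightarrow> bool" where
  "jidempotent c \<longleftrightarrow> c \<odot> c = c"

definition primitive_idempotent :: "'a::euclidean_jordan_algebra \<Rightarrow> bool" where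
  "primitive_idempotent c \<longleftrightarrow> jidempotent c \<and> c \<noteq> 0 \<and>
     \<not> (\<exists>p q. jidempotent p \<and> jidempotent q \<and> p \<noteq> 0 \<and> q \<noteq> 0 \<and> p \<odot> q = 0 \<and> c = p + q)"

text \<open>The members of a Jordan frame are nonzero and pairwise orthogonal, hence distinct, so a frame
  can be given as a set; eigenvalues are then indexed by the frame itself.\<close>

definition jordan_frame :: "'a::euclidean_jordan_algebra set \<Rightarrow> bool" where
  "jordan_frame C \<longleftrightarrow> finite C \<and> (\<forall>c\<in>C. primitive_idempotent c) \<and>
     (\<forall>c\<in>C. \<forall>d\<in>C. c \<noteq> d \<longrightarrow> c \<odot> d = 0) \<and> (\<Sum>c\<in>C. c) = jone"

definition spectral_decomposition ::
    "'a::euclidean_jordan_algebra \<Rightarrow> 'a set \<Rightarrow> ('a \<Rightarrow> real) \<Rightarrow> bool" where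
  "spectral_decomposition x C l \<longleftrightarrow> jordan_frame C \<and> x = (\<Sum>c\<in>C. l c *\<^sub>R c)"

text \<open>The frame in a spectral decomposition need not be unique, but the resulting power is.
  Meaningful for \<open>x \<in> \<Omega>\<close> only, where all eigenvalues are positive.\<close>

definition jpow :: "'a::euclidean_jordan_algebra \<Rightarrow> real \<Rightarrow> 'a" where
  "jpow x \<alpha> = (THE y. \<exists>C l. spectral_decomposition x C l \<and> y = (\<Sum>c\<in>C. (l c powr \<alpha>) *\<^sub>R c))"

abbreviation jinv :: "'a::euclidean_jordan_algebra \<Rightarrow> 'a" where
  "jinv x \<equiv> jpow x (- 1)"

definition metric_geometric_mean ::
    "'a::euclidean_jordan_algebra \<Rightarrow> 'a \<Rightarrow> 'a" (infixl \<open>\<sharp>\<close> 75) where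
  "a \<sharp> b = quad_rep (jpow a (1/2)) (jpow (quad_rep (jpow a (- 1/2)) b) (1/2))"

definition spectral_geometric_mean ::
    "'a::euclidean_jordan_algebra \<Rightarrow> 'a \<Rightarrow> 'a" (infixl \<open>\<natural>\<close> 75) where
  "a \<natural> b = quad_rep (jpow (jinv a \<sharp> b) (1/2)) a"

definition involutive_jordan_automorphism ::
    "('a::euclidean_jordan_algebra \<Rightarrow> 'a) \<Rightarrow> bool" where
  "involutive_jordan_automorphism \<sigma> \<longleftrightarrow>
     linear \<sigma> \<and> bij \<sigma> \<and> (\<forall>x y. \<sigma> (x \<odot> y) = \<sigma> x \<odot> \<sigma> y) \<and> \<sigma> \<circ> \<sigma> = id"

definition cone_plus :: "('a::euclidean_jordan_algebra \<Rightarrow> 'a) \<Rightarrow> 'a set" where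
  "cone_plus \<sigma> = {a \<in> \<Omega>. \<sigma> a = a}"

definition cone_minus :: "('a::euclidean_jordan_algebra \<Rightarrow> 'a) \<Rightarrow> 'a set" where
  "cone_minus \<sigma> = {b \<in> \<Omega>. \<sigma> b = jinv b}"

definition polar_map :: "'a::euclidean_jordan_algebra \<times> 'a \<Rightarrow> 'a" where
  "polar_map = (\<lambda>(a, b). quad_rep (jpow a (1/2)) b)"


section \<open>Real-analytic maps and submanifolds of Euclidean spaces\<close>

text \<open>Local expansion into a convergent power series in the coordinates with respect to
  \<^const>\<open>Basis\<close>; \<open>m\<close> ranges over multi-indices, and the sum is unordered (so absolutely
  convergent).\<close>

definition real_analytic_at :: "('a::euclidean_space \<Rightarrow> 'b::euclidean_space) \<Rightarrow> 'a \<Rightarrow> bool" where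
  "real_analytic_at f x \<longleftrightarrow>
     (\<exists>r>0. \<exists>c :: ('a \<Rightarrow> nat) \<Rightarrow> 'b. \<forall>y\<in>ball x r.
        ((\<lambda>m. (\<Prod>i\<in>Basis. (inner (y - x) i) ^ m i) *\<^sub>R c m) has_sum f y) (Basis \<rightarrow>\<^sub>E UNIV))"

text \<open>For arbitrary \<open>S\<close>, analyticity means that \<open>f\<close> locally extends to an analytic map on an open
  set of the ambient space. On open sets this is ordinary analyticity, and on embedded
  submanifolds it is analyticity for the induced manifold structure.\<close>

definition real_analytic_on ::
    "'a::euclidean_space set \<Rightarrow> ('a \<Rightarrow> 'b::euclidean_space) \<Rightarrow> bool" where
  "real_analytic_on S f \<longleftrightarrow>
     (\<forall>x\<in>S. \<exists>U g. open U \<and> x \<in> U \<and> (\<forall>y\<in>U. real_analytic_at g y) \<and> (\<forall>y\<in>S \<inter> U. g y = f y))"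

definition bianalytic ::
    "'a::euclidean_space set \<Rightarrow> 'b::euclidean_space set \<Rightarrow> ('a \<Rightarrow> 'b) \<Rightarrow> bool" where
  "bianalytic S T f \<longleftrightarrow>
     bij_betw f S T \<and> real_analytic_on S f \<and> real_analytic_on T (inv_into S f)"

text \<open>Slice charts: near each of its points, \<open>S\<close> is flattened to a \<open>d\<close>-dimensional linear
  subspace by an analytic change of coordinates of the ambient space.\<close>

definition embedded_analytic_submanifold :: "'a::euclidean_space set \<Rightarrow> bool" where
  "embedded_analytic_submanifold S \<longleftrightarrow>
     (\<exists>d. \<forall>x\<in>S. \<exists>U W L (\<phi> :: 'a \<Rightarrow> 'a).
        open U \<and> x \<in> U \<and> open W \<and> bianalytic U W \<phi> \<and>
        subspace L \<and> dim L = d \<and> \<phi> ` (S \<inter> U) = L \<inter> W)"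

definition real_analytic_diffeomorphism ::
    "'a::euclidean_space set \<Rightarrow> 'b::euclidean_space set \<Rightarrow> ('a \<Rightarrow> 'b) \<Rightarrow> bool" where
  "real_analytic_diffeomorphism S T f \<longleftrightarrow>
     embedded_analytic_submanifold S \<and> embedded_analytic_submanifold T \<and> bianalytic S T f"

end

theory Submission
  imports Defs
begin

text \<open>If \<open>x = P(a\<^bsup>1/2\<^esup>) b\<close> with \<open>\<sigma> a = a\<close> and \<open>\<sigma> b = b\<^bsup>-1\<^esup>\<close>, then
\<open>\<sigma> x = P(a\<^bsup>1/2\<^esup>) b\<^bsup>-1\<^esup>\<close>, whereas \<open>x\<^bsup>-1\<^esup> = P(a\<^bsup>1/2\<^esup>)\<^bsup>-1\<^esup> b\<^bsup>-1\<^esup>\<close>; hence \<open>a\<close> solves the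
Riccati equation \<open>P(a) x\<^bsup>-1\<^esup> = \<sigma> x\<close>. In the cone this equation has exactly one solution, the
metric geometric mean \<open>x \<sharp> \<sigma> x\<close> (\<open>metric_geometric_mean_riccati\<close>,
\<open>metric_geometric_mean_unique\<close>), and then \<open>b = P(a\<^bsup>1/2\<^esup>)\<^bsup>-1\<^esup> x\<close>, which is
\<open>x \<natural> \<sigma> (x\<^bsup>-1\<^esup>)\<close> because inversion commutes with the metric mean. Conversely, for every \<open>x\<close> in
the cone the mean \<open>a = x \<sharp> \<sigma> x\<close> is fixed by \<open>\<sigma>\<close> since the mean is symmetric, and the Riccati
equation says precisely that \<open>\<sigma>\<close> inverts \<open>P(a\<^bsup>1/2\<^esup>)\<^bsup>-1\<^esup> x\<close>. So the polar map is bijective with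
the stated inverse (\<open>polar_map_decomposition\<close>, \<open>polar_map_components\<close>).

The Jordan-theoretic input has three layers. The spectral theorem is obtained from power
associativity: an eigenspace of multiplication by \<open>x\<close> on the associative algebra generated by \<open>x\<close>
is an ideal, and its unit, the orthogonal projection of the identity, is an idempotent. Positivity
of multiplication by an idempotent then gives a functional calculus that depends only on \<open>x\<close> and
identifies the symmetric cone with the elements of positive spectrum. The identity
\<open>P(P(x) y) = P(x) P(y) P(x)\<close> for \<open>x\<close> in the cone is proved along the curve of powers of \<open>x\<close>,
where both sides satisfy the same linear differential equation; the equation is the infinitesimal
form of the identity and is quadratic in \<open>y\<close>, so it follows directly from the linearized Jordan
identity. A connectedness argument along the same curve shows that \<open>P(x)\<close> preserves the cone.

For analyticity, the maps that are given near a point by a power series with weighted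
\<open>\<ell>\<^sup>1\<close>-summable coefficients form a Banach algebra, which yields closure under products and
composition. Every power \<open>x \<mapsto> x\<^sup>\<alpha>\<close> is locally a binomial series in \<open>e - x / M\<close>, which converges
in this norm because multiplication by an element has operator norm at most its spectral radius.
Both means and the polar map are composed of such powers and of the quadratic representation.

The fixed points of \<open>\<sigma>\<close> in the cone form an open piece of a linear subspace. The Cayley transform
\<open>x \<mapsto> (x - e) / (x + e)\<close> commutes with \<open>\<sigma>\<close> and turns inversion into negation, so it is a chart of
the whole cone that flattens the points with \<open>\<sigma> x = x\<^bsup>-1\<^esup>\<close> to the \<open>(-1)\<close>-eigenspace of \<open>\<sigma>\<close>.\<close>

section \<open>Power series on cubes and real-analytic maps\<close>

definition monomial_at :: "('a::euclidean_space \<Rightarrow> nat) \<Rightarrow> 'a \<Rightarrow> real" where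
  "monomial_at m h = (\<Prod>i\<in>Basis. (h \<bullet> i) ^ m i)"

definition mdegree :: "('a::euclidean_space \<Rightarrow> nat) \<Rightarrow> nat" where
  "mdegree m = (\<Sum>i\<in>Basis. m i)"

abbreviation multi_indices :: "('a::euclidean_space \<Rightarrow> nat) set" where
  "multi_indices \<equiv> Basis \<rightarrow>\<^sub>E UNIV"

definition cube :: "real \<Rightarrow> 'a::euclidean_space set" where
  "cube r = {h. \<forall>i\<in>Basis. \<bar>h \<bullet> i\<bar> \<le> r}"

text \<open>The power series in the coordinates whose coefficients have weighted \<open>\<ell>\<^sup>1\<close>-norm
  \<open>\<Sum>m. norm (c m) * r\<^bsup>|m|\<^esup>\<close> at most \<open>N\<close>. These norms are submultiplicative and complete, unlike
  the supremum norm on a real cube; working with a bound \<open>N\<close> instead of the norm itself avoids the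
  question whether the coefficients are determined by the map.\<close>

definition cube_series :: "real \<Rightarrow> real \<Rightarrow> ('a::euclidean_space \<Rightarrow> 'b::euclidean_space) \<Rightarrow> bool" where
  "cube_series r N f \<longleftrightarrow> (\<exists>c. (\<lambda>m. norm (c m) * r ^ mdegree m) summable_on multi_indices \<and>
     infsum (\<lambda>m. norm (c m) * r ^ mdegree m) multi_indices \<le> N \<and>
     (\<forall>h\<in>cube r. ((\<lambda>m. monomial_at m h *\<^sub>R c m) has_sum f h) multi_indices))"

lemma cube_seriesI:
  assumes "(\<lambda>m. norm (c m) * r ^ mdegree m) summable_on multi_indices"
    and "infsum (\<lambda>m. norm (c m) * r ^ mdegree m) multi_indices \<le> N"
    and "\<And>h. h \<in> cube r \<Longrightarrow> ((\<lambda>m. monomial_at m h *\<^sub>R c m) has_sum f h) multi_indices"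
  shows "cube_series r N f"
  unfolding cube_series_def using assms by (intro exI[of _ c] conjI ballI)

lemma cube_seriesE:
  assumes "cube_series r N f"
  obtains c where "(\<lambda>m. norm (c m) * r ^ mdegree m) summable_on multi_indices"
    and "infsum (\<lambda>m. norm (c m) * r ^ mdegree m) multi_indices \<le> N"
    and "\<forall>h\<in>cube r. ((\<lambda>m. monomial_at m h *\<^sub>R c m) has_sum f h) multi_indices"
proof -
  obtain c where "(\<lambda>m. norm (c m) * r ^ mdegree m) summable_on multi_indices \<and>
     infsum (\<lambda>m. norm (c m) * r ^ mdegree m) multi_indices \<le> N \<and>
     (\<forall>h\<in>cube r. ((\<lambda>m. monomial_at m h *\<^sub>R c m) has_sum f h) multi_indices)"
    using assms unfolding cube_series_def by (elim exE)
  then show thesis by (intro that[of c]) auto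
qed

lemma abs_monomial_at_le:
  assumes "h \<in> cube r"
  shows "\<bar>monomial_at m h\<bar> \<le> r ^ mdegree m"
proof -
  have "\<bar>monomial_at m h\<bar> = (\<Prod>i\<in>Basis. \<bar>h \<bullet> i\<bar> ^ m i)"
    by (simp add: monomial_at_def abs_prod power_abs)
  also have "\<dots> \<le> (\<Prod>i\<in>Basis. r ^ m i)"
    using assms by (intro prod_mono) (auto simp: cube_def intro!: power_mono)
  finally show ?thesis by (simp add: mdegree_def power_sum)
qed

lemma cube_series_mono:
  assumes "cube_series r N f" "N \<le> N'"
  shows "cube_series r N' f"
proof -
  obtain c where c: "(\<lambda>m. norm (c m) * r ^ mdegree m) summable_on multi_indices"
     "infsum (\<lambda>m. norm (c m) * r ^ mdegree m) multi_indices \<le> N"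
     "\<forall>h\<in>cube r. ((\<lambda>m. monomial_at m h *\<^sub>R c m) has_sum f h) multi_indices"
    using assms(1) by (rule cube_seriesE) (rule that)
  show ?thesis
    by (rule cube_seriesI[OF c(1) order_trans[OF c(2) assms(2)]]) (use c(3) in blast)
qed

lemma cube_series_norm_le:
  assumes "cube_series r N f" "h \<in> cube r"
  shows "norm (f h) \<le> N"
proof -
  obtain c where c: "(\<lambda>m. norm (c m) * r ^ mdegree m) summable_on multi_indices"
     "infsum (\<lambda>m. norm (c m) * r ^ mdegree m) multi_indices \<le> N"
     "\<forall>h\<in>cube r. ((\<lambda>m. monomial_at m h *\<^sub>R c m) has_sum f h) multi_indices"
    using assms(1) by (rule cube_seriesE) (rule that)
  have "norm (f h) \<le> infsum (\<lambda>m. norm (c m) * r ^ mdegree m) multi_indices"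
    by (rule norm_infsum_le[OF c(3)[rule_format, OF assms(2)] has_sum_infsum[OF c(1)]])
      (use abs_monomial_at_le[OF assms(2)] in \<open>simp add: mult.commute mult_left_mono\<close>)
  with c(2) show ?thesis by simp
qed

lemma zero_in_cube: "r \<ge> 0 \<Longrightarrow> 0 \<in> cube r"
  by (simp add: cube_def)

lemma cube_series_nonneg:
  assumes "cube_series r N f" "r > 0"
  shows "N \<ge> 0"
proof -
  have "norm (f 0) \<le> N"
    by (rule cube_series_norm_le[OF assms(1) zero_in_cube]) (use assms(2) in simp)
  with norm_ge_zero show ?thesis by (rule order_trans)
qed

lemma cube_series_linear:
  assumes f: "cube_series r N f" and r: "r > 0" and T: "linear T"
    and K: "\<And>v. norm (T v) \<le> K * norm v" "K \<ge> 0"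
  shows "cube_series r (K * N) (\<lambda>h. T (f h))"
proof -
  obtain c where c: "(\<lambda>m. norm (c m) * r ^ mdegree m) summable_on multi_indices"
     "infsum (\<lambda>m. norm (c m) * r ^ mdegree m) multi_indices \<le> N"
     "\<forall>h\<in>cube r. ((\<lambda>m. monomial_at m h *\<^sub>R c m) has_sum f h) multi_indices"
    using f by (rule cube_seriesE) (rule that)
  have bl: "bounded_linear T" using T by (simp add: linear_conv_bounded_linear)
  have le: "norm (T (c m)) * r ^ mdegree m \<le> K * (norm (c m) * r ^ mdegree m)" for m
    using mult_right_mono[OF K(1)[of "c m"], of "r ^ mdegree m"] r by (simp add: mult.assoc)
  have s: "(\<lambda>m. K * (norm (c m) * r ^ mdegree m)) summable_on multi_indices"
    using c(1) by (rule summable_on_cmult_right)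
  have s': "(\<lambda>m. norm (T (c m)) * r ^ mdegree m) summable_on multi_indices"
    by (rule summable_on_comparison_test[OF s]) (use le r in auto)
  have "infsum (\<lambda>m. norm (T (c m)) * r ^ mdegree m) multi_indices
      \<le> infsum (\<lambda>m. K * (norm (c m) * r ^ mdegree m)) multi_indices"
    using le by (intro infsum_mono s s')
  also have "\<dots> = K * infsum (\<lambda>m. norm (c m) * r ^ mdegree m) multi_indices"
    by (rule infsum_cmult_right) (use c in auto)
  also have "\<dots> \<le> K * N" using c(2) K(2) by (rule mult_left_mono)
  finally have "infsum (\<lambda>m. norm (T (c m)) * r ^ mdegree m) multi_indices \<le> K * N" .
  moreover have "((\<lambda>m. monomial_at m h *\<^sub>R T (c m)) has_sum T (f h)) multi_indices" if "h \<in> cube r" for h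
    using has_sum_bounded_linear[OF bl c(3)[rule_format, OF that]] by (simp add: linear_scale[OF T])
  ultimately show ?thesis using s' by (intro cube_seriesI[of "\<lambda>m. T (c m)"]) auto
qed

lemma cube_series_const: 
  fixes v :: "'b::euclidean_space"
  assumes "r > 0"
  shows "cube_series r (norm v) (\<lambda>h::'a::euclidean_space. v)"
proof -
  let ?z = "\<lambda>i\<in>Basis :: 'a set. 0 :: nat"
  let ?c = "\<lambda>m. if m = ?z then v else 0"
  have z: "mdegree ?z = 0" "monomial_at ?z h = 1" for h :: 'a
    by (simp_all add: mdegree_def monomial_at_def)
  have 1: "((\<lambda>m. norm (?c m) * r ^ mdegree m) has_sum norm v) multi_indices"
    by (rule has_sum_finite_neutralI[of "{?z}"]) (auto simp: z)
  have 2: "((\<lambda>m. monomial_at m h *\<^sub>R ?c m) has_sum v) multi_indices" for h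
    by (rule has_sum_finite_neutralI[of "{?z}"]) (auto simp: z)
  show ?thesis
    by (rule cube_seriesI[of ?c]) (use 1 2 in \<open>simp_all only: has_sum_iff order_refl\<close>)
qed

text \<open>Multiplication by a monomial shifts the coefficients by an injective map of the multi-indices.\<close>

lemma cube_series_monomial:
  fixes f :: "'a::euclidean_space \<Rightarrow> 'b::euclidean_space"
  assumes f: "cube_series r N f" and r: "r > 0"
  shows "cube_series r (r ^ mdegree k * N) (\<lambda>h. monomial_at k h *\<^sub>R f h)"
proof -
  obtain c where c: "(\<lambda>m. norm (c m) * r ^ mdegree m) summable_on multi_indices"
     "infsum (\<lambda>m. norm (c m) * r ^ mdegree m) multi_indices \<le> N"
     "\<forall>h\<in>cube r. ((\<lambda>m. monomial_at m h *\<^sub>R c m) has_sum f h) multi_indices"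
    using f by (rule cube_seriesE) (rule that)
  \<comment> \<open>the restriction keeps the shifted index inside the extensional set of multi-indices\<close>
  define s where "s m = (\<lambda>i\<in>Basis. m i + k i)" for m :: "'a \<Rightarrow> nat"
  define d where "d p = (if p \<in> s ` multi_indices then c (inv_into multi_indices s p) else 0)" for p
  have inj: "inj_on s multi_indices"
  proof (rule inj_onI)
    fix m n :: "'a \<Rightarrow> nat" assume mn: "m \<in> multi_indices" "n \<in> multi_indices" "s m = s n"
    show "m = n"
    proof (rule PiE_ext[OF mn(1,2)])
      fix i :: 'a assume "i \<in> Basis"
      with fun_cong[OF mn(3), of i] show "m i = n i" by (simp add: s_def)
    qed
  qed
  have sub: "s ` multi_indices \<subseteq> multi_indices" by (auto simp: s_def)
  have ds: "d (s m) = c m" if "m \<in> multi_indices" for m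
    using that inj by (simp add: d_def)
  have deg: "mdegree (s m) = mdegree m + mdegree k" for m
    by (simp add: mdegree_def s_def sum.distrib)
  have mon: "monomial_at (s m) h = monomial_at m h * monomial_at k h" for m h
    by (simp add: monomial_at_def s_def power_add prod.distrib)
  have reidx: "(G has_sum S) multi_indices"
    if "((\<lambda>m. G (s m)) has_sum S) multi_indices" "\<And>p. d p = 0 \<Longrightarrow> G p = 0"
    for G :: "('a \<Rightarrow> nat) \<Rightarrow> 'c::{topological_space,comm_monoid_add}" and S
  proof -
    have "(G has_sum S) (s ` multi_indices)"
      using that(1) by (simp add: has_sum_reindex[OF inj] o_def)
    then show ?thesis
      by (subst has_sum_cong_neutral[where S = "s ` multi_indices" and f = G, symmetric])
        (use sub in \<open>auto intro!: that(2) simp: d_def\<close>)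
  qed
  let ?I = "infsum (\<lambda>m. norm (c m) * r ^ mdegree m) multi_indices"
  have 1: "((\<lambda>p. norm (d p) * r ^ mdegree p) has_sum r ^ mdegree k * ?I) multi_indices"
  proof (rule reidx)
    have "((\<lambda>m. r ^ mdegree k * (norm (c m) * r ^ mdegree m)) has_sum r ^ mdegree k * ?I) multi_indices"
      by (rule has_sum_cmult_right[OF has_sum_infsum[OF c(1)]])
    then show "((\<lambda>m. norm (d (s m)) * r ^ mdegree (s m)) has_sum r ^ mdegree k * ?I) multi_indices"
      by (rule has_sum_cong[THEN iffD1, rotated]) (simp add: ds deg power_add)
  qed auto
  have 2: "((\<lambda>p. monomial_at p h *\<^sub>R d p) has_sum monomial_at k h *\<^sub>R f h) multi_indices"
    if "h \<in> cube r" for h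
  proof (rule reidx)
    have "((\<lambda>m. monomial_at k h *\<^sub>R (monomial_at m h *\<^sub>R c m)) has_sum monomial_at k h *\<^sub>R f h) multi_indices"
      by (rule has_sum_bounded_linear[OF bounded_linear_scaleR_right c(3)[rule_format, OF that]])
    then show "((\<lambda>m. monomial_at (s m) h *\<^sub>R d (s m)) has_sum monomial_at k h *\<^sub>R f h) multi_indices"
      by (rule has_sum_cong[THEN iffD1, rotated]) (simp add: ds mon mult.commute)
  qed auto
  have "r ^ mdegree k * ?I \<le> r ^ mdegree k * N" using c(2) r by (intro mult_left_mono) auto
  then show ?thesis
    by (intro cube_seriesI[of d]) (use 1 2 in \<open>simp_all only: has_sum_iff\<close>)
qed

text \<open>Completeness of the weighted norm: the coefficients of the sum are the sums of the coefficients,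
  by Fubini for absolutely summable families. Products and compositions reduce to this.\<close>

lemma cube_series_has_sum:
  fixes F :: "'j \<Rightarrow> 'a::euclidean_space \<Rightarrow> 'b::euclidean_space"
  assumes F: "\<And>j. j \<in> J \<Longrightarrow> cube_series r (N j) (F j)" and r: "r > 0"
    and N: "(N has_sum S) J"
    and f: "\<And>h. h \<in> cube r \<Longrightarrow> ((\<lambda>j. F j h) has_sum f h) J"
  shows "cube_series r S f"
proof -
  let ?M = "multi_indices :: ('a \<Rightarrow> nat) set"
  have "\<forall>j. \<exists>c. j \<in> J \<longrightarrow> (\<lambda>m. norm (c m) * r ^ mdegree m) summable_on ?M \<and>
     infsum (\<lambda>m. norm (c m) * r ^ mdegree m) ?M \<le> N j \<and>
     (\<forall>h\<in>cube r. ((\<lambda>m. monomial_at m h *\<^sub>R c m) has_sum F j h) ?M)"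
    using F[unfolded cube_series_def] by (simp only: ex_simps) simp
  then obtain c where c': "\<forall>j. j \<in> J \<longrightarrow> (\<lambda>m. norm (c j m) * r ^ mdegree m) summable_on ?M \<and>
     infsum (\<lambda>m. norm (c j m) * r ^ mdegree m) ?M \<le> N j \<and>
     (\<forall>h\<in>cube r. ((\<lambda>m. monomial_at m h *\<^sub>R c j m) has_sum F j h) ?M)"
    by (rule choice[THEN exE])
  have c: "\<And>j. j \<in> J \<Longrightarrow> (\<lambda>m. norm (c j m) * r ^ mdegree m) summable_on ?M"
     "\<And>j. j \<in> J \<Longrightarrow> infsum (\<lambda>m. norm (c j m) * r ^ mdegree m) ?M \<le> N j"
     "\<And>j h. j \<in> J \<Longrightarrow> h \<in> cube r \<Longrightarrow> ((\<lambda>m. monomial_at m h *\<^sub>R c j m) has_sum F j h) ?M"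
    using c' by simp_all
  let ?w = "\<lambda>j m. norm (c j m) * r ^ mdegree m"
  let ?g = "\<lambda>j. infsum (?w j) ?M"
  have w0: "?w j m \<ge> 0" for j m using r by simp
  have gs: "?g summable_on J"
    by (rule summable_on_comparison_test[of N]) (use N c(2) w0 in \<open>auto simp: has_sum_iff intro!: infsum_nonneg\<close>)
  have W: "(\<lambda>(j,m). ?w j m) summable_on J \<times> ?M"
    by (rule summable_on_SigmaI[OF _ gs]) (use c(1) w0 in auto)
  have W': "(\<lambda>(m,j). ?w j m) summable_on ?M \<times> J"
    using W by (subst (asm) summable_on_swap) (simp add: case_prod_unfold)
  have wj: "(\<lambda>j. ?w j m) summable_on J" if "m \<in> ?M" for m
    using summable_on_SigmaD1[OF W' that] .
  define d where "d m = infsum (\<lambda>j. c j m) J" for m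
  have cs: "(\<lambda>j. norm (c j m)) summable_on J" if m: "m \<in> ?M" for m
    using summable_on_cmult_left[OF wj[OF m], of "inverse (r ^ mdegree m)"] r
    by (simp add: mult.assoc)
  have nd: "norm (d m) * r ^ mdegree m \<le> infsum (\<lambda>j. ?w j m) J" if m: "m \<in> ?M" for m
  proof -
    have "norm (d m) * r ^ mdegree m \<le> infsum (\<lambda>j. norm (c j m)) J * r ^ mdegree m"
      unfolding d_def using norm_infsum_bound[OF cs[OF m]] r by (intro mult_right_mono) auto
    also have "\<dots> = infsum (\<lambda>j. ?w j m) J"
      by (rule infsum_cmult_left[symmetric]) (use cs[OF m] in auto)
    finally show ?thesis .
  qed
  have sw: "(\<lambda>m. infsum (\<lambda>j. ?w j m) J) summable_on ?M"
    using summable_on_SigmaD[OF W'] wj by (simp add: case_prod_unfold)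
  have sd: "(\<lambda>m. norm (d m) * r ^ mdegree m) summable_on ?M"
    by (rule summable_on_comparison_test[OF sw]) (use nd r in auto)
  have "infsum (\<lambda>m. norm (d m) * r ^ mdegree m) ?M \<le> infsum (\<lambda>m. infsum (\<lambda>j. ?w j m) J) ?M"
    by (intro infsum_mono sd sw nd)
  also have "\<dots> = infsum ?g J"
    by (rule infsum_swap_banach[OF W', unfolded case_prod_unfold, simplified])
  also have "\<dots> \<le> S"
    using N c(2) gs by (auto simp: has_sum_iff intro!: infsum_mono)
  finally have le: "infsum (\<lambda>m. norm (d m) * r ^ mdegree m) ?M \<le> S" .
  have "((\<lambda>m. monomial_at m h *\<^sub>R d m) has_sum f h) ?M" if h: "h \<in> cube r" for h
  proof -
    let ?t = "\<lambda>j m. monomial_at m h *\<^sub>R c j m"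
    have tw: "norm (?t j m) \<le> ?w j m" for j m
      using mult_right_mono[OF abs_monomial_at_le[OF h, of m], of "norm (c j m)"] by (simp add: mult.commute)
    have "(\<lambda>x. norm ((\<lambda>(j,m). ?t j m) x)) summable_on J \<times> ?M"
      by (rule Infinite_Sum.abs_summable_on_comparison_test'[OF W]) (use tw in auto)
    then have T: "(\<lambda>(j,m). ?t j m) summable_on J \<times> ?M" by (rule abs_summable_summable)
    have fS: "((\<lambda>(j,m). ?t j m) has_sum f h) (J \<times> ?M)"
      by (rule has_sum_SigmaI[OF _ f[OF h] T]) (use c(3) h in auto)
    then have T2: "((\<lambda>(m,j). ?t j m) has_sum f h) (?M \<times> J)"
      by (subst (asm) has_sum_swap) (simp add: case_prod_unfold)
    have dm: "((\<lambda>j. ?t j m) has_sum monomial_at m h *\<^sub>R d m) J" if m: "m \<in> ?M" for m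
      unfolding d_def
      by (rule has_sum_bounded_linear[OF bounded_linear_scaleR_right
            has_sum_infsum[OF abs_summable_summable[OF cs[OF m]]]])
    show ?thesis
      by (rule has_sum_SigmaD[OF T2]) (use dm in auto)
  qed
  with sd le show ?thesis by (rule cube_seriesI)
qed

lemma cube_series_sum:
  assumes "finite J" "\<And>j. j \<in> J \<Longrightarrow> cube_series r (N j) (F j)" "r > 0"
  shows "cube_series r (\<Sum>j\<in>J. N j) (\<lambda>h. \<Sum>j\<in>J. F j h)"
  by (rule cube_series_has_sum[where J = J and N = N and F = F, OF assms(2,3)]) (assumption | rule has_sum_finite[OF assms(1)])+

lemma cube_series_add:
  assumes "cube_series r N f" "cube_series r M g" "r > 0"
  shows "cube_series r (N + M) (\<lambda>h. f h + g h)"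
  using cube_series_sum[of "UNIV :: bool set" r "\<lambda>b. if b then N else M" "\<lambda>b. if b then f else g"] assms
  by (simp add: UNIV_bool add.commute)

text \<open>Expand only the first factor: each of its terms contributes a monomial times a linear image of the
  second factor, so the general sum lemma applies.\<close>

lemma cube_series_bilinear:
  assumes f: "cube_series r N f" and g: "cube_series r M g" and r: "r > 0"
    and B: "bounded_bilinear B" and C: "\<And>x y. norm (B x y) \<le> C * norm x * norm y" "C \<ge> 0"
  shows "cube_series r (C * N * M) (\<lambda>h. B (f h) (g h))"
proof -
  interpret B: bounded_bilinear B by (fact B)
  have M: "M \<ge> 0" using cube_series_nonneg[OF g r] .
  obtain c where c: "(\<lambda>m. norm (c m) * r ^ mdegree m) summable_on multi_indices"
     "infsum (\<lambda>m. norm (c m) * r ^ mdegree m) multi_indices \<le> N"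
     "\<forall>h\<in>cube r. ((\<lambda>m. monomial_at m h *\<^sub>R c m) has_sum f h) multi_indices"
    using f by (rule cube_seriesE) (rule that)
  let ?I = "infsum (\<lambda>m. norm (c m) * r ^ mdegree m) multi_indices"
  have "cube_series r (C * M * ?I) (\<lambda>h. B (f h) (g h))"
  proof (rule cube_series_has_sum[where J = multi_indices])
    fix m
    have "cube_series r ((C * norm (c m)) * M) (\<lambda>h. B (c m) (g h))"
      by (rule cube_series_linear[OF g r]) (use B.bounded_linear_right C in \<open>auto intro: bounded_linear.linear\<close>)
    from cube_series_monomial[OF this r, of m]
    show "cube_series r (C * M * (norm (c m) * r ^ mdegree m)) (\<lambda>h. monomial_at m h *\<^sub>R B (c m) (g h))"
      by (simp add: mult_ac)
  next
    show "((\<lambda>m. C * M * (norm (c m) * r ^ mdegree m)) has_sum C * M * ?I) multi_indices"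
      using c(1) by (intro has_sum_cmult_right has_sum_infsum)
  next
    fix h :: 'a assume "h \<in> cube r"
    from has_sum_bounded_linear[OF B.bounded_linear_left c(3)[rule_format, OF this], of "g h"]
    show "((\<lambda>m. monomial_at m h *\<^sub>R B (c m) (g h)) has_sum B (f h) (g h)) multi_indices"
      by (simp add: B.scaleR_left)
  qed (fact r)
  moreover have "C * M * ?I \<le> C * N * M" using mult_left_mono[OF c(2), of "C * M"] M C(2) by (simp add: mult_ac)
  ultimately show ?thesis by (rule cube_series_mono)
qed

lemma cube_series_prod:
  fixes f :: "'i \<Rightarrow> 'a::euclidean_space \<Rightarrow> real"
  assumes "finite I" "\<And>i. i \<in> I \<Longrightarrow> cube_series r (N i) (f i)" "r > 0"
  shows "cube_series r (\<Prod>i\<in>I. N i) (\<lambda>h. \<Prod>i\<in>I. f i h)"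
  using assms(1,2)
proof (induction I rule: finite_induct)
  case empty
  show ?case using cube_series_const[OF assms(3), of "1::real"] by simp
next
  case (insert i I)
  have "cube_series r (1 * N i * (\<Prod>i\<in>I. N i)) (\<lambda>h. f i h * (\<Prod>i\<in>I. f i h))"
    by (rule cube_series_bilinear[OF _ _ assms(3) bounded_bilinear_mult])
      (use insert in \<open>auto simp: abs_mult\<close>)
  with insert show ?case by simp
qed

lemma cube_series_coordinate:
  assumes "b \<in> Basis" "r > 0"
  shows "cube_series r r (\<lambda>h. h \<bullet> b)"
proof -
  let ?k = "\<lambda>i. if i = b then 1 else 0 :: nat"
  have "mdegree ?k = 1" using assms(1) by (simp add: mdegree_def)
  moreover have "monomial_at ?k h = h \<bullet> b" for h
  proof -
    have "monomial_at ?k h = (\<Prod>i\<in>Basis. if i = b then h \<bullet> b else 1)"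
      unfolding monomial_at_def by (rule prod.cong) auto
    then show ?thesis using assms(1) by simp
  qed
  ultimately show ?thesis
    using cube_series_monomial[OF cube_series_const[OF assms(2), of "1::real"] assms(2), of ?k] by simp
qed

lemma cube_subset:
  assumes "s \<le> r"
  shows "cube s \<subseteq> cube r"
proof
  fix h :: 'a assume h: "h \<in> cube s"
  have "\<bar>h \<bullet> i\<bar> \<le> r" if "i \<in> Basis" for i
    using h that assms unfolding cube_def by (metis (lifting) mem_Collect_eq order_trans)
  then show "h \<in> cube r" by (simp add: cube_def)
qed

lemma multi_index_nonzero:
  assumes "m \<in> multi_indices" "m \<noteq> (\<lambda>i\<in>Basis. 0)"
  obtains i where "i \<in> Basis" "m i \<noteq> 0"
proof -
  have "\<exists>i\<in>Basis. m i \<noteq> 0"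
  proof (rule ccontr)
    assume "\<not> (\<exists>i\<in>Basis. m i \<noteq> 0)"
    then have "m = (\<lambda>i\<in>Basis. 0)" by (intro PiE_ext[OF assms(1)]) auto
    with assms(2) show False by contradiction
  qed
  with that show thesis by blast
qed

text \<open>Without a constant term, every monomial has degree at least one and gains a factor \<open>s / r\<close> on the
  smaller cube. This is what makes the inner map of a composition small.\<close>

lemma cube_series_shrink:
  fixes f :: "'a::euclidean_space \<Rightarrow> 'b::euclidean_space"
  assumes f: "cube_series r N f" and s: "0 < s" "s \<le> r" and f0: "f 0 = 0"
  shows "cube_series s (s / r * N) f"
proof -
  obtain c where c: "(\<lambda>m. norm (c m) * r ^ mdegree m) summable_on multi_indices"
     "infsum (\<lambda>m. norm (c m) * r ^ mdegree m) multi_indices \<le> N"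
     "\<forall>h\<in>cube r. ((\<lambda>m. monomial_at m h *\<^sub>R c m) has_sum f h) multi_indices"
    using f by (rule cube_seriesE) (rule that)
  let ?z = "\<lambda>i\<in>Basis :: 'a set. 0 :: nat"
  have mz: "monomial_at m 0 = 0" if m: "m \<in> multi_indices - {?z}" for m :: "'a \<Rightarrow> nat"
  proof -
    obtain i where "i \<in> Basis" "m i \<noteq> 0" using m multi_index_nonzero[of m] by blast
    then show ?thesis unfolding monomial_at_def by (auto intro!: prod_zero)
  qed
  have "((\<lambda>m. monomial_at m 0 *\<^sub>R c m) has_sum c ?z) multi_indices"
    by (rule has_sum_finite_neutralI[of "{?z}"]) (use mz in \<open>auto simp: monomial_at_def\<close>)
  from has_sum_unique[OF this c(3)[rule_format, OF zero_in_cube]] s f0 have cz: "c ?z = 0" by simp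
  have le: "norm (c m) * s ^ mdegree m \<le> s / r * (norm (c m) * r ^ mdegree m)"
    if m: "m \<in> multi_indices" for m
  proof (cases "m = ?z")
    case False
    obtain i where i: "i \<in> Basis" "m i \<noteq> 0" using m False multi_index_nonzero[of m] by blast
    then have "mdegree m \<ge> 1" using member_le_sum[of i Basis m] by (simp add: mdegree_def)
    then obtain n where n: "mdegree m = Suc n" by (cases "mdegree m") auto
    have "s ^ n \<le> r ^ n" using s by (intro power_mono) auto
    then have "s * s ^ n \<le> s * r ^ n" using s by simp
    then have "s ^ mdegree m \<le> s / r * r ^ mdegree m" using s n by simp
    from mult_left_mono[OF this norm_ge_zero[of "c m"]] show ?thesis by (simp add: mult_ac)
  qed (simp add: cz)
  have S: "((\<lambda>m. s / r * (norm (c m) * r ^ mdegree m)) has_sum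
      s / r * infsum (\<lambda>m. norm (c m) * r ^ mdegree m) multi_indices) multi_indices"
    using c(1) by (intro has_sum_cmult_right has_sum_infsum)
  have S': "(\<lambda>m. norm (c m) * s ^ mdegree m) summable_on multi_indices"
    by (rule summable_on_comparison_test[OF has_sum_imp_summable[OF S]]) (use le s in auto)
  have "infsum (\<lambda>m. norm (c m) * s ^ mdegree m) multi_indices
     \<le> s / r * infsum (\<lambda>m. norm (c m) * r ^ mdegree m) multi_indices"
    using infsum_mono[OF S' has_sum_imp_summable[OF S] le] S by (simp add: has_sum_iff)
  also have "\<dots> \<le> s / r * N" using c(2) s by (intro mult_left_mono) auto
  finally show ?thesis
    by (rule cube_seriesI[OF S']) (use c(3) cube_subset[OF s(2)] in blast)
qed

lemma cube_series_subcube: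
  assumes f: "cube_series r N f" and s: "0 \<le> s" "s \<le> r"
  shows "cube_series s N f"
proof -
  obtain c where c: "(\<lambda>m. norm (c m) * r ^ mdegree m) summable_on multi_indices"
     "infsum (\<lambda>m. norm (c m) * r ^ mdegree m) multi_indices \<le> N"
     "\<forall>h\<in>cube r. ((\<lambda>m. monomial_at m h *\<^sub>R c m) has_sum f h) multi_indices"
    using f by (rule cube_seriesE) (rule that)
  have le: "norm (c m) * s ^ mdegree m \<le> norm (c m) * r ^ mdegree m" for m
    using s by (intro mult_left_mono power_mono) auto
  have S': "(\<lambda>m. norm (c m) * s ^ mdegree m) summable_on multi_indices"
    by (rule summable_on_comparison_test[OF c(1)]) (use le s in auto)
  have "infsum (\<lambda>m. norm (c m) * s ^ mdegree m) multi_indices \<le> N"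
    using infsum_mono[OF S' c(1) le] c(2) by (rule order_trans)
  then show ?thesis
    by (rule cube_seriesI[OF S']) (use c(3) cube_subset[OF s(2)] in blast)
qed

lemma summable_on_imp_abs_summable_on_euclidean:
  fixes f :: "'i \<Rightarrow> 'b::euclidean_space"
  assumes "f summable_on A"
  shows "(\<lambda>x. norm (f x)) summable_on A"
proof -
  have comp: "(\<lambda>x. \<bar>f x \<bullet> b\<bar>) summable_on A" for b
    using summable_on_bounded_linear[OF bounded_linear_inner_left assms, of b]
    by (simp only: summable_on_iff_abs_summable_on_real[of "\<lambda>x. f x \<bullet> b"] real_norm_def)
  have "(\<lambda>x. \<Sum>b\<in>B. \<bar>f x \<bullet> b\<bar>) summable_on A" if "finite B" for B
    using that
  proof (induction B rule: finite_induct)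
    case (insert b B)
    with summable_on_add[OF comp[of b] insert.IH] show ?case by simp
  qed simp
  from this[OF finite_Basis] show ?thesis
    by (rule Infinite_Sum.abs_summable_on_comparison_test') (rule norm_le_l1)
qed

lemma cube_series_imp_real_analytic_at:
  assumes "cube_series r N (\<lambda>h. f (x + h))" "r > 0"
  shows "real_analytic_at f x"
proof -
  obtain c where c: 
     "\<forall>h\<in>cube r. ((\<lambda>m. monomial_at m h *\<^sub>R c m) has_sum f (x + h)) multi_indices"
    using assms(1) by (rule cube_seriesE) (rule that)
  have "((\<lambda>m. (\<Prod>i\<in>Basis. (inner (y - x) i) ^ m i) *\<^sub>R c m) has_sum f y) (Basis \<rightarrow>\<^sub>E UNIV)"
    if y: "y \<in> ball x r" for y
  proof -
    have "y - x \<in> cube r"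
      using y Basis_le_norm[of _ "y - x"] by (force simp: cube_def dist_norm norm_minus_commute)
    from c[rule_format, OF this] show ?thesis by (simp add: monomial_at_def)
  qed
  then show ?thesis unfolding real_analytic_at_def using assms(2) by blast
qed

lemma norm_less_of_in_cube:
  assumes "h \<in> cube (r / (DIM('a) + 1))" "r > 0"
  shows "norm (h :: 'a::euclidean_space) < r"
proof -
  have "norm h \<le> (\<Sum>i\<in>Basis. \<bar>h \<bullet> i\<bar>)" by (rule norm_le_l1)
  also have "\<dots> \<le> of_nat (card (Basis :: 'a set)) * (r / (DIM('a) + 1))"
    by (rule sum_bounded_above) (use assms(1) in \<open>auto simp: cube_def\<close>)
  also have "\<dots> < r" using assms(2) by (simp add: field_simps)
  finally show ?thesis .
qed

text \<open>Convergence at the corner of a cube, where all coordinates equal the same positive number, is already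
  the weighted summability of the coefficients, since unordered convergence in a finite-dimensional
  space is absolute.\<close>

lemma real_analytic_at_imp_cube_series:
  fixes f :: "'a::euclidean_space \<Rightarrow> 'b::euclidean_space"
  assumes "real_analytic_at f x"
  shows "\<exists>r>0. \<exists>N. cube_series r N (\<lambda>h. f (x + h))"
proof -
  obtain r c where r: "r > 0" and c: "\<And>y. y \<in> ball x r \<Longrightarrow>
      ((\<lambda>m. (\<Prod>i\<in>Basis. (inner (y - x) i) ^ m i) *\<^sub>R c m) has_sum f y) multi_indices"
    using assms unfolding real_analytic_at_def by blast
  define s where "s = r / (DIM('a) + 1)"
  have s: "s > 0" using r by (simp add: s_def)
  have nr: "norm h < r" if "h \<in> cube s" for h :: 'a
    using norm_less_of_in_cube[OF that[unfolded s_def] r] .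
  have c': "((\<lambda>m. monomial_at m h *\<^sub>R c m) has_sum f (x + h)) multi_indices" if "h \<in> cube s" for h
    using c[of "x + h"] nr[OF that] by (simp add: monomial_at_def dist_norm)
  define k :: 'a where "k = (\<Sum>i\<in>Basis. s *\<^sub>R i)"
  have ki: "k \<bullet> i = s" if "i \<in> Basis" for i using that by (simp add: k_def inner_sum_left inner_Basis if_distrib cong: if_cong)
  have kc: "k \<in> cube s" using s by (simp add: cube_def ki)
  have "monomial_at m k = s ^ mdegree m" for m by (simp add: monomial_at_def ki mdegree_def power_sum)
  with c'[OF kc] have "((\<lambda>m. s ^ mdegree m *\<^sub>R c m) has_sum f (x + k)) multi_indices" by simp
  then have "(\<lambda>m. norm (s ^ mdegree m *\<^sub>R c m)) summable_on multi_indices"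
    by (intro summable_on_imp_abs_summable_on_euclidean) (auto simp: has_sum_iff)
  then have "(\<lambda>m. norm (c m) * s ^ mdegree m) summable_on multi_indices"
    using s by (simp add: mult.commute)
  then have "cube_series s (infsum (\<lambda>m. norm (c m) * s ^ mdegree m) multi_indices) (\<lambda>h. f (x + h))"
    using c' by (intro cube_seriesI) auto
  then show ?thesis using s by blast
qed

text \<open>Substitute the coordinates of \<open>f (x + h) - f x\<close>, made smaller than the radius of the outer series by
  shrinking the cube, into the monomials of the outer series.\<close>

lemma real_analytic_at_compose:
  fixes f :: "'a::euclidean_space \<Rightarrow> 'b::euclidean_space" and g :: "'b \<Rightarrow> 'c::euclidean_space"
  assumes f: "real_analytic_at f x" and g: "real_analytic_at g (f x)"
  shows "real_analytic_at (\<lambda>y. g (f y)) x"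
proof -
  obtain r N where r: "r > 0" and F: "cube_series r N (\<lambda>h. f (x + h))"
    using real_analytic_at_imp_cube_series[OF f] by blast
  obtain R M where R: "R > 0" and G: "cube_series R M (\<lambda>k. g (f x + k))"
    using real_analytic_at_imp_cube_series[OF g] by blast
  define \<phi> where "\<phi> h = f (x + h) + - f x" for h
  define N' where "N' = N + norm (f x)"
  have \<phi>r: "cube_series r N' \<phi>"
    unfolding \<phi>_def N'_def
    using cube_series_add[OF F cube_series_const[of r "- f x"]] r by simp
  have N': "N' \<ge> 0" using cube_series_nonneg[OF \<phi>r] r by simp
  \<comment> \<open>so that \<open>s / r * N'\<close>, the bound for the increment on the smaller cube, is at most \<open>R\<close>\<close>
  define s where "s = min r (R * r / (N' + 1))"
  have s: "0 < s" "s \<le> r" using r R N' by (auto simp: s_def)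
  have "s * (N' + 1) \<le> R * r" using N' by (simp add: s_def min_def pos_le_divide_eq not_le split: if_splits)
  then have "s * N' \<le> R * r" using s N' by (simp add: algebra_simps)
  then have "s / r * N' \<le> R" using r by (simp add: field_simps)
  with cube_series_shrink[OF \<phi>r s] have \<phi>s: "cube_series s R \<phi>"
    by (simp add: \<phi>_def cube_series_mono)
  have comp: "cube_series s R (\<lambda>h. \<phi> h \<bullet> i)" if "i \<in> Basis" for i
    using cube_series_linear[OF \<phi>s, of "\<lambda>v. v \<bullet> i" 1] s that
    by (simp add: Basis_le_norm linear_conv_bounded_linear bounded_linear_inner_left)
  obtain c where c: "(\<lambda>m. norm (c m) * R ^ mdegree m) summable_on multi_indices"
     "\<forall>k\<in>cube R. ((\<lambda>m. monomial_at m k *\<^sub>R c m) has_sum g (f x + k)) multi_indices"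
    using G by (rule cube_seriesE) (rule that)
  have "cube_series s (infsum (\<lambda>m. norm (c m) * R ^ mdegree m) multi_indices) (\<lambda>h. g (f (x + h)))"
  proof (rule cube_series_has_sum[OF _ _ has_sum_infsum[OF c(1)]])
    fix m :: "'b \<Rightarrow> nat"
    have "cube_series s (\<Prod>i\<in>Basis. R ^ m i) (\<lambda>h. monomial_at m (\<phi> h))"
      unfolding monomial_at_def
    proof (rule cube_series_prod)
      fix i :: 'b assume i: "i \<in> Basis"
      show "cube_series s (R ^ m i) (\<lambda>h. (\<phi> h \<bullet> i) ^ m i)"
        using cube_series_prod[of "{..<m i}" s "\<lambda>_. R" "\<lambda>_ h. \<phi> h \<bullet> i"] comp[OF i] s by simp
    qed (use s in auto)
    then have "cube_series s (R ^ mdegree m) (\<lambda>h. monomial_at m (\<phi> h))"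
      by (simp add: mdegree_def power_sum)
    then show "cube_series s (norm (c m) * R ^ mdegree m) (\<lambda>h. monomial_at m (\<phi> h) *\<^sub>R c m)"
      by (rule cube_series_linear[where T = "\<lambda>t. t *\<^sub>R c m"])
        (use s in \<open>auto simp: mult.commute linear_conv_bounded_linear bounded_linear_scaleR_left\<close>)
  next
    fix h :: 'a assume "h \<in> cube s"
    then have "\<phi> h \<in> cube R" using cube_series_norm_le[OF comp] by (simp add: cube_def)
    from c(2)[rule_format, OF this] show "((\<lambda>m. monomial_at m (\<phi> h) *\<^sub>R c m) has_sum g (f (x + h))) multi_indices"
      by (simp add: \<phi>_def)
  qed (use s in auto)
  then show ?thesis by (rule cube_series_imp_real_analytic_at) (fact s)
qed

lemma real_analytic_at_bilinear:
  assumes f: "real_analytic_at f x" and g: "real_analytic_at g x" and B: "bounded_bilinear B"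
  shows "real_analytic_at (\<lambda>y. B (f y) (g y)) x"
proof -
  obtain r N where r: "r > 0" and F: "cube_series r N (\<lambda>h. f (x + h))"
    using real_analytic_at_imp_cube_series[OF f] by blast
  obtain s M where s: "s > 0" and G: "cube_series s M (\<lambda>h. g (x + h))"
    using real_analytic_at_imp_cube_series[OF g] by blast
  obtain K where K: "K \<ge> 0" "\<And>x y. norm (B x y) \<le> norm x * norm y * K"
    using bounded_bilinear.nonneg_bounded[OF B] by blast
  have "cube_series (min r s) (K * N * M) (\<lambda>h. B (f (x + h)) (g (x + h)))"
    by (rule cube_series_bilinear[OF cube_series_subcube[OF F] cube_series_subcube[OF G] _ B])
      (use r s K in \<open>auto simp: mult_ac\<close>)
  then show ?thesis by (rule cube_series_imp_real_analytic_at) (use r s in auto)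
qed

lemma real_analytic_at_const: "real_analytic_at (\<lambda>_. v) x"
  using cube_series_imp_real_analytic_at[OF cube_series_const[of 1 v]] by simp

lemma real_analytic_at_add:
  assumes f: "real_analytic_at f x" and g: "real_analytic_at g x"
  shows "real_analytic_at (\<lambda>y. f y + g y) x"
proof -
  obtain r N where r: "r > 0" and F: "cube_series r N (\<lambda>h. f (x + h))"
    using real_analytic_at_imp_cube_series[OF f] by blast
  obtain s M where s: "s > 0" and G: "cube_series s M (\<lambda>h. g (x + h))"
    using real_analytic_at_imp_cube_series[OF g] by blast
  have "cube_series (min r s) (N + M) (\<lambda>h. f (x + h) + g (x + h))"
    by (rule cube_series_add[OF cube_series_subcube[OF F] cube_series_subcube[OF G]]) (use r s in auto)
  then show ?thesis by (rule cube_series_imp_real_analytic_at) (use r s in auto)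
qed

lemma cube_series_id: 
  assumes "r > 0"
  shows "\<exists>N. cube_series r N (\<lambda>h::'a::euclidean_space. h)"
proof -
  have "cube_series r r (\<lambda>h. (h \<bullet> b) *\<^sub>R b)" if "b \<in> Basis" for b :: 'a
    using cube_series_linear[OF cube_series_coordinate[OF that assms], of "\<lambda>t. t *\<^sub>R b" 1] that assms
    by (simp add: linear_conv_bounded_linear bounded_linear_scaleR_left)
  from cube_series_sum[where F = "\<lambda>b h. (h \<bullet> b) *\<^sub>R b", OF finite_Basis this assms]
  have "cube_series r (\<Sum>b\<in>(Basis :: 'a set). r) (\<lambda>h::'a. h)"
    by (simp only: euclidean_representation)
  then show ?thesis by (rule exI)
qed

lemma real_analytic_at_ident: "real_analytic_at (\<lambda>y. y) x"
proof -
  obtain N where "cube_series 1 N (\<lambda>h::'a. h)" using cube_series_id[of 1] by auto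
  from cube_series_add[OF cube_series_const[of 1 x] this]
  show ?thesis by (intro cube_series_imp_real_analytic_at[of 1]) auto
qed

lemma real_analytic_at_linear:
  assumes "linear T" "real_analytic_at f x"
  shows "real_analytic_at (\<lambda>y. T (f y)) x"
proof -
  obtain r N where r: "r > 0" and F: "cube_series r N (\<lambda>h. f (x + h))"
    using real_analytic_at_imp_cube_series[OF assms(2)] by blast
  obtain K where "K \<ge> 0" "\<And>v. norm (T v) \<le> norm v * K"
    using assms(1) bounded_linear.nonneg_bounded linear_conv_bounded_linear by blast
  with cube_series_linear[OF F _ assms(1), of K] r
  show ?thesis by (intro cube_series_imp_real_analytic_at[of r]) (auto simp: mult.commute)
qed

lemma real_analytic_at_Pair:
  assumes "real_analytic_at f x" "real_analytic_at g x"
  shows "real_analytic_at (\<lambda>y. (f y, g y)) x"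
proof -
  have "linear (\<lambda>a::'b. (a, 0::'c))" "linear (\<lambda>b::'c. (0::'b, b))" by (auto intro!: linearI)
  from real_analytic_at_add[OF real_analytic_at_linear[OF this(1) assms(1)]
      real_analytic_at_linear[OF this(2) assms(2)]]
  show ?thesis by simp
qed

lemma real_analytic_at_fst: "real_analytic_at f x \<Longrightarrow> real_analytic_at (\<lambda>y. fst (f y)) x"
  by (rule real_analytic_at_linear) (auto intro: bounded_linear.linear bounded_linear_fst)

lemma real_analytic_at_snd: "real_analytic_at f x \<Longrightarrow> real_analytic_at (\<lambda>y. snd (f y)) x"
  by (rule real_analytic_at_linear) (auto intro: bounded_linear.linear bounded_linear_snd)

lemma real_analytic_at_scaleR: "real_analytic_at f x \<Longrightarrow> real_analytic_at (\<lambda>y. k *\<^sub>R f y) x"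
  by (rule real_analytic_at_linear) (auto intro: bounded_linear.linear bounded_linear_scaleR_right)

lemma real_analytic_at_diff:
  assumes "real_analytic_at f x" "real_analytic_at g x"
  shows "real_analytic_at (\<lambda>y. f y - g y) x"
  using real_analytic_at_add[OF assms(1) real_analytic_at_scaleR[OF assms(2), of "-1"]] by simp

lemma real_analytic_onI:
  assumes "open U" "S \<subseteq> U" "\<And>y. y \<in> U \<Longrightarrow> real_analytic_at g y" "\<And>y. y \<in> S \<Longrightarrow> g y = f y"
  shows "real_analytic_on S f"
  using assms unfolding real_analytic_on_def by (meson IntD1 subsetD)

lemma bianalyticI:
  assumes S: "open U" "S \<subseteq> U" "\<And>y. y \<in> U \<Longrightarrow> real_analytic_at f y"
    and T: "open W" "T \<subseteq> W" "\<And>y. y \<in> W \<Longrightarrow> real_analytic_at g y"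
    and f: "\<And>x. x \<in> S \<Longrightarrow> f x \<in> T \<and> g (f x) = x" and g: "\<And>y. y \<in> T \<Longrightarrow> g y \<in> S \<and> f (g y) = y"
  shows "bianalytic S T f \<and> (\<forall>y\<in>T. inv_into S f y = g y)"
proof -
  have bij: "bij_betw f S T" by (rule bij_betwI[of _ _ _ g]) (use f g in auto)
  then have inv: "inv_into S f y = g y" if "y \<in> T" for y
    using that f g by (metis bij_betw_inv_into_left)
  show ?thesis unfolding bianalytic_def
    using bij inv real_analytic_onI[OF S] real_analytic_onI[OF T, of "inv_into S f"] by auto
qed

section \<open>Consequences of the Jordan identity\<close>

lemma jmult_add_right: "x \<odot> (y + z) = x \<odot> y + x \<odot> (z :: 'a::euclidean_jordan_algebra)"
  by (metis jmult_add_left jmult_commute)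

lemma jmult_scaleR_right: "x \<odot> (r *\<^sub>R y) = r *\<^sub>R (x \<odot> (y :: 'a::euclidean_jordan_algebra))"
  by (metis jmult_scaleR_left jmult_commute)

lemma bounded_bilinear_jmult: "bounded_bilinear ((\<odot>) :: 'a::euclidean_jordan_algebra \<Rightarrow> 'a \<Rightarrow> 'a)"
proof -
  have "bilinear ((\<odot>) :: 'a \<Rightarrow> 'a \<Rightarrow> 'a)"
    by (auto simp: bilinear_def jmult_add_left jmult_add_right jmult_scaleR_left jmult_scaleR_right
        intro!: linearI)
  then show ?thesis by (simp add: bilinear_conv_bounded_bilinear)
qed

interpretation jmult: bounded_bilinear "(\<odot>) :: 'a::euclidean_jordan_algebra \<Rightarrow> 'a \<Rightarrow> 'a"
  by (rule bounded_bilinear_jmult)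

lemma jmult_one_right: "x \<odot> jone = (x :: 'a::euclidean_jordan_algebra)"
  by (metis jone_jmult jmult_commute)

lemma inner_jmult_left: "(x \<odot> y) \<bullet> z = x \<bullet> (y \<odot> (z :: 'a::euclidean_jordan_algebra))"
  unfolding jmult_commute[of x y] by (rule inner_jmult)

lemma linear_jmult: "linear ((\<odot>) (x :: 'a::euclidean_jordan_algebra))"
  by (rule bounded_linear.linear[OF jmult.bounded_linear_right])

text \<open>Full polarization of the cubic identity \<open>x ((x x) v) = (x x) (x v)\<close>. Read as operators acting on
  \<open>v\<close> it is the cyclic sum of the commutators \<open>[L(x), L(y z)]\<close>.\<close>

lemma jordan_linearized:
  fixes x y z v :: "'a::euclidean_jordan_algebra"
  shows "x \<odot> ((y \<odot> z) \<odot> v) + y \<odot> ((z \<odot> x) \<odot> v) + z \<odot> ((x \<odot> y) \<odot> v)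
    = (y \<odot> z) \<odot> (x \<odot> v) + (z \<odot> x) \<odot> (y \<odot> v) + (x \<odot> y) \<odot> (z \<odot> v)"
    (is "?L = ?R")
proof -
  define F where "F x = x \<odot> ((x \<odot> x) \<odot> v) - (x \<odot> x) \<odot> (x \<odot> v)" for x
  have F0: "F x = 0" for x by (simp add: F_def jordan_identity)
  have c: "y \<odot> x = x \<odot> y" "z \<odot> x = x \<odot> z" "z \<odot> y = y \<odot> z" by (rule jmult_commute)+
  have "F (x + y + z) - F (x + y) - F (y + z) - F (x + z) + F x + F y + F z = 2 *\<^sub>R (?L - ?R)"
    unfolding F_def scaleR_2 by (simp add: jmult_add_left jmult_add_right c)
  then show ?thesis by (simp add: F0)
qed

text \<open>The linearized identity again, but read as an identity between operators acting on \<open>x\<close>: it expresses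
  the multiplication by a triple product through multiplications by shorter products.\<close>

lemma jordan_operator_identity:
  fixes x y z v :: "'a::euclidean_jordan_algebra"
  shows "((y \<odot> z) \<odot> v) \<odot> x = (y \<odot> z) \<odot> (v \<odot> x) + (y \<odot> v) \<odot> (z \<odot> x) + (z \<odot> v) \<odot> (y \<odot> x)
    - y \<odot> (v \<odot> (z \<odot> x)) - z \<odot> (v \<odot> (y \<odot> x))"
proof -
  have c: "x \<odot> ((y \<odot> z) \<odot> v) = ((y \<odot> z) \<odot> v) \<odot> x" "(z \<odot> x) \<odot> v = v \<odot> (z \<odot> x)"
    "(x \<odot> y) \<odot> v = v \<odot> (y \<odot> x)" "x \<odot> v = v \<odot> x" "(z \<odot> x) \<odot> (y \<odot> v) = (y \<odot> v) \<odot> (z \<odot> x)"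
    "(x \<odot> y) \<odot> (z \<odot> v) = (z \<odot> v) \<odot> (y \<odot> x)"
    by (simp_all only: jmult_commute)
  from jordan_linearized[of x y z v] show ?thesis unfolding c by (simp add: algebra_simps)
qed

section \<open>Powers of an element\<close>

primrec jpower :: "'a::euclidean_jordan_algebra \<Rightarrow> nat \<Rightarrow> 'a" where
  "jpower x 0 = jone"
| "jpower x (Suc n) = x \<odot> jpower x n"

text \<open>Multiplication by \<open>x\<^bsup>n+2\<^esup>\<close> is a polynomial in the multiplications by \<open>x\<close>, \<open>x\<^sup>2\<close>, \<open>x\<^sup>n\<close> and
  \<open>x\<^bsup>n+1\<^esup>\<close>, so by induction all powers act by polynomials in the operators of \<open>x\<close> and \<open>x\<^sup>2\<close>.\<close>

lemma jpower_commutes_with_commutant: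
  assumes T: "linear T" and c1: "\<And>v. T (x \<odot> v) = x \<odot> T v"
    and c2: "\<And>v. T ((x \<odot> x) \<odot> v) = (x \<odot> x) \<odot> T v"
  shows "T (jpower x n \<odot> v) = jpower x n \<odot> T v"
proof (induction n arbitrary: v rule: less_induct)
  case (less n)
  consider "n = 0" | "n = 1" | m where "n = Suc (Suc m)" by (metis One_nat_def not0_implies_Suc)
  then show ?case
  proof cases
    case 3
    have J: "jpower x (Suc (Suc m)) \<odot> w = jpower x (Suc m) \<odot> (x \<odot> w) + (x \<odot> x) \<odot> (jpower x m \<odot> w)
        + jpower x (Suc m) \<odot> (x \<odot> w) - x \<odot> (x \<odot> (jpower x m \<odot> w)) - jpower x m \<odot> (x \<odot> (x \<odot> w))" for w
      using jordan_operator_identity[of x "jpower x m" x w]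
      by (simp add: jmult_commute[of "x \<odot> jpower x m" x] jmult_commute[of "jpower x m" x])
    have I: "T (jpower x m \<odot> w) = jpower x m \<odot> T w" "T (jpower x (Suc m) \<odot> w) = jpower x (Suc m) \<odot> T w" for w
      by (rule less; simp add: 3)+
    show ?thesis unfolding 3 J
      by (simp only: linear_add[OF T] linear_diff[OF T] I c1 c2)
  qed (simp_all add: jone_jmult jmult_one_right c1)
qed

lemma jpower_operators_commute: "jpower x m \<odot> (jpower x n \<odot> v) = jpower x n \<odot> (jpower x m \<odot> v)"
proof (rule jpower_commutes_with_commutant[OF linear_jmult])
  fix v
  show "jpower x m \<odot> (x \<odot> v) = x \<odot> (jpower x m \<odot> v)" for v
    by (rule sym, rule jpower_commutes_with_commutant[OF linear_jmult]) (simp_all add: jordan_identity)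
  show "jpower x m \<odot> ((x \<odot> x) \<odot> v) = (x \<odot> x) \<odot> (jpower x m \<odot> v)"
    by (rule sym, rule jpower_commutes_with_commutant[OF linear_jmult]) (simp_all add: jordan_identity)
qed

lemma jpower_add: "jpower x m \<odot> jpower x n = jpower x (m + n)"
proof (induction m)
  case (Suc m)
  have "(x \<odot> jpower x m) \<odot> jpower x n = jpower x n \<odot> (x \<odot> jpower x m)" by (rule jmult_commute)
  also have "\<dots> = x \<odot> (jpower x n \<odot> jpower x m)"
    using jpower_operators_commute[of x n 1 "jpower x m"] by (simp add: jmult_one_right)
  also have "\<dots> = x \<odot> (jpower x m \<odot> jpower x n)" by (simp only: jmult_commute[of "jpower x n"])
  finally show ?case using Suc by simp
qed (simp add: jone_jmult)

text \<open>The algebra generated by \<open>x\<close>, which power associativity makes commutative and associative.\<close>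

definition power_span :: "'a::euclidean_jordan_algebra \<Rightarrow> 'a set" where
  "power_span x = span (range (jpower x))"

lemma subspace_power_span: "subspace (power_span x)"
  by (simp add: power_span_def)

lemma jpower_in_power_span: "jpower x n \<in> power_span x"
  by (simp add: power_span_def span_base)

lemma power_span_induct [consumes 1, case_names subspace jpower]:
  assumes "p \<in> power_span x" "subspace {p. P p}" "\<And>n. P (jpower x n)"
  shows "P p"
  by (rule span_induct[OF assms(1)[unfolded power_span_def], where P = P]) (use assms(2,3) in auto)

lemma power_span_operators_commute:
  assumes "p \<in> power_span x" "q \<in> power_span x"
  shows "p \<odot> (q \<odot> v) = q \<odot> (p \<odot> v)"
  using assms(1)
proof (induction rule: power_span_induct)
  case (jpower m)
  show ?case using assms(2)
    by (induction rule: power_span_induct)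
      (simp_all add: jpower_operators_commute subspace_def jmult_add_left jmult_add_right
        jmult.zero_left jmult.zero_right jmult_scaleR_left jmult_scaleR_right)
qed (simp_all add: subspace_def jmult_add_left jmult_add_right
        jmult.zero_left jmult.zero_right jmult_scaleR_left jmult_scaleR_right)

lemma power_span_jmult:
  assumes "p \<in> power_span x" "q \<in> power_span x"
  shows "p \<odot> q \<in> power_span x"
  using assms(1)
proof (induction rule: power_span_induct)
  case (jpower m)
  show ?case using assms(2)
    by (induction rule: power_span_induct)
      (use subspace_power_span[of x] jpower_in_power_span[of x] in \<open>simp_all add: jpower_add subspace_def jmult_add_right
        jmult.zero_right jmult_scaleR_right\<close>)
qed (use subspace_power_span[of x] in \<open>simp_all add: subspace_def jmult_add_left
        jmult.zero_left jmult_scaleR_left\<close>)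

lemma power_span_assoc:
  assumes "p \<in> power_span x" "q \<in> power_span x" "r \<in> power_span x"
  shows "(p \<odot> q) \<odot> r = p \<odot> (q \<odot> r)"
proof -
  have "(p \<odot> q) \<odot> r = r \<odot> (p \<odot> q)" by (rule jmult_commute)
  also have "\<dots> = p \<odot> (r \<odot> q)" by (rule power_span_operators_commute[OF assms(3,1)])
  also have "r \<odot> q = q \<odot> r" by (rule jmult_commute)
  finally show ?thesis .
qed

section \<open>The spectral theorem\<close>

text \<open>Otherwise moving from \<open>v\<close> in the direction \<open>- T v\<close> would make the quadratic form negative, because its
  first-order change there is \<open>- 2 (T v \<bullet> T v)\<close>.\<close>

lemma psd_kernel:
  fixes T :: "'a::euclidean_space \<Rightarrow> 'a"
  assumes B: "subspace B" and T: "linear T" and inv: "\<And>u. u \<in> B \<Longrightarrow> T u \<in> B"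
    and sa: "\<And>u w. u \<in> B \<Longrightarrow> w \<in> B \<Longrightarrow> T u \<bullet> w = u \<bullet> T w"
    and psd: "\<And>u. u \<in> B \<Longrightarrow> T u \<bullet> u \<ge> 0" and v: "v \<in> B" "T v \<bullet> v = 0"
  shows "T v = 0"
proof (rule ccontr)
  assume nz: "T v \<noteq> 0"
  define p where "p = T v \<bullet> T v"
  define q where "q = T (T v) \<bullet> T v"
  have p: "p > 0" using nz by (simp add: p_def)
  have q: "q \<ge> 0" using psd[OF inv[OF v(1)]] by (simp add: q_def)
  \<comment> \<open>the denominator \<open>q + 1\<close> instead of \<open>q\<close> covers the case \<open>q = 0\<close>\<close>
  define t where "t = - p / (q + 1)"
  have tq: "t * (q + 1) = - p" using q by (simp add: t_def)
  have "0 \<le> T (v + t *\<^sub>R T v) \<bullet> (v + t *\<^sub>R T v)"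
    by (rule psd) (use B v inv in \<open>auto intro: subspace_add subspace_scale\<close>)
  also have "\<dots> = 2 * t * p + t\<^sup>2 * q"
    using sa[OF inv[OF v(1)] v(1)] v(2)
    by (simp add: linear_add[OF T] linear_scale[OF T] inner_add_left inner_add_right p_def q_def
        power2_eq_square inner_commute algebra_simps)
  also have "\<dots> \<le> 2 * t * p + t * (t * (q + 1))" by (simp add: power2_eq_square algebra_simps)
  also have "\<dots> = t * p" unfolding tq by simp
  also have "\<dots> < 0" using p q by (simp add: t_def divide_neg_pos mult_neg_pos)
  finally show False by simp
qed

text \<open>Maximize the Rayleigh quotient on the unit sphere; at the maximum \<open>l\<close> the operator \<open>l - T\<close> is positive
  semidefinite with vanishing form.\<close>

lemma self_adjoint_eigenvector:
  fixes T :: "'a::euclidean_space \<Rightarrow> 'a"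
  assumes B: "subspace B" "B \<noteq> {0}" and T: "linear T" and inv: "\<And>u. u \<in> B \<Longrightarrow> T u \<in> B"
    and sa: "\<And>u w. u \<in> B \<Longrightarrow> w \<in> B \<Longrightarrow> T u \<bullet> w = u \<bullet> T w"
  obtains l v where "v \<in> B" "v \<noteq> 0" "T v = l *\<^sub>R v"
proof -
  define S where "S = sphere 0 1 \<inter> B"
  have "compact S" unfolding S_def
    by (intro compact_Int_closed closed_subspace B) auto
  obtain b where b: "b \<in> B" "b \<noteq> 0" using B subspace_0 by blast
  then have "(1 / norm b) *\<^sub>R b \<in> S" using B by (auto simp: S_def intro: subspace_scale)
  then have "S \<noteq> {}" by blast
  have bl: "bounded_linear T" using T by (simp add: linear_conv_bounded_linear)
  have "continuous_on S (\<lambda>u. T u \<bullet> u)"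
    by (intro continuous_intros bounded_linear.continuous_on[OF bl])
  then obtain v where v: "v \<in> S" "\<And>u. u \<in> S \<Longrightarrow> T u \<bullet> u \<le> T v \<bullet> v"
    using continuous_attains_sup[OF \<open>compact S\<close> \<open>S \<noteq> {}\<close>] by blast
  define l where "l = T v \<bullet> v"
  have vB: "v \<in> B" "norm v = 1" using v by (auto simp: S_def)
  have vv: "v \<bullet> v = 1" using vB(2) by (simp add: norm_eq_1)
  have "l *\<^sub>R v - T v = 0"
  proof (rule psd_kernel[where T = "\<lambda>u. l *\<^sub>R u - T u" and B = B])
    show "linear (\<lambda>u. l *\<^sub>R u - T u)"
      by (intro linearI) (simp_all add: linear_add[OF T] linear_scale[OF T] algebra_simps)
    show "(l *\<^sub>R u - T u) \<bullet> u \<ge> 0" if u: "u \<in> B" for u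
    proof (cases "u = 0")
      case False
      define k where "k = 1 / norm u"
      have "k *\<^sub>R u \<in> S" using False u B by (auto simp: S_def k_def intro: subspace_scale)
      from v(2)[OF this] have "k\<^sup>2 * (T u \<bullet> u) \<le> l"
        by (simp add: linear_scale[OF T] l_def power2_eq_square mult.assoc)
      then have "T u \<bullet> u \<le> l * (u \<bullet> u)"
        using False by (simp add: k_def power_divide dot_square_norm field_simps)
      then show ?thesis by (simp add: inner_diff_left)
    qed (simp add: linear_0[OF T])
    show "l *\<^sub>R u - T u \<in> B" if "u \<in> B" for u
      by (intro subspace_diff[OF B(1)] subspace_scale[OF B(1)] inv that)
    show "(l *\<^sub>R u - T u) \<bullet> w = u \<bullet> (l *\<^sub>R w - T w)" if "u \<in> B" "w \<in> B" for u w
      by (simp add: inner_diff_left inner_diff_right sa[OF that])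
    show "(l *\<^sub>R v - T v) \<bullet> v = 0"
      by (simp add: inner_diff_left vv l_def)
  qed (fact B(1) vB(1))+
  then have "T v = l *\<^sub>R v" by simp
  moreover have "v \<noteq> 0" using vB by auto
  ultimately show thesis using that vB by blast
qed

text \<open>Multiplication \<open>L\<close> by an idempotent satisfies \<open>L (2 L - 1) (L - 1) = 0\<close>, so its eigenvalues are
  \<open>0\<close>, \<open>1/2\<close> and \<open>1\<close>. Interpolating at these three points gives \<open>L\<close> as the sum of squares
  \<open>(2 L\<^sup>2 - L)\<^sup>2 + 8 (L - L\<^sup>2)\<^sup>2\<close>.\<close>

lemma idempotent_psd:
  fixes c v :: "'a::euclidean_jordan_algebra"
  assumes c: "c \<odot> c = c"
  shows "(c \<odot> v) \<bullet> v \<ge> 0"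
proof -
  define a where "a = c \<odot> v"
  \<comment> \<open>the first three iterates of \<open>L\<close> at \<open>v\<close>; the sum of squares below is evaluated on their inner products\<close>
  define b where "b = c \<odot> a"
  define d where "d = c \<odot> b"
  have "((c \<odot> c) \<odot> c) \<odot> v = (c \<odot> c) \<odot> (c \<odot> v) + (c \<odot> c) \<odot> (c \<odot> v) + (c \<odot> c) \<odot> (c \<odot> v)
     - c \<odot> (c \<odot> (c \<odot> v)) - c \<odot> (c \<odot> (c \<odot> v))" by (rule jordan_operator_identity)
  then have eq: "a = b + 2 *\<^sub>R b - 2 *\<^sub>R d"
    by (simp add: c a_def[symmetric] b_def[symmetric] d_def[symmetric] scaleR_2 del: add_diff_eq)
  have i: "b \<bullet> v = a \<bullet> a" "d \<bullet> v = a \<bullet> b" "d \<bullet> a = b \<bullet> b" "b \<bullet> a = a \<bullet> b"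
    unfolding b_def d_def a_def by (simp_all add: inner_jmult inner_commute)
  have e1: "a \<bullet> v = 3 * (a \<bullet> a) - 2 * (a \<bullet> b)"
    using arg_cong[OF eq, of "\<lambda>t. t \<bullet> v"] by (simp add: inner_diff_left inner_add_left i)
  have e2: "a \<bullet> a = 3 * (a \<bullet> b) - 2 * (b \<bullet> b)"
    using arg_cong[OF eq, of "\<lambda>t. t \<bullet> a"] by (simp add: inner_diff_left inner_add_left i)
  have "a \<bullet> v = (2 *\<^sub>R b - a) \<bullet> (2 *\<^sub>R b - a) + 8 * ((a - b) \<bullet> (a - b))"
    using e1 e2 by (simp add: inner_diff_left inner_diff_right i algebra_simps)
  then show ?thesis unfolding a_def by simp
qed

lemma inner_idempotents: 
  assumes "d \<odot> d = d"
  shows "c \<bullet> d = (c \<odot> d) \<bullet> (d :: 'a::euclidean_jordan_algebra)"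
  unfolding inner_jmult_left assms ..

lemma idempotent_kernel:
  assumes c: "c \<odot> c = c" and v: "(c \<odot> v) \<bullet> v = 0"
  shows "c \<odot> v = (0 :: 'a::euclidean_jordan_algebra)"
proof (rule psd_kernel[where B = UNIV and T = "(\<odot>) c"])
  show "(c \<odot> u) \<bullet> u \<ge> 0" for u by (rule idempotent_psd[OF c])
  show "(c \<odot> u) \<bullet> w = u \<bullet> (c \<odot> w)" for u w by (rule inner_jmult)
qed (simp_all add: linear_jmult v)

lemma idempotents_orthogonal:
  assumes "c \<odot> c = c" "d \<odot> d = d" "c \<bullet> d = 0"
  shows "c \<odot> d = (0 :: 'a::euclidean_jordan_algebra)"
proof (rule idempotent_kernel[OF assms(1)])
  show "(c \<odot> d) \<bullet> d = 0" using inner_idempotents[OF assms(2), of c] assms(3) by (rule trans[OF sym])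
qed

lemma inner_idempotents_nonneg:
  assumes "c \<odot> c = c" "d \<odot> d = d"
  shows "c \<bullet> d \<ge> (0 :: real)"
  by (subst inner_idempotents[OF assms(2)]) (rule idempotent_psd[OF assms(1)])

definition orthogonal_idempotents :: "'a::euclidean_jordan_algebra set \<Rightarrow> bool" where
  "orthogonal_idempotents C \<longleftrightarrow> finite C \<and> (\<forall>c\<in>C. c \<odot> c = c \<and> c \<noteq> 0) \<and>
     (\<forall>c\<in>C. \<forall>d\<in>C. c \<noteq> d \<longrightarrow> c \<odot> d = 0)"

lemma orthogonal_idempotents_card:
  fixes C :: "'a::euclidean_jordan_algebra set"
  assumes "orthogonal_idempotents C"
  shows "card C \<le> DIM('a)"
proof -
  have "c \<bullet> d = 0" if "c \<in> C" "d \<in> C" "c \<noteq> d" for c d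
    using assms that inner_idempotents[of d c] by (simp add: orthogonal_idempotents_def)
  then have "pairwise orthogonal C" by (auto simp: pairwise_def orthogonal_def)
  moreover have "0 \<notin> C" using assms by (auto simp: orthogonal_idempotents_def)
  ultimately have "independent C" by (rule pairwise_orthogonal_independent)
  from independent_bound[OF this] show ?thesis by simp
qed

lemma maximal_orthogonal_idempotents:
  fixes P :: "'a::euclidean_jordan_algebra set \<Rightarrow> bool"
  assumes "P C0" "\<And>C. P C \<Longrightarrow> orthogonal_idempotents C"
  obtains C where "P C" "\<And>D. P D \<Longrightarrow> card D \<le> card C"
proof -
  have "\<exists>C. P C \<and> (\<forall>D. P D \<longrightarrow> card D \<le> card C)"
    by (rule ex_has_greatest_nat[of P C0 card "DIM('a) + 1"])
      (use assms orthogonal_idempotents_card in \<open>force simp: less_Suc_eq_le\<close>)+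
  with that show thesis by blast
qed

text \<open>A Jordan frame without primitivity of its members.\<close>

definition complete_system :: "'a::euclidean_jordan_algebra set \<Rightarrow> bool" where
  "complete_system C \<longleftrightarrow> orthogonal_idempotents C \<and> (\<Sum>c\<in>C. c) = jone"

lemma orthogonal_idempotents_sum_jmult:
  assumes "orthogonal_idempotents C" "c \<in> C"
  shows "(\<Sum>d\<in>C. l d *\<^sub>R d) \<odot> c = l c *\<^sub>R c"
proof -
  have "(\<Sum>d\<in>C. l d *\<^sub>R d) \<odot> c = (\<Sum>d\<in>C. if d = c then l c *\<^sub>R c else 0)"
    unfolding jmult.sum_left
    by (rule sum.cong) (use assms in \<open>auto simp: orthogonal_idempotents_def jmult_scaleR_left\<close>)
  then show ?thesis using assms by (simp add: orthogonal_idempotents_def)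
qed

text \<open>Take a maximal family of orthogonal idempotents in the algebra \<open>A\<close> generated by \<open>x\<close>, each an eigenvector
  of \<open>L(x)\<close>, and let \<open>s\<close> be what is missing from the identity. If \<open>s \<noteq> 0\<close>, then \<open>L(x)\<close> has an
  eigenvector in \<open>s A\<close>. By associativity its eigenspace \<open>E\<close> there is an ideal of \<open>A\<close>, and the
  orthogonal projection of the identity to \<open>E\<close> is the unit of \<open>E\<close>, which is one more idempotent.\<close>

lemma exists_eigen_system:
  fixes x :: "'a::euclidean_jordan_algebra"
  obtains C where "complete_system C" "\<forall>c\<in>C. \<exists>l. x \<odot> c = l *\<^sub>R c"
proof -
  let ?A = "power_span x"
  define P where "P C \<longleftrightarrow> orthogonal_idempotents C \<and> C \<subseteq> ?A \<and> (\<forall>c\<in>C. \<exists>l. x \<odot> c = l *\<^sub>R c)" for C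
  have "P {}" by (simp add: P_def orthogonal_idempotents_def)
  then obtain C where C: "P C" and max: "\<And>D. P D \<Longrightarrow> card D \<le> card C"
    by (rule maximal_orthogonal_idempotents) (auto simp: P_def)
  have oC: "orthogonal_idempotents C" and CA: "C \<subseteq> ?A" using C by (auto simp: P_def)
  have sub: "subspace ?A" by (rule subspace_power_span)
  have xA: "x \<in> ?A" using jpower_in_power_span[of x 1] by (simp add: jmult_one_right)
  have eA: "jone \<in> ?A" using jpower_in_power_span[of x 0] by simp
  define s where "s = jone - (\<Sum>c\<in>C. c)"
  have sA: "s \<in> ?A" unfolding s_def using sub eA CA by (intro subspace_diff subspace_sum) auto
  have sc: "s \<odot> c = 0" if "c \<in> C" for c
    using orthogonal_idempotents_sum_jmult[OF oC that, of "\<lambda>_. 1"]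
    by (simp add: s_def jmult.diff_left jone_jmult)
  have ss: "s \<odot> s = s"
  proof -
    have "s \<odot> (jone - (\<Sum>c\<in>C. c)) = s \<odot> jone - (\<Sum>c\<in>C. s \<odot> c)"
      by (simp only: jmult.diff_right jmult.sum_right)
    then show ?thesis unfolding s_def[symmetric] by (simp add: sc jmult_one_right)
  qed
  have "s = 0"
  proof (rule ccontr)
    assume s0: "s \<noteq> 0"
    define B where "B = {v \<in> ?A. s \<odot> v = v}"
    have BA: "B \<subseteq> ?A" by (auto simp: B_def)
    have subB: "subspace B" using sub
      by (auto simp: B_def subspace_def jmult_add_right jmult_scaleR_right jmult.zero_right)
    have "s \<in> B" using sA ss by (simp add: B_def)
    with s0 have "B \<noteq> {0}" by blast
    moreover have "x \<odot> u \<in> B" if "u \<in> B" for u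
      using that power_span_jmult[OF xA, of u] power_span_operators_commute[OF sA xA, of u] by (simp add: B_def)
    ultimately obtain l v where v: "v \<in> B" "v \<noteq> 0" "x \<odot> v = l *\<^sub>R v"
      using self_adjoint_eigenvector[OF subB _ linear_jmult[of x]] inner_jmult by metis
    define E where "E = {v \<in> B. x \<odot> v = l *\<^sub>R v}"
    have subE: "subspace E" using subB
      by (auto simp: E_def subspace_def jmult_add_right jmult_scaleR_right jmult.zero_right algebra_simps)
    have EA: "E \<subseteq> ?A" using BA by (auto simp: E_def)
    have ideal: "u \<odot> w \<in> E" if u: "u \<in> E" and w: "w \<in> ?A" for u w
    proof -
      have uA: "u \<in> ?A" using u EA by blast
      have "s \<odot> (u \<odot> w) = u \<odot> w" "x \<odot> (u \<odot> w) = l *\<^sub>R (u \<odot> w)"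
        using power_span_assoc[OF sA uA w] power_span_assoc[OF xA uA w] u
        by (simp_all add: E_def B_def jmult_scaleR_left)
      then show ?thesis using power_span_jmult[OF uA w] by (simp add: E_def B_def)
    qed
    \<comment> \<open>\<open>c\<close> is the projection of the identity to the ideal \<open>E\<close>; for \<open>u \<in> E\<close> the element \<open>u - u \<odot> c\<close>
      is then orthogonal to itself\<close>
    obtain c z where cz: "c \<in> span E" "\<And>w. w \<in> span E \<Longrightarrow> orthogonal z w" "jone = c + z"
      using orthogonal_subspace_decomp_exists[of E jone] by metis
    have cE: "c \<in> E" using cz(1) subE by (metis span_eq_iff)
    have z: "z \<bullet> w = 0" if "w \<in> E" for w using cz(2)[OF span_base[OF that]] by (simp add: orthogonal_def)
    have cA: "c \<in> ?A" using cE EA by blast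
    have unit: "u \<odot> c = u" if u: "u \<in> E" for u
    proof -
      define w where "w = u \<odot> z"
      have wz: "w = u - u \<odot> c" using cz(3) jmult_one_right[of u] unfolding w_def
        by (metis jmult_add_right add_diff_cancel_left')
      have "w \<in> ?A" unfolding wz using u EA cA power_span_jmult[of u x c] subspace_diff[OF sub] by blast
      then have "z \<bullet> (u \<odot> w) = 0" using z ideal u by blast
      then have "w \<bullet> w = 0" unfolding w_def by (simp add: inner_jmult)
      then show ?thesis using wz by simp
    qed
    have cc: "c \<odot> c = c" using unit cE .
    have vE: "v \<in> E" using v by (simp add: E_def)
    have c0: "c \<noteq> 0" using unit[OF vE] v(2) by (auto simp: jmult.zero_right)
    have dc: "d \<odot> c = 0" if d: "d \<in> C" for d
    proof -
      have "d \<odot> c = d \<odot> (s \<odot> c)" using cE by (simp add: E_def B_def)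
      also have "\<dots> = (d \<odot> s) \<odot> c" using power_span_assoc[of d x s c] d CA sA cA by (simp add: subsetD)
      finally show ?thesis using sc[OF d] by (simp add: jmult_commute[of d s] jmult.zero_left)
    qed
    then have "c \<notin> C" using cc c0 by force
    have "P (insert c C)"
      using C cc c0 dc cA cE by (auto simp: P_def orthogonal_idempotents_def jmult_commute E_def)
    from max[OF this] \<open>c \<notin> C\<close> oC show False by (simp add: orthogonal_idempotents_def)
  qed
  then have "complete_system C" using oC by (simp add: complete_system_def s_def)
  with C that show thesis by (auto simp: P_def)
qed

lemma complete_system_finite: "complete_system C \<Longrightarrow> finite C"
  by (simp add: complete_system_def orthogonal_idempotents_def)

lemma complete_system_idem: "complete_system C \<Longrightarrow> c \<in> C \<Longrightarrow> c \<odot> c = c"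
  by (simp add: complete_system_def orthogonal_idempotents_def)

lemma complete_system_nonzero: "complete_system C \<Longrightarrow> c \<in> C \<Longrightarrow> c \<noteq> 0"
  by (simp add: complete_system_def orthogonal_idempotents_def)

lemma complete_system_sum: "complete_system C \<Longrightarrow> (\<Sum>c\<in>C. c) = jone"
  by (simp add: complete_system_def)

lemma complete_system_expand:
  assumes "complete_system C"
  shows "v = (\<Sum>c\<in>C. c \<odot> v)"
proof -
  have "v = (\<Sum>c\<in>C. c) \<odot> v" by (simp only: complete_system_sum[OF assms] jone_jmult)
  also have "\<dots> = (\<Sum>c\<in>C. c \<odot> v)" by (rule jmult.sum_left)
  finally show ?thesis .
qed

lemma eigen_system_combination:
  assumes "complete_system C" "\<And>c. c \<in> C \<Longrightarrow> x \<odot> c = l c *\<^sub>R c"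
  shows "x = (\<Sum>c\<in>C. l c *\<^sub>R c)"
proof -
  have "x = (\<Sum>c\<in>C. c \<odot> x)" by (rule complete_system_expand[OF assms(1)])
  also have "\<dots> = (\<Sum>c\<in>C. l c *\<^sub>R c)"
    by (rule sum.cong) (simp_all only: jmult_commute[of _ x] assms(2))
  finally show ?thesis .
qed

lemma primitive_idempotentD: "primitive_idempotent c \<Longrightarrow> c \<odot> c = c \<and> c \<noteq> 0"
  unfolding primitive_idempotent_def jidempotent_def by (elim conjE) (intro conjI)

lemma jordan_frame_complete_system: "jordan_frame C \<Longrightarrow> complete_system C"
  using primitive_idempotentD
  unfolding jordan_frame_def complete_system_def orthogonal_idempotents_def by blast

text \<open>Among all complete systems of eigenvectors of \<open>L(x)\<close> choose one with the most members. A member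
  \<open>c = p + q\<close> that is not primitive could be replaced by \<open>p\<close> and \<open>q\<close>: for another member \<open>d\<close> the
  nonnegative numbers \<open>p \<bullet> d\<close> and \<open>q \<bullet> d\<close> add up to zero, so \<open>p\<close> and \<open>q\<close> are orthogonal to \<open>d\<close>.\<close>

theorem spectral_theorem: "\<exists>C l. spectral_decomposition (x :: 'a::euclidean_jordan_algebra) C l"
proof -
  define P where "P C \<longleftrightarrow> complete_system C \<and> (\<forall>c\<in>C. \<exists>l. x \<odot> c = l *\<^sub>R c)" for C
  obtain C0 where "P C0" by (rule exists_eigen_system[of x]) (auto simp: P_def)
  then obtain C where C: "P C" and max: "\<And>D. P D \<Longrightarrow> card D \<le> card C"
    by (rule maximal_orthogonal_idempotents) (auto simp: P_def complete_system_def)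
  have cC: "complete_system C" using C by (simp add: P_def)
  note fin = complete_system_finite[OF cC]
  obtain l where l: "\<And>c. c \<in> C \<Longrightarrow> x \<odot> c = l c *\<^sub>R c" using C unfolding P_def by metis
  have x: "x = (\<Sum>c\<in>C. l c *\<^sub>R c)" by (rule eigen_system_combination[OF cC l])
  have "primitive_idempotent c" if c: "c \<in> C" for c
  proof (rule ccontr)
    assume "\<not> primitive_idempotent c"
    then obtain p q where pq: "p \<odot> p = p" "q \<odot> q = q" "p \<noteq> 0" "q \<noteq> 0" "p \<odot> q = 0" "c = p + q"
      using complete_system_idem[OF cC c] complete_system_nonzero[OF cC c]
      unfolding primitive_idempotent_def jidempotent_def by blast
    have orth: "p \<odot> d = 0 \<and> q \<odot> d = 0" if d: "d \<in> C - {c}" for d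
    proof -
      have dd: "d \<odot> d = d" using complete_system_idem[OF cC] d by blast
      have "c \<odot> d = 0" using cC c d by (auto simp: complete_system_def orthogonal_idempotents_def)
      then have "c \<bullet> d = 0" using inner_idempotents[OF dd, of c] by simp
      then have "p \<bullet> d = 0" "q \<bullet> d = 0"
        using inner_idempotents_nonneg[OF pq(1) dd] inner_idempotents_nonneg[OF pq(2) dd] pq(6)
        by (simp_all add: inner_add_left)
      then show ?thesis using idempotents_orthogonal pq dd by blast
    qed
    have eig: "x \<odot> r = l c *\<^sub>R r" if r: "c \<odot> r = r" "\<And>d. d \<in> C - {c} \<Longrightarrow> d \<odot> r = 0" for r
    proof -
      have "x \<odot> r = (\<Sum>d\<in>C. if d = c then l c *\<^sub>R r else 0)"
        unfolding x jmult.sum_left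
        by (rule sum.cong) (use r in \<open>auto simp: jmult_scaleR_left\<close>)
      then show ?thesis using c fin by simp
    qed
    have orth': "d \<odot> p = 0" "d \<odot> q = 0" if "d \<in> C - {c}" for d
      using orth[OF that] by (metis jmult_commute)+
    have qp: "q \<odot> p = 0" using pq(5) by (metis jmult_commute)
    have "c \<odot> p = p" "c \<odot> q = q" by (simp_all add: pq qp jmult_add_left)
    then have ep: "x \<odot> p = l c *\<^sub>R p" and eq: "x \<odot> q = l c *\<^sub>R q"
      using orth' by (auto intro!: eig)
    define D where "D = insert p (insert q (C - {c}))"
    have ne: "p \<noteq> q" "p \<notin> C - {c}" "q \<notin> C - {c}" using pq orth by force+
    have "(\<Sum>d\<in>D. d) = p + q + (\<Sum>d\<in>C - {c}. d)" using ne fin by (simp add: D_def add.assoc)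
    also have "\<dots> = (\<Sum>d\<in>C. d)" using c fin pq(6) by (simp add: sum.remove)
    finally have "(\<Sum>d\<in>D. d) = jone" using complete_system_sum[OF cC] by simp
    moreover have "orthogonal_idempotents D"
      using cC fin pq(1-5) qp orth orth' unfolding D_def complete_system_def orthogonal_idempotents_def
      by auto
    moreover have "\<forall>d\<in>D. \<exists>l. x \<odot> d = l *\<^sub>R d" using ep eq l unfolding D_def by blast
    ultimately have "P D" by (simp add: P_def complete_system_def)
    moreover have "card D = Suc (card C)"
      using ne fin card_Suc_Diff1[OF fin c] unfolding D_def by (simp del: card_Diff_insert card_Diff_singleton)
    ultimately show False using max by fastforce
  qed
  then have "jordan_frame C"
    using cC by (simp add: jordan_frame_def complete_system_def orthogonal_idempotents_def)
  with x have "spectral_decomposition x C l" by (simp add: spectral_decomposition_def)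
  then show ?thesis by (intro exI)
qed

section \<open>Linear combinations of orthogonal idempotents\<close>

abbreviation lincomb :: "'a::euclidean_jordan_algebra set \<Rightarrow> ('a \<Rightarrow> real) \<Rightarrow> 'a" where
  "lincomb C l \<equiv> (\<Sum>c\<in>C. l c *\<^sub>R c)"

lemma lincomb_jmult_elem:
  assumes "complete_system C" "c \<in> C"
  shows "lincomb C l \<odot> c = l c *\<^sub>R c"
  using assms by (intro orthogonal_idempotents_sum_jmult) (simp_all add: complete_system_def)

lemma lincomb_jmult:
  assumes "complete_system C"
  shows "lincomb C l \<odot> lincomb C m = lincomb C (\<lambda>c. l c * m c)"
proof -
  have "lincomb C l \<odot> lincomb C m = (\<Sum>c\<in>C. m c *\<^sub>R (lincomb C l \<odot> c))"
    by (simp add: jmult.sum_right jmult_scaleR_right)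
  also have "\<dots> = lincomb C (\<lambda>c. l c * m c)"
    by (rule sum.cong) (simp_all add: lincomb_jmult_elem[OF assms] mult.commute)
  finally show ?thesis .
qed

lemma lincomb_one:
  assumes "complete_system C"
  shows "lincomb C (\<lambda>_. 1) = jone"
  using complete_system_sum[OF assms] by simp

lemma lincomb_affine:
  assumes "complete_system C"
  shows "lincomb C (\<lambda>c. a * l c + b) = a *\<^sub>R lincomb C l + b *\<^sub>R jone"
  by (simp add: scaleR_left_distrib sum.distrib scaleR_sum_right complete_system_sum[OF assms, symmetric])

lemma lincomb_scale: "lincomb C (\<lambda>c. k * l c) = k *\<^sub>R lincomb C l"
  by (simp add: scaleR_sum_right)

lemma lincomb_cong: "(\<And>c. c \<in> C \<Longrightarrow> l c = m c) \<Longrightarrow> lincomb C l = lincomb C m"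
  by (rule sum.cong) simp_all

lemma orthogonal_idempotent_operators_commute:
  fixes c d v :: "'a::euclidean_jordan_algebra"
  assumes "c \<odot> c = c" "c \<odot> d = 0"
  shows "c \<odot> (d \<odot> v) = d \<odot> (c \<odot> v)"
proof -
  have "d \<odot> c = 0" using assms(2) by (metis jmult_commute)
  then show ?thesis using jordan_linearized[of c c d v] assms
    by (simp add: jmult.zero_left jmult.zero_right)
qed

lemma complete_system_operators_commute:
  assumes "complete_system C" "c \<in> C" "d \<in> C"
  shows "c \<odot> (d \<odot> v) = d \<odot> (c \<odot> v)"
proof (cases "c = d")
  case False
  with assms show ?thesis
    by (intro orthogonal_idempotent_operators_commute)
      (simp_all add: complete_system_def orthogonal_idempotents_def)
qed simp

lemma lincomb_operators_commute:
  assumes C: "complete_system C"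
  shows "lincomb C l \<odot> (lincomb C m \<odot> v) = lincomb C m \<odot> (lincomb C l \<odot> v)"
proof -
  have e: "lincomb C l \<odot> (lincomb C m \<odot> v) = (\<Sum>d\<in>C. \<Sum>c\<in>C. (m d * l c) *\<^sub>R (c \<odot> (d \<odot> v)))" for l m
    by (simp add: jmult.sum_left jmult.sum_right jmult_scaleR_left jmult_scaleR_right scaleR_sum_right)
  have "(\<Sum>d\<in>C. \<Sum>c\<in>C. (m d * l c) *\<^sub>R (c \<odot> (d \<odot> v))) = (\<Sum>d\<in>C. \<Sum>c\<in>C. (l c * m d) *\<^sub>R (d \<odot> (c \<odot> v)))"
    by (intro sum.cong refl) (simp only: complete_system_operators_commute[OF C] mult.commute)
  also have "\<dots> = (\<Sum>c\<in>C. \<Sum>d\<in>C. (l c * m d) *\<^sub>R (d \<odot> (c \<odot> v)))" by (rule sum.swap)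
  finally show ?thesis unfolding e .
qed

lemma lincomb_quadratic_form:
  "(lincomb C l \<odot> v) \<bullet> v = (\<Sum>c\<in>C. l c * ((c \<odot> v) \<bullet> v))"
  by (simp add: jmult.sum_left jmult_scaleR_left inner_sum_left)

lemma lincomb_psd:
  assumes "complete_system C" "\<And>c. c \<in> C \<Longrightarrow> l c \<ge> 0"
  shows "(lincomb C l \<odot> v) \<bullet> v \<ge> 0"
  unfolding lincomb_quadratic_form
  by (intro sum_nonneg mult_nonneg_nonneg assms(2) idempotent_psd complete_system_idem[OF assms(1)])

lemma lincomb_inner_elem:
  assumes "complete_system C" "c \<in> C"
  shows "lincomb C l \<bullet> c = l c * (c \<bullet> c)"
proof -
  have "lincomb C l \<bullet> c = (lincomb C l \<odot> c) \<bullet> c"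
    by (rule inner_idempotents[OF complete_system_idem[OF assms]])
  then show ?thesis by (simp add: lincomb_jmult_elem[OF assms])
qed

lemma inner_jone_idempotent:
  assumes "d \<odot> d = d"
  shows "jone \<bullet> d = d \<bullet> (d :: 'a::euclidean_jordan_algebra)"
  using inner_idempotents[OF assms, of jone] by (simp add: jone_jmult)

text \<open>The quadratic form of \<open>L(u)\<close> is bounded by the spectral radius because each idempotent acts positively
  and the idempotents add up to the identity. For a self-adjoint operator such a bound passes to the
  operator norm by polarization at vectors of equal length.\<close>

lemma norm_lincomb_jmult_le:
  fixes v :: "'a::euclidean_jordan_algebra"
  assumes C: "complete_system C" and l: "\<And>c. c \<in> C \<Longrightarrow> \<bar>l c\<bar> \<le> \<rho>" and \<rho>: "\<rho> \<ge> 0"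
  shows "norm (lincomb C l \<odot> v) \<le> \<rho> * norm v"
proof -
  define T where "T z = lincomb C l \<odot> z" for z
  have T: "linear T" unfolding T_def by (rule linear_jmult)
  have sa: "T y \<bullet> z = y \<bullet> T z" for y z unfolding T_def by (rule inner_jmult)
  have bound: "\<bar>T z \<bullet> z\<bar> \<le> \<rho> * (z \<bullet> z)" for z
  proof -
    have "\<bar>T z \<bullet> z\<bar> \<le> (\<Sum>c\<in>C. \<bar>l c * ((c \<odot> z) \<bullet> z)\<bar>)"
      unfolding T_def lincomb_quadratic_form by (rule sum_abs)
    also have "\<dots> \<le> (\<Sum>c\<in>C. \<rho> * ((c \<odot> z) \<bullet> z))"
    proof (rule sum_mono)
      fix c assume c: "c \<in> C"
      have "(c \<odot> z) \<bullet> z \<ge> 0" by (rule idempotent_psd[OF complete_system_idem[OF C c]])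
      with l[OF c] show "\<bar>l c * ((c \<odot> z) \<bullet> z)\<bar> \<le> \<rho> * ((c \<odot> z) \<bullet> z)"
        by (simp add: abs_mult mult_right_mono)
    qed
    also have "\<dots> = \<rho> * ((\<Sum>c\<in>C. c \<odot> z) \<bullet> z)"
      by (simp add: sum_distrib_left inner_sum_left)
    also have "(\<Sum>c\<in>C. c \<odot> z) = z" by (rule complete_system_expand[OF C, symmetric])
    finally show ?thesis .
  qed
  show ?thesis
  proof (cases "T v = 0")
    case True
    then show ?thesis using \<rho> by (simp add: T_def)
  next
    case False
    then have v: "norm v > 0" using linear_0[OF T] by auto
    \<comment> \<open>\<open>z\<close> is parallel to \<open>T v\<close> and as long as \<open>v\<close>\<close>
    define k where "k = norm v / norm (T v)"
    define z where "z = k *\<^sub>R T v"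
    have nz: "z \<bullet> z = v \<bullet> v" using False by (simp add: z_def k_def dot_square_norm power2_eq_square)
    have Tz: "T v \<bullet> z = norm v * norm (T v)" using False
      by (simp add: z_def k_def dot_square_norm power2_eq_square)
    have "4 * (T v \<bullet> z) = T (v + z) \<bullet> (v + z) - T (v - z) \<bullet> (v - z)"
      using sa[of z v] by (simp add: linear_add[OF T] linear_diff[OF T] inner_add_left inner_add_right
          inner_diff_left inner_diff_right inner_commute)
    also have "\<dots> \<le> \<rho> * ((v + z) \<bullet> (v + z)) + \<rho> * ((v - z) \<bullet> (v - z))"
      using bound[of "v + z"] bound[of "v - z"] by linarith
    also have "\<dots> = 4 * \<rho> * (v \<bullet> v)" using nz
      by (simp add: inner_add_left inner_add_right inner_diff_left inner_diff_right inner_commute algebra_simps)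
    finally have "norm v * norm (T v) \<le> norm v * (\<rho> * norm v)"
      unfolding Tz by (simp add: dot_square_norm power2_eq_square mult_ac)
    then show ?thesis using v by (simp add: T_def)
  qed
qed

section \<open>Functional calculus\<close>

text \<open>If \<open>c\<close> and \<open>d\<close> belong to two decompositions of the same element, then self-adjointness of its
  multiplication gives \<open>(l c - m d) (c \<bullet> d) = 0\<close>, so either \<open>c \<odot> d = 0\<close> or the two eigenvalues agree.
  Expanding \<open>\<Sum>c. f (l c) c\<close> with respect to both systems, the coefficients may therefore be exchanged.\<close>

lemma lincomb_functional_calculus:
  fixes C D :: "'a::euclidean_jordan_algebra set"
  assumes C: "complete_system C" and D: "complete_system D" and eq: "lincomb C l = lincomb D m"
  shows "lincomb C (\<lambda>c. f (l c)) = lincomb D (\<lambda>d. f (m d))"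
proof -
  have key: "f (l c) *\<^sub>R (c \<odot> d) = f (m d) *\<^sub>R (c \<odot> d)" if c: "c \<in> C" and d: "d \<in> D" for c d
  proof (cases "c \<bullet> d = 0")
    case True
    then show ?thesis
      by (simp add: idempotents_orthogonal complete_system_idem[OF C c] complete_system_idem[OF D d])
  next
    case False
    have "l c * (c \<bullet> d) = (lincomb C l \<odot> c) \<bullet> d" by (simp add: lincomb_jmult_elem[OF C c])
    also have "\<dots> = c \<bullet> (lincomb D m \<odot> d)" unfolding eq by (rule inner_jmult)
    also have "\<dots> = m d * (c \<bullet> d)" by (simp add: lincomb_jmult_elem[OF D d])
    finally show ?thesis using False by simp
  qed
  have "lincomb C (\<lambda>c. f (l c)) = (\<Sum>d\<in>D. d \<odot> lincomb C (\<lambda>c. f (l c)))"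
    by (rule complete_system_expand[OF D])
  also have "\<dots> = (\<Sum>d\<in>D. \<Sum>c\<in>C. f (l c) *\<^sub>R (c \<odot> d))"
    by (simp add: jmult.sum_right jmult_scaleR_right jmult_commute)
  also have "\<dots> = (\<Sum>d\<in>D. \<Sum>c\<in>C. f (m d) *\<^sub>R (c \<odot> d))"
    by (intro sum.cong refl key)
  also have "\<dots> = (\<Sum>d\<in>D. f (m d) *\<^sub>R (\<Sum>c\<in>C. c \<odot> d))" by (simp add: scaleR_sum_right)
  also have "\<dots> = lincomb D (\<lambda>d. f (m d))"
    by (simp add: complete_system_expand[OF C, symmetric])
  finally show ?thesis .
qed

lemma spectral_decompositionD:
  assumes "spectral_decomposition x C l"
  shows "complete_system C" and "x = lincomb C l"
proof -
  have d: "jordan_frame C \<and> x = lincomb C l" using assms unfolding spectral_decomposition_def .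
  show "complete_system C" by (rule jordan_frame_complete_system[OF conjunct1[OF d]])
  show "x = lincomb C l" by (rule conjunct2[OF d])
qed

lemma spectral_decompositionE:
  obtains C l where "complete_system C" "x = lincomb C l"
proof -
  obtain C l where d: "spectral_decomposition x C l" using spectral_theorem by blast
  show thesis by (rule that[OF spectral_decompositionD[OF d]])
qed

lemma jpow_lincomb:
  assumes C: "complete_system C"
  shows "jpow (lincomb C l) \<alpha> = lincomb C (\<lambda>c. l c powr \<alpha>)"
proof -
  obtain D m where D: "spectral_decomposition (lincomb C l) D m" using spectral_theorem by blast
  have eq: "lincomb E (\<lambda>c. n c powr \<alpha>) = lincomb C (\<lambda>c. l c powr \<alpha>)"
    if "spectral_decomposition (lincomb C l) E n" for E n
  proof -
    show ?thesis
      by (rule lincomb_functional_calculus[OF spectral_decompositionD(1)[OF that] C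
            spectral_decompositionD(2)[OF that, symmetric]])
  qed
  show ?thesis unfolding jpow_def
  proof (rule the_equality)
    show "\<exists>E n. spectral_decomposition (lincomb C l) E n \<and>
        lincomb C (\<lambda>c. l c powr \<alpha>) = lincomb E (\<lambda>c. n c powr \<alpha>)"
      by (intro exI[of _ D] exI[of _ m] conjI D eq[OF D, symmetric])
  next
    fix y assume "\<exists>E n. spectral_decomposition (lincomb C l) E n \<and> y = lincomb E (\<lambda>c. n c powr \<alpha>)"
    then obtain E n where En: "spectral_decomposition (lincomb C l) E n"
      "y = lincomb E (\<lambda>c. n c powr \<alpha>)" by (elim exE conjE)
    then show "y = lincomb C (\<lambda>c. l c powr \<alpha>)" by (simp only: eq[OF En(1)])
  qed
qed

section \<open>The symmetric cone\<close>

lemma nonneg_of_inner_self: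
  assumes "0 \<le> l * (c \<bullet> c)" "c \<noteq> 0"
  shows "0 \<le> (l :: real)"
proof (rule ccontr)
  assume "\<not> 0 \<le> l"
  then have "l * (c \<bullet> c) < 0" using assms(2) by (intro mult_neg_pos) simp_all
  with assms(1) show False by simp
qed

lemma lincomb_square_iff:
  assumes C: "complete_system C"
  shows "(\<exists>y. lincomb C l = y \<odot> y) \<longleftrightarrow> (\<forall>c\<in>C. l c \<ge> 0)"
proof
  assume "\<exists>y. lincomb C l = y \<odot> y"
  then obtain y where y: "lincomb C l = y \<odot> y" by blast
  show "\<forall>c\<in>C. l c \<ge> 0"
  proof
    fix c assume c: "c \<in> C"
    have "l c * (c \<bullet> c) = (y \<odot> y) \<bullet> c" using lincomb_inner_elem[OF C c, of l] y by simp
    also have "\<dots> = (c \<odot> y) \<bullet> y" by (simp only: inner_jmult jmult_commute[of y c])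
    also have "\<dots> \<ge> 0" by (rule idempotent_psd[OF complete_system_idem[OF C c]])
    finally show "l c \<ge> 0" using complete_system_nonzero[OF C c] by (rule nonneg_of_inner_self)
  qed
next
  assume l: "\<forall>c\<in>C. l c \<ge> 0"
  have "lincomb C (\<lambda>c. sqrt (l c)) \<odot> lincomb C (\<lambda>c. sqrt (l c)) = lincomb C l"
    unfolding lincomb_jmult[OF C] using l by (intro lincomb_cong) simp
  then show "\<exists>y. lincomb C l = y \<odot> y" by metis
qed

text \<open>Nonzero idempotents stay away from \<open>0\<close>, since \<open>d = d \<odot> d\<close> and the product is bounded.\<close>

lemma norm_idempotent_lower_bound:
  obtains K where "K > 0"
    and "\<And>d :: 'a::euclidean_jordan_algebra. d \<odot> d = d \<Longrightarrow> norm d \<le> K * (d \<bullet> d)"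
proof -
  obtain K where K: "K > 0" "\<And>a b :: 'a. norm (a \<odot> b) \<le> norm a * norm b * K"
    using jmult.pos_bounded by blast
  have "norm d \<le> K * (d \<bullet> d)" if "d \<odot> d = d" for d :: 'a
    using K(2)[of d d] that by (simp add: dot_square_norm power2_eq_square mult_ac)
  with K(1) that show thesis by blast
qed

text \<open>Eigenvalues are read off by pairing with idempotents, and this pairing changes by a controlled amount
  under a small perturbation because idempotents are bounded below in norm; so positive eigenvalues
  stay nonnegative nearby. Conversely, an interior point of the squares stays a square after
  subtracting a small multiple of the identity.\<close>

lemma lincomb_in_cone_iff:
  fixes C :: "'a::euclidean_jordan_algebra set"
  assumes C: "complete_system C"
  shows "lincomb C l \<in> \<Omega> \<longleftrightarrow> (\<forall>c\<in>C. l c > 0)"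
proof
  assume "lincomb C l \<in> \<Omega>"
  then obtain e where e: "e > 0" "ball (lincomb C l) e \<subseteq> {y \<odot> y |y. True}"
    unfolding symmetric_cone_def mem_interior by blast
  define t where "t = e / (2 * (norm (jone :: 'a) + 1))"
  have np: "norm (jone :: 'a) + 1 > 0" using norm_ge_zero[of "jone :: 'a"] by linarith
  have t: "t > 0" using e np by (simp add: t_def)
  have "n < 2 * (n + 1)" if "n \<ge> 0" for n :: real using that by simp
  from this[OF norm_ge_zero] have "norm (jone :: 'a) < 2 * (norm (jone :: 'a) + 1)" .
  then have "t * norm (jone :: 'a) < t * (2 * (norm (jone :: 'a) + 1))"
    using t by (rule mult_strict_left_mono)
  also have "\<dots> = e" using np by (simp add: t_def)
  finally have "lincomb C l - t *\<^sub>R jone \<in> ball (lincomb C l) e"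
    using t by (simp add: dist_norm)
  with e(2) have "\<exists>y. lincomb C l - t *\<^sub>R jone = y \<odot> y" by blast
  moreover have "lincomb C (\<lambda>c. 1 * l c + - t) = lincomb C l - t *\<^sub>R jone"
    unfolding lincomb_affine[OF C] by simp
  ultimately have "\<exists>y. lincomb C (\<lambda>c. 1 * l c + - t) = y \<odot> y"
    by simp
  then have "\<forall>c\<in>C. 1 * l c + - t \<ge> 0" unfolding lincomb_square_iff[OF C] .
  with t show "\<forall>c\<in>C. l c > 0" by force
next
  assume l: "\<forall>c\<in>C. l c > 0"
  obtain K where K: "K > 0" "\<And>d :: 'a. d \<odot> d = d \<Longrightarrow> norm d \<le> K * (d \<bullet> d)"
    by (rule norm_idempotent_lower_bound) (rule that)
  define \<epsilon> where "\<epsilon> = Min (insert 1 (l ` C))"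
  note fin = complete_system_finite[OF C]
  have \<epsilon>: "\<epsilon> > 0" using fin l by (simp add: \<epsilon>_def)
  have \<epsilon>l: "\<epsilon> \<le> l c" if "c \<in> C" for c using fin that by (simp add: \<epsilon>_def)
  have "ball (lincomb C l) (\<epsilon> / K) \<subseteq> {y \<odot> y |y. True}"
  proof
    fix z assume z: "z \<in> ball (lincomb C l) (\<epsilon> / K)"
    obtain D m where D: "complete_system D" and zD: "z = lincomb D m" by (rule spectral_decompositionE)
    have "m d \<ge> 0" if d: "d \<in> D" for d
    proof -
      have dd: "d \<odot> d = d" by (rule complete_system_idem[OF D d])
      have "\<epsilon> * (d \<bullet> d) = (\<Sum>c\<in>C. \<epsilon> * (c \<bullet> d))"
        unfolding inner_jone_idempotent[OF dd, symmetric] complete_system_sum[OF C, symmetric]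
        by (simp add: inner_sum_left sum_distrib_left)
      also have "\<dots> \<le> (\<Sum>c\<in>C. l c * (c \<bullet> d))"
        by (intro sum_mono mult_right_mono \<epsilon>l inner_idempotents_nonneg[OF complete_system_idem[OF C] dd])
      also have "\<dots> = lincomb C l \<bullet> d" by (simp add: inner_sum_left)
      finally have 1: "\<epsilon> * (d \<bullet> d) \<le> lincomb C l \<bullet> d" .
      have "(lincomb C l - z) \<bullet> d \<le> norm (lincomb C l - z) * norm d" by (rule norm_cauchy_schwarz)
      also have "\<dots> \<le> \<epsilon> / K * norm d" using z by (intro mult_right_mono) (auto simp: dist_norm)
      also have "\<dots> \<le> \<epsilon> / K * (K * (d \<bullet> d))" using K \<epsilon> dd by (intro mult_left_mono) auto
      also have "\<dots> = \<epsilon> * (d \<bullet> d)" using K by simp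
      finally have "z \<bullet> d \<ge> 0" using 1 by (simp add: inner_diff_left)
      then have "m d * (d \<bullet> d) \<ge> 0" unfolding zD lincomb_inner_elem[OF D d] .
      then show ?thesis using complete_system_nonzero[OF D d] by (rule nonneg_of_inner_self)
    qed
    then have "\<exists>y. z = y \<odot> y" unfolding zD lincomb_square_iff[OF D] by blast
    then show "z \<in> {y \<odot> y |y. True}" by simp
  qed
  moreover have "\<epsilon> / K > 0" using \<epsilon> K by simp
  ultimately show "lincomb C l \<in> \<Omega>" unfolding symmetric_cone_def mem_interior by blast
qed

lemma open_cone: "open \<Omega>"
  by (simp add: symmetric_cone_def)

lemma cone_lincombE:
  assumes "x \<in> \<Omega>"
  obtains C l where "complete_system C" "x = lincomb C l" "\<forall>c\<in>C. l c > 0"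
proof -
  obtain C l where C: "complete_system C" "x = lincomb C l" by (rule spectral_decompositionE)
  with assms lincomb_in_cone_iff[OF C(1)] have "\<forall>c\<in>C. l c > 0" by simp
  with C show thesis by (rule that)
qed

lemma jone_in_cone: "jone \<in> (\<Omega> :: 'a::euclidean_jordan_algebra set)"
proof -
  obtain C l where C: "complete_system C" "(jone :: 'a) = lincomb C l" by (rule spectral_decompositionE)
  have "lincomb C (\<lambda>_. 1) \<in> \<Omega>" unfolding lincomb_in_cone_iff[OF C(1)] by simp
  then show ?thesis unfolding lincomb_one[OF C(1)] .
qed

text \<open>The squares are exactly the elements whose multiplication is positive semidefinite (self-duality of the
  cone), a closed condition.\<close>

lemma closed_squares: "closed {y \<odot> y |y :: 'a::euclidean_jordan_algebra. True}"
proof -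
  have "{y \<odot> y |y :: 'a. True} = (\<Inter>z. {x. 0 \<le> (x \<odot> z) \<bullet> z})"
  proof (rule set_eqI)
    fix x :: 'a
    obtain C l where C: "complete_system C" and x: "x = lincomb C l" by (rule spectral_decompositionE)
    have "(\<forall>z. 0 \<le> (x \<odot> z) \<bullet> z) \<longleftrightarrow> (\<forall>c\<in>C. l c \<ge> 0)"
    proof
      assume *: "\<forall>z. 0 \<le> (x \<odot> z) \<bullet> z"
      show "\<forall>c\<in>C. l c \<ge> 0"
      proof
        fix c assume c: "c \<in> C"
        have "0 \<le> l c * (c \<bullet> c)" using *[rule_format, of c] unfolding x lincomb_jmult_elem[OF C c] by simp
        then show "l c \<ge> 0" using complete_system_nonzero[OF C c] by (rule nonneg_of_inner_self)
      qed
    qed (use lincomb_psd[OF C] x in blast)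
    with lincomb_square_iff[OF C, of l] x
    show "x \<in> {y \<odot> y |y. True} \<longleftrightarrow> x \<in> (\<Inter>z. {x. 0 \<le> (x \<odot> z) \<bullet> z})" by simp
  qed
  moreover have "closed {x :: 'a. 0 \<le> (x \<odot> z) \<bullet> z}" for z
    by (intro closed_Collect_le continuous_intros jmult.continuous_on)
  ultimately show ?thesis by (simp add: closed_INT)
qed

section \<open>Powers in the symmetric cone\<close>

lemma jpow_in_cone:
  assumes "x \<in> \<Omega>"
  shows "jpow x \<alpha> \<in> \<Omega>"
proof -
  obtain C l where C: "complete_system C" "x = lincomb C l" "\<forall>c\<in>C. l c > 0"
    using assms by (rule cone_lincombE)
  show ?thesis unfolding C(2) jpow_lincomb[OF C(1)] lincomb_in_cone_iff[OF C(1)]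
    using C(3) by force
qed

lemma jpow_jpow:
  assumes "x \<in> \<Omega>"
  shows "jpow (jpow x \<alpha>) \<beta> = jpow x (\<alpha> * \<beta>)"
proof -
  obtain C l where C: "complete_system C" "x = lincomb C l" "\<forall>c\<in>C. l c > 0"
    using assms by (rule cone_lincombE)
  show ?thesis unfolding C(2) jpow_lincomb[OF C(1)] powr_powr ..
qed

lemma jpow_jmult: 
  assumes "x \<in> \<Omega>"
  shows "jpow x \<alpha> \<odot> jpow x \<beta> = jpow x (\<alpha> + \<beta>)"
proof -
  obtain C l where C: "complete_system C" "x = lincomb C l" "\<forall>c\<in>C. l c > 0"
    using assms by (rule cone_lincombE)
  show ?thesis unfolding C(2) jpow_lincomb[OF C(1)] lincomb_jmult[OF C(1)] powr_add ..
qed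

lemma jpow_1: 
  assumes "x \<in> \<Omega>"
  shows "jpow x 1 = x"
proof -
  obtain C l where C: "complete_system C" "x = lincomb C l" "\<forall>c\<in>C. l c > 0"
    using assms by (rule cone_lincombE)
  show ?thesis unfolding C(2) jpow_lincomb[OF C(1)] by (rule lincomb_cong) (use C(3) in force)
qed

lemma jpow_0: 
  assumes "x \<in> \<Omega>"
  shows "jpow x 0 = jone"
proof -
  obtain C l where C: "complete_system C" "x = lincomb C l" "\<forall>c\<in>C. l c > 0"
    using assms by (rule cone_lincombE)
  have "jpow x 0 = lincomb C (\<lambda>_. 1)"
    unfolding C(2) jpow_lincomb[OF C(1)] by (rule lincomb_cong) (use C(3) in force)
  then show ?thesis by (simp only: lincomb_one[OF C(1)])
qed

lemma jpow_half_unique: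
  assumes "w \<in> \<Omega>"
  shows "jpow (w \<odot> w) (1/2) = w"
proof -
  have "w \<odot> w = jpow w 2" using jpow_jmult[OF assms, of 1 1] by (simp add: jpow_1[OF assms])
  then show ?thesis by (simp add: jpow_jpow[OF assms] jpow_1[OF assms])
qed

section \<open>The quadratic representation\<close>

lemma quad_rep_add: "quad_rep x (u + v) = quad_rep x u + quad_rep x v"
  by (simp add: quad_rep_def jmult_add_right scaleR_right_distrib)

lemma linear_quad_rep: "linear (quad_rep x)"
  by (intro linearI) (simp_all add: quad_rep_add, simp add: quad_rep_def jmult_scaleR_right algebra_simps)

lemma quad_rep_jone_left: "quad_rep jone v = v"
  by (simp add: quad_rep_def jone_jmult scaleR_2)

lemma quad_rep_jone_right: "quad_rep x jone = x \<odot> x"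
  by (simp add: quad_rep_def jmult_one_right scaleR_2)

text \<open>The symmetric bilinear map in the first two arguments whose diagonal is the quadratic representation.\<close>

definition quad_rep_polar :: "'a::euclidean_jordan_algebra \<Rightarrow> 'a \<Rightarrow> 'a \<Rightarrow> 'a" where
  "quad_rep_polar a b v = a \<odot> (b \<odot> v) + b \<odot> (a \<odot> v) - (a \<odot> b) \<odot> v"

text \<open>The infinitesimal form of \<open>P(P(g) y) = P(g) P(y) P(g)\<close> for \<open>g = exp (t x)\<close>, where \<open>P(g)\<close> has derivative
  \<open>2 L(x)\<close> at \<open>t = 0\<close>: it says that \<open>2 L(x)\<close> belongs
  to the Lie algebra of the structure group.\<close>

lemma quad_rep_structure_identity:
  fixes x y v :: "'a::euclidean_jordan_algebra"
  shows "2 *\<^sub>R quad_rep_polar (x \<odot> y) y v = x \<odot> quad_rep y v + quad_rep y (x \<odot> v)"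
proof -
  have J1: "y \<odot> ((y \<odot> x) \<odot> v) + y \<odot> ((x \<odot> y) \<odot> v) + x \<odot> ((y \<odot> y) \<odot> v)
    = (y \<odot> x) \<odot> (y \<odot> v) + (x \<odot> y) \<odot> (y \<odot> v) + (y \<odot> y) \<odot> (x \<odot> v)"
    by (rule jordan_linearized)
  have J2: "((x \<odot> y) \<odot> y) \<odot> v = (x \<odot> y) \<odot> (y \<odot> v) + (x \<odot> y) \<odot> (y \<odot> v) + (y \<odot> y) \<odot> (x \<odot> v)
    - x \<odot> (y \<odot> (y \<odot> v)) - y \<odot> (y \<odot> (x \<odot> v))"
    by (rule jordan_operator_identity)
  have c: "y \<odot> x = x \<odot> y" by (rule jmult_commute)
  show ?thesis using J1
    unfolding quad_rep_polar_def quad_rep_def J2 c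
    by (simp add: scaleR_2 jmult_add_right jmult.diff_right algebra_simps)
qed

lemma has_vector_derivative_jmult:
  fixes f g :: "real \<Rightarrow> 'a::euclidean_jordan_algebra"
  assumes "(f has_vector_derivative f') (at t)" "(g has_vector_derivative g') (at t)"
  shows "((\<lambda>t. f t \<odot> g t) has_vector_derivative (f t \<odot> g' + f' \<odot> g t)) (at t)"
  using jmult.has_vector_derivative[OF assms] .

lemma has_vector_derivative_quad_rep:
  fixes Y w :: "real \<Rightarrow> 'a::euclidean_jordan_algebra"
  assumes Y: "(Y has_vector_derivative Y') (at t)" and w: "(w has_vector_derivative w') (at t)"
  shows "((\<lambda>t. quad_rep (Y t) (w t)) has_vector_derivative
     (2 *\<^sub>R quad_rep_polar Y' (Y t) (w t) + quad_rep (Y t) w')) (at t)"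
proof -
  have 1: "((\<lambda>t. Y t \<odot> (Y t \<odot> w t)) has_vector_derivative
      (Y t \<odot> (Y t \<odot> w' + Y' \<odot> w t) + Y' \<odot> (Y t \<odot> w t))) (at t)"
    by (intro has_vector_derivative_jmult assms)
  have 2: "((\<lambda>t. (Y t \<odot> Y t) \<odot> w t) has_vector_derivative
      ((Y t \<odot> Y t) \<odot> w' + (Y t \<odot> Y' + Y' \<odot> Y t) \<odot> w t)) (at t)"
    by (intro has_vector_derivative_jmult assms)
  have c: "Y t \<odot> Y' = Y' \<odot> Y t" by (rule jmult_commute)
  have e: "2 *\<^sub>R (Y t \<odot> (Y t \<odot> w' + Y' \<odot> w t) + Y' \<odot> (Y t \<odot> w t)) -
     ((Y t \<odot> Y t) \<odot> w' + (Y t \<odot> Y' + Y' \<odot> Y t) \<odot> w t)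
     = 2 *\<^sub>R quad_rep_polar Y' (Y t) (w t) + quad_rep (Y t) w'"
    unfolding c quad_rep_polar_def quad_rep_def
    by (simp add: scaleR_2 jmult_add_right jmult_add_left algebra_simps)
  have "((\<lambda>t. quad_rep (Y t) (w t)) has_vector_derivative
     2 *\<^sub>R (Y t \<odot> (Y t \<odot> w' + Y' \<odot> w t) + Y' \<odot> (Y t \<odot> w t)) -
     ((Y t \<odot> Y t) \<odot> w' + (Y t \<odot> Y' + Y' \<odot> Y t) \<odot> w t)) (at t)"
    unfolding quad_rep_def
    by (rule has_vector_derivative_diff[OF
          bounded_linear.has_vector_derivative[OF bounded_linear_scaleR_right 1] 2])
  then show ?thesis unfolding e .
qed

text \<open>The one-parameter group of powers of an element of the cone whose logarithm is \<open>lincomb C l\<close>.\<close>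

definition exp_flow :: "'a::euclidean_jordan_algebra set \<Rightarrow> ('a \<Rightarrow> real) \<Rightarrow> real \<Rightarrow> 'a" where
  "exp_flow C l t = lincomb C (\<lambda>c. exp (t * l c))"

lemma exp_flow_0: "complete_system C \<Longrightarrow> exp_flow C l 0 = jone"
  by (simp add: exp_flow_def complete_system_sum)

lemma has_vector_derivative_exp_flow:
  assumes C: "complete_system C"
  shows "(exp_flow C l has_vector_derivative (lincomb C l \<odot> exp_flow C l t)) (at t)"
proof -
  have "((\<lambda>t. lincomb C (\<lambda>c. exp (t * l c))) has_vector_derivative
      (\<Sum>c\<in>C. (l c * exp (t * l c)) *\<^sub>R c)) (at t)"
    by (rule has_vector_derivative_sum) (auto intro!: derivative_eq_intros)
  then show ?thesis
    unfolding exp_flow_def[abs_def] lincomb_jmult[OF C] .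
qed

lemma lincomb_commutes_quad_rep:
  assumes C: "complete_system C"
  shows "lincomb C l \<odot> quad_rep (lincomb C m) v = quad_rep (lincomb C m) (lincomb C l \<odot> v)"
  unfolding quad_rep_def lincomb_jmult[OF C]
  by (simp only: jmult.diff_right jmult_scaleR_right lincomb_operators_commute[OF C, of l])

lemma has_vector_derivative_quad_rep_exp_flow:
  assumes C: "complete_system C" and w: "(w has_vector_derivative w') (at t)"
  shows "((\<lambda>t. quad_rep (exp_flow C l t) (w t)) has_vector_derivative
     (2 *\<^sub>R (lincomb C l \<odot> quad_rep (exp_flow C l t) (w t)) + quad_rep (exp_flow C l t) w')) (at t)"
proof -
  have "2 *\<^sub>R quad_rep_polar (lincomb C l \<odot> exp_flow C l t) (exp_flow C l t) (w t)
      = 2 *\<^sub>R (lincomb C l \<odot> quad_rep (exp_flow C l t) (w t))"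
    unfolding quad_rep_structure_identity
    by (simp add: exp_flow_def lincomb_commutes_quad_rep[OF C] scaleR_2)
  then show ?thesis
    using has_vector_derivative_quad_rep[OF has_vector_derivative_exp_flow[OF C] w, of l] by (simp only:)
qed

lemma lincomb_uminus: "lincomb C (\<lambda>c. - l c) = - lincomb C l"
  by (simp add: sum_negf)

lemma has_zero_vector_derivative_constant:
  fixes f :: "real \<Rightarrow> 'a::euclidean_space"
  assumes "\<And>t. (f has_vector_derivative 0) (at t)"
  shows "f t = f s"
proof -
  obtain c where "\<And>x. x \<in> UNIV \<Longrightarrow> f x = c"
    using has_vector_derivative_zero_constant[OF convex_UNIV, of f] assms by auto
  then show ?thesis by simp
qed

text \<open>The product of the two operators is constant along the flow, because \<open>P(exp (t x))\<close> has logarithmic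
  derivative \<open>2 L(x)\<close>.\<close>

lemma quad_rep_exp_flow_inverse:
  assumes C: "complete_system C"
  shows "quad_rep (exp_flow C l t) (quad_rep (exp_flow C (\<lambda>c. - l c) t) v) = v"
proof -
  let ?x = "lincomb C l" and ?g = "exp_flow C l" and ?h = "exp_flow C (\<lambda>c. - l c)"
  define f where "f t = quad_rep (?g t) (quad_rep (?h t) v)" for t
  have w: "((\<lambda>t. quad_rep (?h t) v) has_vector_derivative - (2 *\<^sub>R (?x \<odot> quad_rep (?h t) v))) (at t)" for t
    using has_vector_derivative_quad_rep_exp_flow[OF C has_vector_derivative_const, of "\<lambda>c. - l c" v t]
    unfolding lincomb_uminus by (simp add: jmult.minus_left linear_0[OF linear_quad_rep])
  have "2 *\<^sub>R (?x \<odot> f t) + quad_rep (?g t) (- (2 *\<^sub>R (?x \<odot> quad_rep (?h t) v))) = 0" for t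
    by (simp add: f_def linear_neg[OF linear_quad_rep] linear_scale[OF linear_quad_rep]
        exp_flow_def lincomb_commutes_quad_rep[OF C])
  with has_vector_derivative_quad_rep_exp_flow[OF C w, of l]
  have "(f has_vector_derivative 0) (at t)" for t by (simp add: f_def[abs_def])
  then have "f t = f 0" by (rule has_zero_vector_derivative_constant)
  then show ?thesis by (simp add: f_def exp_flow_0[OF C] quad_rep_jone_left)
qed

text \<open>By the structure identity, \<open>t \<mapsto> P(exp (t x))\<^bsup>-1\<^esup> P(P(exp (t x)) y) P(exp (t x))\<^bsup>-1\<^esup>\<close> has derivative
  zero, and its value at \<open>t = 0\<close> is \<open>P(y)\<close>.\<close>

lemma quad_rep_exp_flow_fundamental:
  assumes C: "complete_system C"
  shows "quad_rep (quad_rep (exp_flow C l t) y) v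
     = quad_rep (exp_flow C l t) (quad_rep y (quad_rep (exp_flow C l t) v))"
proof -
  let ?x = "lincomb C l" and ?g = "exp_flow C l" and ?h = "exp_flow C (\<lambda>c. - l c)"
  define u where "u = quad_rep (?g t) v"
  define Y where "Y t = quad_rep (?g t) y" for t
  define w where "w t = quad_rep (?h t) u" for t
  define Z where "Z t = quad_rep (Y t) (w t)" for t
  define f where "f t = quad_rep (?h t) (Z t)" for t
  have Y: "(Y has_vector_derivative ((2 *\<^sub>R ?x) \<odot> Y t)) (at t)" for t
    using has_vector_derivative_quad_rep_exp_flow[OF C has_vector_derivative_const, of l y t]
    by (simp add: Y_def[abs_def] jmult_scaleR_left linear_0[OF linear_quad_rep])
  have w: "(w has_vector_derivative - ((2 *\<^sub>R ?x) \<odot> w t)) (at t)" for t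
    using has_vector_derivative_quad_rep_exp_flow[OF C has_vector_derivative_const, of "\<lambda>c. - l c" u t]
    unfolding lincomb_uminus
    by (simp add: w_def[abs_def] jmult.minus_left jmult_scaleR_left linear_0[OF linear_quad_rep])
  have Z: "(Z has_vector_derivative (2 *\<^sub>R (?x \<odot> Z t))) (at t)" for t
    using has_vector_derivative_quad_rep[OF Y w]
    unfolding quad_rep_structure_identity
    by (simp add: Z_def[abs_def] linear_neg[OF linear_quad_rep] jmult_scaleR_left)
  have "2 *\<^sub>R (lincomb C (\<lambda>c. - l c) \<odot> f t) + quad_rep (?h t) (2 *\<^sub>R (?x \<odot> Z t)) = 0" for t
    unfolding lincomb_uminus
    by (simp add: f_def jmult.minus_left linear_scale[OF linear_quad_rep]
        exp_flow_def lincomb_commutes_quad_rep[OF C])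
  with has_vector_derivative_quad_rep_exp_flow[OF C Z, of "\<lambda>c. - l c"]
  have "(f has_vector_derivative 0) (at t)" for t by (simp add: f_def[abs_def])
  then have "f t = f 0" by (rule has_zero_vector_derivative_constant)
  then have "quad_rep (?h t) (quad_rep (Y t) (w t)) = quad_rep y u"
    by (simp add: f_def Z_def Y_def w_def exp_flow_0[OF C] quad_rep_jone_left)
  moreover have "w t = v"
    using quad_rep_exp_flow_inverse[OF C, of "\<lambda>c. - l c" t v] by (simp add: w_def u_def)
  ultimately have "quad_rep (?g t) (quad_rep (?h t) (quad_rep (Y t) v)) = quad_rep (?g t) (quad_rep y u)"
    by simp
  then show ?thesis unfolding quad_rep_exp_flow_inverse[OF C] Y_def u_def .
qed

lemma cone_exp_flowE:
  assumes "x \<in> \<Omega>"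
  obtains C l where "complete_system C" "x = exp_flow C l 1" "jinv x = exp_flow C (\<lambda>c. - l c) 1"
proof -
  obtain C l where C: "complete_system C" "x = lincomb C l" "\<forall>c\<in>C. l c > 0"
    using assms by (rule cone_lincombE)
  have "x = exp_flow C (\<lambda>c. ln (l c)) 1"
    unfolding C(2) exp_flow_def by (rule lincomb_cong) (use C(3) in simp)
  moreover have "jinv x = exp_flow C (\<lambda>c. - ln (l c)) 1"
    unfolding C(2) exp_flow_def jpow_lincomb[OF C(1)]
    by (rule lincomb_cong) (use C(3) in \<open>force simp: powr_def\<close>)
  ultimately show thesis using C(1) by (intro that)
qed

lemma quad_rep_jinv:
  assumes "x \<in> \<Omega>"
  shows "quad_rep x (quad_rep (jinv x) v) = v" "quad_rep (jinv x) (quad_rep x v) = v"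
proof -
  obtain C l where C: "complete_system C" and x: "x = exp_flow C l 1" "jinv x = exp_flow C (\<lambda>c. - l c) 1"
    using assms by (rule cone_exp_flowE)
  show "quad_rep x (quad_rep (jinv x) v) = v"
    unfolding x(2) by (subst x(1), rule quad_rep_exp_flow_inverse[OF C])
  show "quad_rep (jinv x) (quad_rep x v) = v"
    unfolding x(2) using quad_rep_exp_flow_inverse[OF C, of "\<lambda>c. - l c" 1 v] x(1) by simp
qed

theorem fundamental_formula:
  assumes "x \<in> \<Omega>"
  shows "quad_rep (quad_rep x y) v = quad_rep x (quad_rep y (quad_rep x v))"
proof -
  obtain C l where C: "complete_system C" and x: "x = exp_flow C l 1" 
    using assms by (rule cone_exp_flowE)
  show ?thesis unfolding x by (rule quad_rep_exp_flow_fundamental[OF C])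
qed

text \<open>The boundary points of the squares have \<open>0\<close> as an eigenvalue, and \<open>P(z)\<close> kills the corresponding
  idempotent.\<close>

lemma square_in_cone:
  assumes z: "z \<in> {y \<odot> y |y. True}" and inj: "\<And>v. quad_rep z v = 0 \<Longrightarrow> v = 0"
  shows "z \<in> \<Omega>"
proof -
  obtain C l where C: "complete_system C" and zl: "z = lincomb C l" by (rule spectral_decompositionE)
  have l: "\<forall>c\<in>C. l c \<ge> 0" using z unfolding zl lincomb_square_iff[OF C, symmetric] by blast
  have "l c \<noteq> 0" if c: "c \<in> C" for c
  proof
    assume l0: "l c = 0"
    have "quad_rep z c = 0" unfolding quad_rep_def zl lincomb_jmult[OF C] lincomb_jmult_elem[OF C c] l0
      by (simp add: jmult.zero_right)
    with inj complete_system_nonzero[OF C c] show False by blast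
  qed
  with l have "\<forall>c\<in>C. l c > 0" by (auto simp: order_less_le)
  then show ?thesis unfolding zl lincomb_in_cone_iff[OF C] .
qed

text \<open>Join \<open>y\<close> to \<open>P(x) y\<close> by the curve \<open>P(exp (t log x)) y\<close>. By the fundamental formula the quadratic
  representation of each of its points is injective, so the curve cannot meet the boundary of the
  cone: the times at which it is in the cone form a set that is both open and closed.\<close>

lemma quad_rep_in_cone:
  assumes x: "x \<in> \<Omega>" and y: "y \<in> \<Omega>"
  shows "quad_rep x y \<in> \<Omega>"
proof -
  obtain C l where C: "complete_system C" and xl: "x = exp_flow C l 1"
    using x by (rule cone_exp_flowE)
  define \<gamma> where "\<gamma> t = quad_rep (exp_flow C l t) y" for t
  have cont: "continuous_on UNIV \<gamma>"
    unfolding continuous_on_eq_continuous_at[OF open_UNIV]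
    using has_vector_derivative_continuous[OF
        has_vector_derivative_quad_rep_exp_flow[OF C has_vector_derivative_const, of l y]]
    by (simp add: \<gamma>_def[abs_def])
  have inj_flow: "v = 0" if "quad_rep (exp_flow C m t) v = 0" for m t v
    using quad_rep_exp_flow_inverse[OF C, of "\<lambda>c. - m c" t v] that by (simp add: linear_0[OF linear_quad_rep])
  have inj_y: "v = 0" if "quad_rep y v = 0" for v
    using quad_rep_jinv(2)[OF y, of v] that by (simp add: linear_0[OF linear_quad_rep])
  have inj: "v = 0" if "quad_rep (\<gamma> t) v = 0" for t v
    by (rule inj_flow[OF inj_y[OF inj_flow[OF that[unfolded \<gamma>_def quad_rep_exp_flow_fundamental[OF C]]]]])
  have "\<gamma> -` \<Omega> = \<gamma> -` {y \<odot> y |y. True}"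
  proof (rule set_eqI)
    fix t
    have "\<gamma> t \<in> {y \<odot> y |y. True}" if "\<gamma> t \<in> \<Omega>"
      using that interior_subset unfolding symmetric_cone_def by (rule rev_subsetD)
    moreover have "\<gamma> t \<in> \<Omega>" if "\<gamma> t \<in> {y \<odot> y |y. True}"
      using that inj by (rule square_in_cone)
    ultimately show "t \<in> \<gamma> -` \<Omega> \<longleftrightarrow> t \<in> \<gamma> -` {y \<odot> y |y. True}" unfolding vimage_eq by (rule iffI)
  qed
  then have "closed (\<gamma> -` \<Omega>)"
    using closed_vimage[OF closed_squares cont] by (simp only:)
  moreover have "open (\<gamma> -` \<Omega>)"
    using open_vimage[OF open_cone cont] .
  moreover have "0 \<in> \<gamma> -` \<Omega>" using y by (simp add: \<gamma>_def exp_flow_0[OF C] quad_rep_jone_left)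
  ultimately have "\<gamma> -` \<Omega> = UNIV" using clopen[of "\<gamma> -` \<Omega>"] by blast
  then have "\<gamma> 1 \<in> \<Omega>" by blast
  then show ?thesis by (simp add: \<gamma>_def xl)
qed

lemma quad_rep_injective:
  assumes "x \<in> \<Omega>" "quad_rep x u = quad_rep x v"
  shows "u = v"
proof -
  have "u = quad_rep (jinv x) (quad_rep x u)" by (rule quad_rep_jinv(2)[OF assms(1), symmetric])
  also have "\<dots> = v" unfolding assms(2) by (rule quad_rep_jinv(2)[OF assms(1)])
  finally show ?thesis .
qed

lemma quad_rep_jpow:
  assumes "x \<in> \<Omega>"
  shows "quad_rep (jpow x \<alpha>) (jpow x \<beta>) = jpow x (2 * \<alpha> + \<beta>)"
proof -
  have e: "\<alpha> + (\<alpha> + \<beta>) = 2 * \<alpha> + \<beta>" "\<alpha> + \<alpha> + \<beta> = 2 * \<alpha> + \<beta>" by simp_all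
  show ?thesis unfolding quad_rep_def jpow_jmult[OF assms] e by (simp add: scaleR_2)
qed

lemma quad_rep_jinv_self:
  assumes "x \<in> \<Omega>"
  shows "quad_rep x (jinv x) = x"
proof -
  have "quad_rep x (jinv x) = quad_rep (jpow x 1) (jpow x (- 1))" by (simp only: jpow_1[OF assms])
  also have "\<dots> = jpow x (2 * 1 + - 1)" by (rule quad_rep_jpow[OF assms])
  also have "\<dots> = x" by (simp add: jpow_1[OF assms])
  finally show ?thesis .
qed

lemma jinv_unique:
  assumes "x \<in> \<Omega>" "quad_rep x z = x"
  shows "jinv x = z"
  by (rule quad_rep_injective[OF assms(1) trans[OF quad_rep_jinv_self[OF assms(1)] assms(2)[symmetric]]])

text \<open>Inverses are characterized by \<open>P(w) w\<^bsup>-1\<^esup> = w\<close>, and the fundamental formula verifies this for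
  \<open>w = P(x) y\<close>.\<close>

lemma jinv_quad_rep:
  assumes x: "x \<in> \<Omega>" and y: "y \<in> \<Omega>"
  shows "jinv (quad_rep x y) = quad_rep (jinv x) (jinv y)"
  by (rule jinv_unique[OF quad_rep_in_cone[OF x y]])
    (simp add: fundamental_formula[OF x] quad_rep_jinv(1)[OF x] quad_rep_jinv_self[OF y])

lemma quad_rep_sqrt_twice:
  assumes x: "x \<in> \<Omega>"
  shows "quad_rep (jpow x (1/2)) (quad_rep (jpow x (1/2)) v) = quad_rep x v"
proof -
  have "quad_rep (jpow x (1/2)) jone = x"
    using jpow_jmult[OF x, of "1/2" "1/2"] by (simp add: quad_rep_jone_right jpow_1[OF x])
  with fundamental_formula[OF jpow_in_cone[OF x], of "1/2" jone v] show ?thesis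
    by (simp add: quad_rep_jone_left)
qed

lemma quad_rep_sqrt_inverse:
  assumes x: "x \<in> \<Omega>"
  shows "quad_rep (jpow x (1/2)) (quad_rep (jpow x (- 1/2)) v) = v"
    and "quad_rep (jpow x (- 1/2)) (quad_rep (jpow x (1/2)) v) = v"
  using quad_rep_jinv[OF jpow_in_cone[OF x, of "1/2"], of v] by (simp_all add: jpow_jpow[OF x])

lemma jinv_jinv:
  assumes "x \<in> \<Omega>"
  shows "jinv (jinv x) = x"
  by (simp add: jpow_jpow[OF assms] jpow_1[OF assms])

section \<open>Geometric means\<close>

lemma metric_geometric_mean_in_cone:
  "x \<in> \<Omega> \<Longrightarrow> y \<in> \<Omega> \<Longrightarrow> x \<sharp> y \<in> \<Omega>"
  unfolding metric_geometric_mean_def by (intro quad_rep_in_cone jpow_in_cone)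

lemma metric_geometric_mean_riccati:
  assumes x: "x \<in> \<Omega>" and y: "y \<in> \<Omega>"
  shows "quad_rep (x \<sharp> y) (jinv x) = y"
proof -
  let ?s = "jpow x (1/2)"
  define z where "z = quad_rep (jpow x (- 1/2)) y"
  have z: "z \<in> \<Omega>" unfolding z_def by (intro quad_rep_in_cone jpow_in_cone x y)
  have "quad_rep ?s (jinv x) = jone"
    using quad_rep_jpow[OF x, of "1/2" "-1"] by (simp add: jpow_0[OF x])
  then have "quad_rep (x \<sharp> y) (jinv x) = quad_rep ?s (jpow z (1/2) \<odot> jpow z (1/2))"
    unfolding metric_geometric_mean_def z_def[symmetric] fundamental_formula[OF jpow_in_cone[OF x]]
    by (simp add: quad_rep_jone_right)
  also have "jpow z (1/2) \<odot> jpow z (1/2) = z" by (simp add: jpow_jmult[OF z] jpow_1[OF z])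
  also have "quad_rep ?s z = y" unfolding z_def by (rule quad_rep_sqrt_inverse(1)[OF x])
  finally show ?thesis .
qed

text \<open>Transport the equation to \<open>x = e\<close> by \<open>P(x\<^bsup>1/2\<^esup>)\<^bsup>-1\<^esup>\<close>, where it becomes
  \<open>w\<^sup>2 = P(x\<^bsup>1/2\<^esup>)\<^bsup>-1\<^esup> y\<close>; square roots in the
  cone are unique.\<close>

lemma metric_geometric_mean_unique:
  assumes x: "x \<in> \<Omega>" and g: "g \<in> \<Omega>" and eq: "quad_rep g (jinv x) = y"
  shows "x \<sharp> y = g"
proof -
  let ?s = "jpow x (1/2)"
  define w where "w = quad_rep (jpow x (- 1/2)) g"
  have w: "w \<in> \<Omega>" unfolding w_def by (intro quad_rep_in_cone jpow_in_cone x g)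
  have gw: "g = quad_rep ?s w" unfolding w_def by (rule quad_rep_sqrt_inverse(1)[OF x, symmetric])
  have "quad_rep ?s (jinv x) = jone"
    using quad_rep_jpow[OF x, of "1/2" "-1"] by (simp add: jpow_0[OF x])
  then have "y = quad_rep ?s (w \<odot> w)"
    using eq unfolding gw fundamental_formula[OF jpow_in_cone[OF x]] by (simp add: quad_rep_jone_right)
  then have "quad_rep (jpow x (- 1/2)) y = w \<odot> w" by (simp add: quad_rep_sqrt_inverse(2)[OF x, simplified])
  then show ?thesis unfolding metric_geometric_mean_def gw by (simp add: jpow_half_unique[OF w])
qed

text \<open>Inverting both sides of \<open>P(g) x\<^bsup>-1\<^esup> = y\<close> gives \<open>P(g) y\<^bsup>-1\<^esup> = x\<close>, the Riccati equation with the
  arguments exchanged.\<close>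

lemma metric_geometric_mean_commute:
  assumes x: "x \<in> \<Omega>" and y: "y \<in> \<Omega>"
  shows "y \<sharp> x = x \<sharp> y"
proof (rule metric_geometric_mean_unique[OF y metric_geometric_mean_in_cone[OF x y]])
  let ?g = "x \<sharp> y"
  have g: "?g \<in> \<Omega>" by (rule metric_geometric_mean_in_cone[OF x y])
  have "jinv y = quad_rep (jinv ?g) x"
    using jinv_quad_rep[OF g jpow_in_cone[OF x], of "-1"]
    by (simp add: metric_geometric_mean_riccati[OF x y] jinv_jinv[OF x])
  then show "quad_rep ?g (jinv y) = x" by (simp add: quad_rep_jinv(1)[OF g])
qed

lemma jinv_metric_geometric_mean:
  assumes x: "x \<in> \<Omega>" and y: "y \<in> \<Omega>"
  shows "jinv x \<sharp> jinv y = jinv (x \<sharp> y)"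
proof (rule metric_geometric_mean_unique)
  let ?g = "x \<sharp> y"
  have g: "?g \<in> \<Omega>" by (rule metric_geometric_mean_in_cone[OF x y])
  show "jinv x \<in> \<Omega>" "jinv ?g \<in> \<Omega>" using x g by (auto intro: jpow_in_cone)
  show "quad_rep (jinv ?g) (jinv (jinv x)) = jinv y"
    using jinv_quad_rep[OF g jpow_in_cone[OF x], of "-1"]
    by (simp add: metric_geometric_mean_riccati[OF x y])
qed

lemma spectral_geometric_mean_jinv:
  assumes x: "x \<in> \<Omega>" and y: "y \<in> \<Omega>"
  shows "x \<natural> jinv y = quad_rep (jpow (x \<sharp> y) (- 1/2)) x"
  unfolding spectral_geometric_mean_def jinv_metric_geometric_mean[OF assms]
  by (simp add: jpow_jpow metric_geometric_mean_in_cone[OF assms])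

section \<open>Involutions and the polar decomposition\<close>

context
  fixes \<sigma> :: "'a::euclidean_jordan_algebra \<Rightarrow> 'a"
  assumes \<sigma>: "involutive_jordan_automorphism \<sigma>"
begin

lemma involution_linear: "linear \<sigma>"
  and involution_jmult: "\<sigma> (x \<odot> y) = \<sigma> x \<odot> \<sigma> y"
  and involution_involutive: "\<sigma> (\<sigma> x) = x"
  using \<sigma> unfolding involutive_jordan_automorphism_def by (auto simp: fun_eq_iff)

lemma involution_inj: "inj \<sigma>"
  using involution_involutive by (metis injI)

lemma involution_jone: "\<sigma> jone = jone"
proof -
  have "\<sigma> jone = \<sigma> jone \<odot> \<sigma> (\<sigma> jone)" by (simp add: involution_involutive jmult_one_right)
  also have "\<dots> = \<sigma> (\<sigma> jone)" unfolding involution_jmult[symmetric] by (simp add: jone_jmult)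
  finally show ?thesis by (simp add: involution_involutive)
qed

lemma involution_quad_rep: "\<sigma> (quad_rep x y) = quad_rep (\<sigma> x) (\<sigma> y)"
  by (simp add: quad_rep_def linear_diff[OF involution_linear] linear_scale[OF involution_linear] involution_jmult)

lemma involution_complete_system:
  assumes "complete_system C"
  shows "complete_system (\<sigma> ` C)"
proof -
  have inj: "inj_on \<sigma> C" using involution_inj by (rule inj_on_subset) simp
  have "(\<Sum>c\<in>\<sigma> ` C. c) = \<sigma> (\<Sum>c\<in>C. c)"
    by (simp add: sum.reindex[OF inj] linear_sum[OF involution_linear])
  moreover have "\<sigma> c \<odot> \<sigma> c = \<sigma> c \<and> \<sigma> c \<noteq> 0" if "c \<in> C" for c
    using complete_system_idem[OF assms that] complete_system_nonzero[OF assms that]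
    by (metis involution_jmult involution_involutive linear_0[OF involution_linear])
  moreover have "\<sigma> c \<odot> \<sigma> d = 0" if "c \<in> C" "d \<in> C" "c \<noteq> d" for c d
  proof -
    have "c \<odot> d = 0" using assms that by (simp add: complete_system_def orthogonal_idempotents_def)
    then show ?thesis by (metis involution_jmult linear_0[OF involution_linear])
  qed
  ultimately show ?thesis using assms
    unfolding complete_system_def orthogonal_idempotents_def by (auto simp: involution_jone)
qed

lemma involution_lincomb: "\<sigma> (lincomb C l) = lincomb (\<sigma> ` C) (\<lambda>c. l (\<sigma> c))"
proof -
  have inj: "inj_on \<sigma> C" using involution_inj by (rule inj_on_subset) simp
  show ?thesis
    by (simp add: sum.reindex[OF inj] linear_sum[OF involution_linear] linear_scale[OF involution_linear]
        involution_involutive)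
qed

lemma involution_jpow: "\<sigma> (jpow x \<alpha>) = jpow (\<sigma> x) \<alpha>"
proof -
  obtain C l where C: "complete_system C" and x: "x = lincomb C l" by (rule spectral_decompositionE)
  show ?thesis
    unfolding x jpow_lincomb[OF C] involution_lincomb jpow_lincomb[OF involution_complete_system[OF C]] ..
qed

lemma involution_in_cone:
  assumes "x \<in> \<Omega>"
  shows "\<sigma> x \<in> \<Omega>"
proof -
  obtain C l where C: "complete_system C" "x = lincomb C l" "\<forall>c\<in>C. l c > 0"
    using assms by (rule cone_lincombE)
  show ?thesis
    unfolding C(2) involution_lincomb lincomb_in_cone_iff[OF involution_complete_system[OF C(1)]]
    using C(3) by (simp add: involution_involutive)
qed

lemma involution_metric_geometric_mean: "\<sigma> (x \<sharp> y) = \<sigma> x \<sharp> \<sigma> y"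
  by (simp add: metric_geometric_mean_def involution_quad_rep involution_jpow)

lemma polar_map_decomposition:
  assumes x: "x \<in> \<Omega>"
  defines "a \<equiv> x \<sharp> \<sigma> x" and "b \<equiv> x \<natural> \<sigma> (jinv x)"
  shows "a \<in> cone_plus \<sigma>" "b \<in> cone_minus \<sigma>" "polar_map (a, b) = x"
proof -
  have sx: "\<sigma> x \<in> \<Omega>" by (rule involution_in_cone[OF x])
  have a: "a \<in> \<Omega>" unfolding a_def by (rule metric_geometric_mean_in_cone[OF x sx])
  have sa: "\<sigma> a = a"
    unfolding a_def involution_metric_geometric_mean involution_involutive
    by (rule metric_geometric_mean_commute[OF x sx])
  then show "a \<in> cone_plus \<sigma>" using a by (simp add: cone_plus_def)
  have b: "b = quad_rep (jpow a (- 1/2)) x"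
    unfolding a_def b_def involution_jpow by (rule spectral_geometric_mean_jinv[OF x sx])
  have bc: "b \<in> \<Omega>" unfolding b by (intro quad_rep_in_cone jpow_in_cone a x)
  show "polar_map (a, b) = x"
    unfolding polar_map_def b using quad_rep_sqrt_inverse(1)[OF a] by simp
  have "\<sigma> b = quad_rep (jpow a (- 1/2)) (\<sigma> x)"
    unfolding b involution_quad_rep involution_jpow sa ..
  also have "\<sigma> x = quad_rep a (jinv x)"
    unfolding a_def by (rule metric_geometric_mean_riccati[OF x sx, symmetric])
  also have "\<dots> = quad_rep (jpow a (1/2)) (quad_rep (jpow a (1/2)) (jinv x))"
    by (rule quad_rep_sqrt_twice[OF a, symmetric])
  also have "quad_rep (jpow a (- 1/2)) \<dots> = quad_rep (jpow a (1/2)) (jinv x)"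
    by (rule quad_rep_sqrt_inverse(2)[OF a])
  also have "\<dots> = jinv b"
    unfolding b using jinv_quad_rep[OF jpow_in_cone[OF a] x, of "- 1/2"] by (simp add: jpow_jpow[OF a])
  finally show "b \<in> cone_minus \<sigma>" using bc by (simp add: cone_minus_def)
qed

text \<open>The first component solves the Riccati equation for the pair \<open>x, \<sigma> x\<close>, so it is their metric mean.\<close>

lemma polar_map_components:
  assumes a: "a \<in> cone_plus \<sigma>" and b: "b \<in> cone_minus \<sigma>"
  defines "x \<equiv> polar_map (a, b)"
  shows "x \<in> \<Omega>" "x \<sharp> \<sigma> x = a" "x \<natural> \<sigma> (jinv x) = b"
proof -
  have a': "a \<in> \<Omega>" "\<sigma> a = a" and b': "b \<in> \<Omega>" "\<sigma> b = jinv b"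
    using a b by (auto simp: cone_plus_def cone_minus_def)
  let ?s = "jpow a (1/2)"
  have s: "?s \<in> \<Omega>" by (rule jpow_in_cone[OF a'(1)])
  have xs: "x = quad_rep ?s b" by (simp add: x_def polar_map_def)
  show x: "x \<in> \<Omega>" unfolding xs by (rule quad_rep_in_cone[OF s b'(1)])
  have sx: "\<sigma> x \<in> \<Omega>" by (rule involution_in_cone[OF x])
  have "quad_rep a (jinv x) = quad_rep ?s (quad_rep ?s (quad_rep (jinv ?s) (jinv b)))"
    unfolding xs jinv_quad_rep[OF s b'(1)] by (rule quad_rep_sqrt_twice[OF a'(1), symmetric])
  also have "\<dots> = quad_rep ?s (jinv b)" by (simp only: quad_rep_jinv(1)[OF s])
  also have "\<dots> = \<sigma> x" by (simp add: xs involution_quad_rep involution_jpow a'(2) b'(2))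
  finally show ax: "x \<sharp> \<sigma> x = a" by (rule metric_geometric_mean_unique[OF x a'(1)])
  have "x \<natural> \<sigma> (jinv x) = quad_rep (jpow a (- 1/2)) x"
    unfolding involution_jpow spectral_geometric_mean_jinv[OF x sx] ax ..
  also have "\<dots> = b" unfolding xs by (rule quad_rep_sqrt_inverse(2)[OF a'(1)])
  finally show "x \<natural> \<sigma> (jinv x) = b" .
qed

end

section \<open>Powers depend analytically on their argument\<close>

lemma has_sum_finite_sum:
  fixes f :: "'i \<Rightarrow> 'k \<Rightarrow> 'b::real_normed_vector"
  assumes "finite I" "\<And>i. i \<in> I \<Longrightarrow> (f i has_sum S i) A"
  shows "((\<lambda>k. \<Sum>i\<in>I. f i k) has_sum (\<Sum>i\<in>I. S i)) A"
  using assms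
proof (induction I rule: finite_induct)
  case (insert i I)
  have "(f i has_sum S i) A" "((\<lambda>k. \<Sum>i\<in>I. f i k) has_sum (\<Sum>i\<in>I. S i)) A"
    using insert by auto
  from has_sum_add[OF this] insert show ?case by simp
qed simp

lemma gbinomial_abs_summable:
  fixes a q :: real
  assumes "\<bar>q\<bar> < 1"
  shows "summable (\<lambda>k. norm ((a gchoose k) * q ^ k))"
proof (rule powser_insidea)
  \<comment> \<open>a point between \<open>\<bar>q\<bar>\<close> and the radius of convergence\<close>
  define z where "z = (1 + \<bar>q\<bar>) / 2"
  have z: "\<bar>q\<bar> < z" "\<bar>z\<bar> < 1" using assms by (simp_all add: z_def)
  show "summable (\<lambda>k. (a gchoose k) * z ^ k)" using gen_binomial_real[OF z(2)] by (rule sums_summable)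
  show "norm q < norm z" using z by simp
qed

lemma gbinomial_powr_has_sum:
  fixes a t :: real
  assumes "\<bar>t\<bar> < 1"
  shows "((\<lambda>k. (a gchoose k) * t ^ k) has_sum (1 + t) powr a) UNIV"
  by (rule norm_summable_imp_has_sum[OF gbinomial_abs_summable gen_binomial_real]) (fact assms)+

lemma jpower_lincomb:
  assumes "complete_system C"
  shows "jpower (lincomb C l) k = lincomb C (\<lambda>c. l c ^ k)"
  by (induction k) (simp_all add: complete_system_sum[OF assms] lincomb_jmult[OF assms])

text \<open>Expand the power around the scalar \<open>M\<close>, chosen to dominate \<open>x\<close>: then all eigenvalues of \<open>e - x / M\<close>
  lie strictly between \<open>0\<close> and \<open>1\<close>, and the scalar binomial series applies to each of them.\<close>

lemma jpow_binomial_series: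
  assumes x: "x \<in> \<Omega>" and M: "M > 0" "M *\<^sub>R jone - x \<in> \<Omega>"
  shows "((\<lambda>k. (M powr \<alpha> * ((\<alpha> gchoose k) * (- 1) ^ k)) *\<^sub>R jpower (jone - (1 / M) *\<^sub>R x) k)
    has_sum jpow x \<alpha>) UNIV"
proof -
  obtain C l where C: "complete_system C" and xl: "x = lincomb C l" and l: "\<forall>c\<in>C. l c > 0"
    using x by (rule cone_lincombE)
  have 1: "M *\<^sub>R jone - x = lincomb C (\<lambda>c. (- 1) * l c + M)" unfolding lincomb_affine[OF C] by (simp add: xl)
  have lM: "\<forall>c\<in>C. l c < M" using M(2) unfolding 1 lincomb_in_cone_iff[OF C] by simp
  have u: "jone - (1 / M) *\<^sub>R x = lincomb C (\<lambda>c. (- 1 / M) * l c + 1)"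
    unfolding lincomb_affine[OF C] by (simp add: xl)
  have e: "(M powr \<alpha> * ((\<alpha> gchoose k) * (- 1) ^ k)) *\<^sub>R jpower (jone - (1 / M) *\<^sub>R x) k
     = (\<Sum>c\<in>C. (M powr \<alpha> * ((\<alpha> gchoose k) * ((l c - M) / M) ^ k)) *\<^sub>R c)" for k
    unfolding u jpower_lincomb[OF C] lincomb_scale[symmetric]
  proof (rule lincomb_cong)
    fix c
    have "(- 1) * ((- 1 / M) * l c + 1) = (l c - M) / M" using M(1) by (simp add: diff_divide_distrib)
    then have "(- 1) ^ k * ((- 1 / M) * l c + 1) ^ k = ((l c - M) / M) ^ k"
      unfolding power_mult_distrib[symmetric] by (simp only:)
    then show "M powr \<alpha> * ((\<alpha> gchoose k) * (- 1) ^ k) * ((- 1 / M) * l c + 1) ^ k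
      = M powr \<alpha> * ((\<alpha> gchoose k) * ((l c - M) / M) ^ k)" by (simp only: mult.assoc)
  qed
  have "((\<lambda>k. (M powr \<alpha> * ((\<alpha> gchoose k) * ((l c - M) / M) ^ k)) *\<^sub>R c) has_sum l c powr \<alpha> *\<^sub>R c) UNIV"
    if c: "c \<in> C" for c
  proof -
    have lc: "l c > 0" "l c < M" using l lM c by auto
    have "\<bar>(l c - M) / M\<bar> < 1" using lc M(1) by (simp add: abs_if field_simps)
    from has_sum_cmult_right[OF gbinomial_powr_has_sum[OF this, of \<alpha>], of "M powr \<alpha>"]
    have "((\<lambda>k. M powr \<alpha> * ((\<alpha> gchoose k) * ((l c - M) / M) ^ k)) has_sum
        M powr \<alpha> * (1 + (l c - M) / M) powr \<alpha>) UNIV" .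
    moreover have "M powr \<alpha> * (1 + (l c - M) / M) powr \<alpha> = l c powr \<alpha>"
    proof -
      have "1 + (l c - M) / M = l c / M" using M(1) by (simp add: field_simps)
      then show ?thesis using lc M(1) by (simp add: powr_divide)
    qed
    ultimately have "((\<lambda>k. M powr \<alpha> * ((\<alpha> gchoose k) * ((l c - M) / M) ^ k)) has_sum l c powr \<alpha>) UNIV"
      by (simp only:)
    from has_sum_bounded_linear[OF bounded_linear_scaleR_left this] show ?thesis .
  qed
  from has_sum_finite_sum[OF complete_system_finite[OF C] this]
  show ?thesis unfolding e unfolding xl jpow_lincomb[OF C] .
qed

lemma cone_strict_upper_bound:
  assumes "x \<in> \<Omega>"
  obtains M \<rho> where "M > 0" "M *\<^sub>R jone - x \<in> \<Omega>" "0 \<le> \<rho>" "\<rho> < 1"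
    "\<And>v. norm ((jone - (1 / M) *\<^sub>R x) \<odot> v) \<le> \<rho> * norm v"
proof -
  obtain C l where C: "complete_system C" and xl: "x = lincomb C l" and l: "\<forall>c\<in>C. l c > 0"
    using assms by (rule cone_lincombE)
  note fin = complete_system_finite[OF C]
  \<comment> \<open>inserting \<open>0\<close> keeps the maximum meaningful and \<open>M\<close> positive\<close>
  define M where "M = Max (insert 0 (l ` C)) + 1"
  have "0 \<le> Max (insert 0 (l ` C))" using fin by simp
  then have M: "M > 0" by (simp add: M_def)
  have lM: "l c < M" if "c \<in> C" for c
  proof -
    have "l c \<le> Max (insert 0 (l ` C))" using fin that by simp
    then show ?thesis by (simp add: M_def)
  qed
  have 1: "M *\<^sub>R jone - x = lincomb C (\<lambda>c. (- 1) * l c + M)" unfolding lincomb_affine[OF C] by (simp add: xl)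
  have 2: "M *\<^sub>R jone - x \<in> \<Omega>" unfolding 1 lincomb_in_cone_iff[OF C] using lM by simp
  define k where "k c = (- 1 / M) * l c + 1" for c
  have u: "jone - (1 / M) *\<^sub>R x = lincomb C k"
    unfolding k_def lincomb_affine[OF C] by (simp add: xl)
  have k: "0 \<le> k c" "k c < 1" if "c \<in> C" for c
    using lM[OF that] l that M by (auto simp: k_def field_simps)
  define \<rho> where "\<rho> = Max (insert 0 (k ` C))"
  have "0 \<le> \<rho>" "\<rho> < 1" using fin k by (auto simp: \<rho>_def)
  have "\<bar>k c\<bar> \<le> \<rho>" if "c \<in> C" for c
    using fin k(1)[OF that] that by (simp add: \<rho>_def)
  then have "norm ((jone - (1 / M) *\<^sub>R x) \<odot> v) \<le> \<rho> * norm v" for v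
    unfolding u using \<open>0 \<le> \<rho>\<close> by (intro norm_lincomb_jmult_le[OF C])
  with M 2 \<open>0 \<le> \<rho>\<close> \<open>\<rho> < 1\<close> show thesis by (rule that)
qed

text \<open>The powers of \<open>u + r h\<close>, as power series in \<open>h\<close>, grow at most like \<open>q\<^sup>k\<close> for any \<open>q\<close> larger than the
  operator norm of \<open>L(u)\<close>: multiplication by \<open>u\<close> costs at most that norm, and multiplication by
  \<open>r h\<close> costs an amount proportional to the size of the cube.\<close>

lemma cube_series_jpower_affine:
  fixes u :: "'a::euclidean_jordan_algebra"
  assumes u: "\<And>v. norm (u \<odot> v) \<le> \<rho> * norm v" "0 \<le> \<rho>" and q: "\<rho> < q"
  obtains s0 where "s0 > 0" and "\<And>s k. 0 < s \<Longrightarrow> s \<le> s0 \<Longrightarrow>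
    cube_series s (q ^ k * norm (jone :: 'a)) (\<lambda>h. jpower (u + r *\<^sub>R h) k)"
proof -
  obtain D where D: "cube_series 1 D (\<lambda>h::'a. h)" using cube_series_id[of 1] by auto
  have D0: "D \<ge> 0" using cube_series_nonneg[OF D] by simp
  obtain K where K: "K \<ge> 0" "\<And>a b :: 'a. norm (a \<odot> b) \<le> norm a * norm b * K"
    using jmult.nonneg_bounded by blast
  define E where "E = \<bar>r\<bar> * (K * D) + 1"
  have E: "E > 0" using K D0 by (simp add: E_def add_nonneg_pos)
  \<comment> \<open>on a cube of size at most \<open>s0\<close>, multiplication by \<open>r h\<close> has norm at most \<open>q - \<rho>\<close>\<close>
  define s0 where "s0 = min 1 ((q - \<rho>) / E)"
  have s0: "s0 > 0" using q E by (simp add: s0_def)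
  have "cube_series s (q ^ k * norm (jone :: 'a)) (\<lambda>h. jpower (u + r *\<^sub>R h) k)"
    if s: "0 < s" "s \<le> s0" for s k
  proof (induction k)
    case 0
    show ?case using cube_series_const[OF s(1), of "jone :: 'a"] by simp
  next
    case (Suc k)
    let ?N = "q ^ k * norm (jone :: 'a)" and ?f = "\<lambda>h. jpower (u + r *\<^sub>R h) k"
    have N0: "?N \<ge> 0" by (rule cube_series_nonneg[OF Suc s(1)])
    have 1: "cube_series s (\<rho> * ?N) (\<lambda>h. u \<odot> ?f h)"
      by (rule cube_series_linear[OF Suc s(1) linear_jmult u])
    have "cube_series s (s / 1 * D) (\<lambda>h::'a. h)"
      by (rule cube_series_shrink[OF D s(1)]) (use s in \<open>simp_all add: s0_def\<close>)
    from cube_series_bilinear[OF this Suc s(1) bounded_bilinear_jmult, of K] K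
    have "cube_series s (K * (s * D) * ?N) (\<lambda>h. h \<odot> ?f h)" by (simp add: mult_ac)
    from cube_series_linear[OF this s(1) bounded_linear.linear[OF bounded_linear_scaleR_right, of r], of "\<bar>r\<bar>"]
    have "cube_series s (\<bar>r\<bar> * (K * (s * D) * ?N)) (\<lambda>h. r *\<^sub>R (h \<odot> ?f h))" by simp
    from cube_series_add[OF 1 this s(1)]
    have 2: "cube_series s (\<rho> * ?N + \<bar>r\<bar> * (K * (s * D) * ?N)) (\<lambda>h. jpower (u + r *\<^sub>R h) (Suc k))"
      by (simp add: jmult_add_left jmult_scaleR_left)
    have "s * (\<bar>r\<bar> * (K * D)) \<le> s * E" using s by (intro mult_left_mono) (auto simp: E_def)
    also have "\<dots> \<le> (q - \<rho>) / E * E" using s E by (intro mult_right_mono) (auto simp: s0_def)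
    also have "\<dots> = q - \<rho>" using E by simp
    finally have "(\<rho> + s * (\<bar>r\<bar> * (K * D))) * ?N \<le> q * ?N" using N0 by (intro mult_right_mono) auto
    then have "\<rho> * ?N + \<bar>r\<bar> * (K * (s * D) * ?N) \<le> q ^ Suc k * norm (jone :: 'a)"
      by (simp add: algebra_simps)
    with 2 show ?case by (rule cube_series_mono)
  qed
  with s0 show thesis by (rule that)
qed

text \<open>In the weighted norm of a small cube, the \<open>k\<close>-th term of the binomial series is at most a constant times
  \<open>\<bar>\<alpha> gchoose k\<bar> q\<^sup>k\<close> with \<open>q < 1\<close>, so the series converges there and its sum is again a power series.\<close>

theorem real_analytic_at_jpow:
  fixes x :: "'a::euclidean_jordan_algebra"
  assumes x: "x \<in> \<Omega>"
  shows "real_analytic_at (\<lambda>x. jpow x \<alpha>) x"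
proof -
  obtain M \<rho> where M: "M > 0" "M *\<^sub>R jone - x \<in> \<Omega>" and \<rho>: "0 \<le> \<rho>" "\<rho> < 1"
    and bound: "\<And>v. norm ((jone - (1 / M) *\<^sub>R x) \<odot> v) \<le> \<rho> * norm v"
    using x by (rule cone_strict_upper_bound) (rule that)
  define q where "q = (1 + \<rho>) / 2"
  have q: "\<rho> < q" "0 < q" "q < 1" using \<rho> by (simp_all add: q_def)
  obtain s0 where s0: "s0 > 0" and pow: "\<And>s k. 0 < s \<Longrightarrow> s \<le> s0 \<Longrightarrow>
    cube_series s (q ^ k * norm (jone :: 'a)) (\<lambda>h. jpower ((jone - (1 / M) *\<^sub>R x) + (- 1 / M) *\<^sub>R h) k)"
    by (rule cube_series_jpower_affine[OF bound \<rho>(1) q(1), of "- 1 / M"]) (rule that)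
  \<comment> \<open>near \<open>x\<close> the same \<open>M\<close> dominates, so one binomial series represents the power there\<close>
  have "open (\<Omega> \<inter> (\<lambda>y. M *\<^sub>R jone - y) -` \<Omega>)"
    by (intro open_Int open_cone open_vimage continuous_intros)
  then obtain e where e: "e > 0" "ball x e \<subseteq> \<Omega> \<inter> (\<lambda>y. M *\<^sub>R jone - y) -` \<Omega>"
    using x M(2) open_contains_ball by (metis IntI vimageI)
  define s where "s = min s0 (e / (DIM('a) + 1))"
  have s: "0 < s" "s \<le> s0" "s \<le> e / (DIM('a) + 1)" using s0 e by (simp_all add: s_def)
  define a where "a k = M powr \<alpha> * ((\<alpha> gchoose k) * (- 1) ^ k)" for k
  have "(\<lambda>k. \<bar>a k\<bar> * (q ^ k * norm (jone :: 'a))) =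
      (\<lambda>k. (M powr \<alpha> * norm (jone :: 'a)) * norm ((\<alpha> gchoose k) * q ^ k))"
    using q by (simp add: a_def abs_mult power_abs fun_eq_iff mult_ac)
  moreover have "(\<lambda>k. (M powr \<alpha> * norm (jone :: 'a)) * norm ((\<alpha> gchoose k) * q ^ k)) summable_on UNIV"
  proof (rule summable_on_cmult_right)
    have "summable (\<lambda>k. norm (norm ((\<alpha> gchoose k) * q ^ k)))"
      using gbinomial_abs_summable[of q \<alpha>] q by simp
    then show "(\<lambda>k. norm ((\<alpha> gchoose k) * q ^ k)) summable_on UNIV"
      by (rule norm_summable_imp_summable_on)
  qed
  ultimately have sum: "(\<lambda>k. \<bar>a k\<bar> * (q ^ k * norm (jone :: 'a))) summable_on UNIV" by simp
  have "cube_series s (infsum (\<lambda>k. \<bar>a k\<bar> * (q ^ k * norm (jone :: 'a))) UNIV) (\<lambda>h. jpow (x + h) \<alpha>)"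
  proof (rule cube_series_has_sum[OF _ s(1) has_sum_infsum[OF sum]])
    fix k
    show "cube_series s (\<bar>a k\<bar> * (q ^ k * norm (jone :: 'a)))
       (\<lambda>h. a k *\<^sub>R jpower ((jone - (1 / M) *\<^sub>R x) + (- 1 / M) *\<^sub>R h) k)"
      by (rule cube_series_linear[OF pow[OF s(1,2)] s(1) bounded_linear.linear[OF bounded_linear_scaleR_right]]) simp_all
  next
    fix h :: 'a assume h: "h \<in> cube s"
    then have "h \<in> cube (e / (DIM('a) + 1))" using cube_subset[OF s(3)] by blast
    then have "norm h < e" by (rule norm_less_of_in_cube) (fact e(1))
    then have "x + h \<in> ball x e" by (simp add: dist_norm)
    with e(2) have "x + h \<in> \<Omega>" "M *\<^sub>R jone - (x + h) \<in> \<Omega>" by auto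
    from jpow_binomial_series[OF this(1) M(1) this(2), of \<alpha>]
    show "((\<lambda>k. a k *\<^sub>R jpower ((jone - (1 / M) *\<^sub>R x) + (- 1 / M) *\<^sub>R h) k) has_sum jpow (x + h) \<alpha>) UNIV"
      by (simp add: a_def scaleR_add_right diff_diff_add)
  qed
  then show ?thesis by (rule cube_series_imp_real_analytic_at) (fact s(1))
qed

lemma real_analytic_at_jpow_compose:
  assumes "real_analytic_at f x" "f x \<in> \<Omega>"
  shows "real_analytic_at (\<lambda>y. jpow (f y) \<alpha>) x"
  by (rule real_analytic_at_compose[OF assms(1) real_analytic_at_jpow[OF assms(2)]])

lemma real_analytic_at_quad_rep:
  assumes f: "real_analytic_at f x" and g: "real_analytic_at g x"
  shows "real_analytic_at (\<lambda>y. quad_rep (f y) (g y)) x"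
  unfolding quad_rep_def
  by (intro real_analytic_at_diff real_analytic_at_scaleR
      real_analytic_at_bilinear[where B = "(\<odot>)"] bounded_bilinear_jmult f g)

lemma real_analytic_at_metric_geometric_mean:
  assumes f: "real_analytic_at f x" "f x \<in> \<Omega>" and g: "real_analytic_at g x" "g x \<in> \<Omega>"
  shows "real_analytic_at (\<lambda>y. f y \<sharp> g y) x"
  unfolding metric_geometric_mean_def
  by (intro real_analytic_at_quad_rep real_analytic_at_jpow_compose quad_rep_in_cone jpow_in_cone f g)

lemma real_analytic_at_spectral_geometric_mean:
  assumes f: "real_analytic_at f x" "f x \<in> \<Omega>" and g: "real_analytic_at g x" "g x \<in> \<Omega>"
  shows "real_analytic_at (\<lambda>y. f y \<natural> g y) x"
  unfolding spectral_geometric_mean_def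
  by (intro real_analytic_at_quad_rep real_analytic_at_jpow_compose real_analytic_at_metric_geometric_mean
      metric_geometric_mean_in_cone jpow_in_cone f g)

section \<open>The Cayley transform\<close>

text \<open>On the spectrum this is \<open>t \<mapsto> (t - 1) / (t + 1)\<close>, written with a single inverse.\<close>

definition cayley :: "'a::euclidean_jordan_algebra \<Rightarrow> 'a" where
  "cayley x = jone - 2 *\<^sub>R jinv (x + jone)"

definition cayley_inverse :: "'a::euclidean_jordan_algebra \<Rightarrow> 'a" where
  "cayley_inverse y = 2 *\<^sub>R jinv (jone - y) - jone"

definition cayley_range :: "'a::euclidean_jordan_algebra set" where
  "cayley_range = {y. jone - y \<in> \<Omega> \<and> jone + y \<in> \<Omega>}"

lemma cayley_lincomb:
  assumes C: "complete_system C" and l: "\<forall>c\<in>C. l c > 0"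
  shows "cayley (lincomb C l) = lincomb C (\<lambda>c. (l c - 1) / (l c + 1))"
proof -
  have 1: "lincomb C l + jone = lincomb C (\<lambda>c. 1 * l c + 1)" unfolding lincomb_affine[OF C] by simp
  have 2: "jinv (lincomb C l + jone) = lincomb C (\<lambda>c. (1 * l c + 1) powr - 1)"
    unfolding 1 by (rule jpow_lincomb[OF C])
  have "cayley (lincomb C l) = lincomb C (\<lambda>c. (- 2) * (1 * l c + 1) powr - 1 + 1)"
    unfolding cayley_def 2 lincomb_affine[OF C] by simp
  also have "\<dots> = lincomb C (\<lambda>c. (l c - 1) / (l c + 1))"
  proof (rule lincomb_cong)
    fix c assume "c \<in> C"
    with l have "l c > 0" by blast
    then show "(- 2) * (1 * l c + 1) powr - 1 + 1 = (l c - 1) / (l c + 1)"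
      by (simp add: powr_minus divide_simps)
  qed
  finally show ?thesis .
qed

lemma cayley_inverse_lincomb:
  assumes C: "complete_system C" and l: "\<forall>c\<in>C. l c < 1"
  shows "cayley_inverse (lincomb C l) = lincomb C (\<lambda>c. (1 + l c) / (1 - l c))"
proof -
  have 1: "jone - lincomb C l = lincomb C (\<lambda>c. (- 1) * l c + 1)" unfolding lincomb_affine[OF C] by simp
  have 2: "jinv (jone - lincomb C l) = lincomb C (\<lambda>c. ((- 1) * l c + 1) powr - 1)"
    unfolding 1 by (rule jpow_lincomb[OF C])
  have "cayley_inverse (lincomb C l) = lincomb C (\<lambda>c. 2 * ((- 1) * l c + 1) powr - 1 + - 1)"
    unfolding cayley_inverse_def 2 lincomb_affine[OF C] by simp
  also have "\<dots> = lincomb C (\<lambda>c. (1 + l c) / (1 - l c))"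
  proof (rule lincomb_cong)
    fix c assume "c \<in> C"
    with l have "l c < 1" by blast
    then show "2 * ((- 1) * l c + 1) powr - 1 + - 1 = (1 + l c) / (1 - l c)"
      by (simp add: powr_minus divide_simps)
  qed
  finally show ?thesis .
qed

lemma lincomb_in_cayley_range_iff:
  assumes C: "complete_system C"
  shows "lincomb C l \<in> cayley_range \<longleftrightarrow> (\<forall>c\<in>C. \<bar>l c\<bar> < 1)"
proof -
  have 1: "jone - lincomb C l = lincomb C (\<lambda>c. (- 1) * l c + 1)" unfolding lincomb_affine[OF C] by simp
  have 2: "jone + lincomb C l = lincomb C (\<lambda>c. 1 * l c + 1)" unfolding lincomb_affine[OF C] by simp
  show ?thesis unfolding cayley_range_def mem_Collect_eq 1 2 lincomb_in_cone_iff[OF C]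
    by (force simp: abs_less_iff)
qed

lemma open_cayley_range: "open (cayley_range :: 'a::euclidean_jordan_algebra set)"
proof -
  have e: "cayley_range = (\<lambda>y :: 'a. jone - y) -` \<Omega> \<inter> (\<lambda>y. jone + y) -` \<Omega>" by (auto simp: cayley_range_def)
  show ?thesis unfolding e by (intro open_Int open_vimage open_cone continuous_intros)
qed

lemma cayley_in_range:
  assumes "x \<in> \<Omega>"
  shows "cayley x \<in> cayley_range" "cayley_inverse (cayley x) = x" "cayley (jinv x) = - cayley x"
proof -
  obtain C l where C: "complete_system C" and x: "x = lincomb C l" and l: "\<forall>c\<in>C. l c > 0"
    using assms by (rule cone_lincombE)
  have lt: "\<forall>c\<in>C. \<bar>(l c - 1) / (l c + 1)\<bar> < 1"
  proof
    fix c assume "c \<in> C"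
    with l have "l c > 0" by blast
    then show "\<bar>(l c - 1) / (l c + 1)\<bar> < 1" by (simp add: abs_less_iff divide_simps)
  qed
  show "cayley x \<in> cayley_range"
    unfolding x cayley_lincomb[OF C l] lincomb_in_cayley_range_iff[OF C] by (fact lt)
  have lt': "\<forall>c\<in>C. (l c - 1) / (l c + 1) < 1"
    using lt by (blast intro: le_less_trans[OF abs_ge_self])
  show "cayley_inverse (cayley x) = x"
    unfolding x cayley_lincomb[OF C l] cayley_inverse_lincomb[OF C lt']
  proof (rule lincomb_cong)
    fix c assume "c \<in> C"
    with l have "l c > 0" by blast
    then show "(1 + (l c - 1) / (l c + 1)) / (1 - (l c - 1) / (l c + 1)) = l c"
      by (simp add: divide_simps)
  qed
  have l': "\<forall>c\<in>C. l c powr - 1 > 0" using l by force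
  show "cayley (jinv x) = - cayley x"
    unfolding x jpow_lincomb[OF C] cayley_lincomb[OF C l] cayley_lincomb[OF C l'] lincomb_uminus[symmetric]
  proof (rule lincomb_cong)
    fix c assume "c \<in> C"
    with l have "l c > 0" by blast
    then show "(l c powr - 1 - 1) / (l c powr - 1 + 1) = - ((l c - 1) / (l c + 1))"
      by (simp add: powr_minus divide_simps)
  qed
qed

lemma cayley_inverse_in_cone:
  assumes "y \<in> cayley_range"
  shows "cayley_inverse y \<in> \<Omega>" "cayley (cayley_inverse y) = y"
proof -
  obtain C l where C: "complete_system C" and y: "y = lincomb C l" by (rule spectral_decompositionE)
  have l: "\<forall>c\<in>C. \<bar>l c\<bar> < 1" using assms unfolding y lincomb_in_cayley_range_iff[OF C] .
  have l1: "\<forall>c\<in>C. l c < 1" and pos: "\<forall>c\<in>C. (1 + l c) / (1 - l c) > 0"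
    using l by (auto simp: abs_less_iff divide_simps)
  show "cayley_inverse y \<in> \<Omega>"
    unfolding y cayley_inverse_lincomb[OF C l1] lincomb_in_cone_iff[OF C] by (fact pos)
  show "cayley (cayley_inverse y) = y"
    unfolding y cayley_inverse_lincomb[OF C l1] cayley_lincomb[OF C pos]
  proof (rule lincomb_cong)
    fix c assume "c \<in> C"
    with l1 have "l c < 1" by blast
    then show "((1 + l c) / (1 - l c) - 1) / ((1 + l c) / (1 - l c) + 1) = l c"
      by (simp add: divide_simps)
  qed
qed

lemma add_jone_in_cone:
  assumes "x \<in> \<Omega>"
  shows "x + jone \<in> \<Omega>"
proof -
  obtain C l where C: "complete_system C" and x: "x = lincomb C l" and l: "\<forall>c\<in>C. l c > 0"
    using assms by (rule cone_lincombE)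
  have 1: "lincomb C l + jone = lincomb C (\<lambda>c. 1 * l c + 1)" unfolding lincomb_affine[OF C] by simp
  show ?thesis unfolding x 1 lincomb_in_cone_iff[OF C] using l by force
qed

lemma real_analytic_at_cayley:
  assumes "real_analytic_at f x" "f x \<in> \<Omega>"
  shows "real_analytic_at (\<lambda>y. cayley (f y)) x"
  unfolding cayley_def
  by (intro real_analytic_at_diff real_analytic_at_const real_analytic_at_scaleR
      real_analytic_at_jpow_compose real_analytic_at_add add_jone_in_cone assms)

lemma real_analytic_at_cayley_inverse:
  assumes "real_analytic_at f x" "f x \<in> cayley_range"
  shows "real_analytic_at (\<lambda>y. cayley_inverse (f y)) x"
  unfolding cayley_inverse_def
  by (intro real_analytic_at_diff real_analytic_at_const real_analytic_at_scaleR
      real_analytic_at_jpow_compose assms(1)) (use assms(2) in \<open>simp add: cayley_range_def\<close>)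

section \<open>Submanifolds and the polar map\<close>

lemma embedded_analytic_submanifoldI:
  fixes \<phi> :: "'a::euclidean_space \<Rightarrow> 'a"
  assumes "open U" "S \<subseteq> U" "open W" "bianalytic U W \<phi>" "subspace L" "\<phi> ` S = L \<inter> W"
  shows "embedded_analytic_submanifold S"
  unfolding embedded_analytic_submanifold_def
proof (rule exI[of _ "dim L"], rule ballI, rule exI[of _ U], rule exI[of _ W], rule exI[of _ L],
    rule exI[of _ \<phi>], intro conjI)
  fix x assume "x \<in> S"
  show "open U" "open W" "bianalytic U W \<phi>" "subspace L" by fact+
  show "x \<in> U" using \<open>x \<in> S\<close> assms(2) by blast
  show "dim L = dim L" ..
  show "\<phi> ` (S \<inter> U) = L \<inter> W" using assms(2,6) by (simp add: Int_absorb2)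
qed

lemma bianalytic_ident: "open U \<Longrightarrow> bianalytic U U (\<lambda>x. x)"
  by (rule bianalyticI[of U U _ U U "\<lambda>x. x", THEN conjunct1]) (simp_all add: real_analytic_at_ident)

lemma embedded_analytic_submanifold_subspace_Int_open:
  assumes "open U" "subspace L"
  shows "embedded_analytic_submanifold (L \<inter> U)"
  by (rule embedded_analytic_submanifoldI[OF assms(1) _ assms(1) bianalytic_ident[OF assms(1)] assms(2)]) auto

lemma bianalytic_cayley: "bianalytic \<Omega> cayley_range cayley"
proof (rule bianalyticI[THEN conjunct1])
  show "open \<Omega>" "open cayley_range" by (rule open_cone open_cayley_range)+
  show "real_analytic_at cayley x" if "x \<in> \<Omega>" for x
    by (rule real_analytic_at_cayley[OF real_analytic_at_ident that])
  show "real_analytic_at cayley_inverse y" if "y \<in> cayley_range" for y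
    by (rule real_analytic_at_cayley_inverse[OF real_analytic_at_ident that])
  show "cayley x \<in> cayley_range \<and> cayley_inverse (cayley x) = x" if "x \<in> \<Omega>" for x
    using cayley_in_range(1,2)[OF that] by (rule conjI)
  show "cayley_inverse y \<in> \<Omega> \<and> cayley (cayley_inverse y) = y" if "y \<in> cayley_range" for y
    using cayley_inverse_in_cone[OF that] by (rule conjI)
qed (rule order_refl)+

lemma bianalytic_id_cayley:
  "bianalytic (\<Omega> \<times> \<Omega>) (\<Omega> \<times> cayley_range) (\<lambda>p. (fst p, cayley (snd p)))"
proof (rule bianalyticI[where g = "\<lambda>p. (fst p, cayley_inverse (snd p))", THEN conjunct1])
  show "open (\<Omega> \<times> \<Omega>)" "open (\<Omega> \<times> cayley_range)"
    by (intro open_Times open_cone open_cayley_range)+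
  show "real_analytic_at (\<lambda>p. (fst p, cayley (snd p))) p" if "p \<in> \<Omega> \<times> \<Omega>" for p :: "'a \<times> 'b"
    using that by (intro real_analytic_at_Pair real_analytic_at_fst real_analytic_at_cayley
        real_analytic_at_snd real_analytic_at_ident) auto
  show "real_analytic_at (\<lambda>p. (fst p, cayley_inverse (snd p))) p" if "p \<in> \<Omega> \<times> cayley_range" for p :: "'a \<times> 'b"
    using that by (intro real_analytic_at_Pair real_analytic_at_fst real_analytic_at_cayley_inverse
        real_analytic_at_snd real_analytic_at_ident) auto
qed (auto simp: cayley_in_range cayley_inverse_in_cone)

context
  fixes \<sigma> :: "'a::euclidean_jordan_algebra \<Rightarrow> 'a"
  assumes \<sigma>: "involutive_jordan_automorphism \<sigma>"
begin

lemma subspace_fixed: "subspace {x. \<sigma> x = x}"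
  and subspace_antifixed: "subspace {x. \<sigma> x = - x}"
  using involution_linear[OF \<sigma>]
  by (auto simp: subspace_def linear_0 linear_add linear_scale)

lemma cone_plus_eq: "cone_plus \<sigma> = {x. \<sigma> x = x} \<inter> \<Omega>"
  by (auto simp: cone_plus_def)

lemma involution_cayley: "\<sigma> (cayley x) = cayley (\<sigma> x)"
  by (simp add: cayley_def linear_diff[OF involution_linear[OF \<sigma>]] linear_scale[OF involution_linear[OF \<sigma>]]
      linear_add[OF involution_linear[OF \<sigma>]] involution_jpow[OF \<sigma>] involution_jone[OF \<sigma>])

lemma cayley_image_cone_minus: "cayley ` cone_minus \<sigma> = {x. \<sigma> x = - x} \<inter> cayley_range"
proof (intro set_eqI iffI)
  fix y assume "y \<in> cayley ` cone_minus \<sigma>"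
  then obtain x where x: "x \<in> \<Omega>" "\<sigma> x = jinv x" "y = cayley x" by (auto simp: cone_minus_def)
  then show "y \<in> {x. \<sigma> x = - x} \<inter> cayley_range"
    using cayley_in_range[OF x(1)] by (simp add: involution_cayley)
next
  fix y assume "y \<in> {x. \<sigma> x = - x} \<inter> cayley_range"
  then have y: "\<sigma> y = - y" "y \<in> cayley_range" by auto
  define x where "x = cayley_inverse y"
  have x: "x \<in> \<Omega>" and yx: "y = cayley x" using cayley_inverse_in_cone[OF y(2)] by (simp_all add: x_def)
  have "cayley (\<sigma> x) = cayley (jinv x)"
    using y(1) cayley_in_range(3)[OF x] by (simp add: yx involution_cayley)
  then have "cayley_inverse (cayley (\<sigma> x)) = cayley_inverse (cayley (jinv x))" by (rule arg_cong)
  then have "\<sigma> x = jinv x"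
    unfolding cayley_in_range(2)[OF involution_in_cone[OF \<sigma> x]] cayley_in_range(2)[OF jpow_in_cone[OF x]] .
  then show "y \<in> cayley ` cone_minus \<sigma>" using x yx by (auto simp: cone_minus_def)
qed

lemma embedded_cone_plus: "embedded_analytic_submanifold (cone_plus \<sigma>)"
  unfolding cone_plus_eq by (rule embedded_analytic_submanifold_subspace_Int_open[OF open_cone subspace_fixed])

lemma embedded_cone_minus: "embedded_analytic_submanifold (cone_minus \<sigma>)"
  by (rule embedded_analytic_submanifoldI[OF open_cone _ open_cayley_range bianalytic_cayley
        subspace_antifixed cayley_image_cone_minus]) (auto simp: cone_minus_def)

lemma embedded_cone_plus_times_cone_minus:
  "embedded_analytic_submanifold (cone_plus \<sigma> \<times> cone_minus \<sigma>)"
proof (rule embedded_analytic_submanifoldI[OF _ _ _ bianalytic_id_cayley])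
  show "open (\<Omega> \<times> (\<Omega> :: 'a set))" "open (\<Omega> \<times> (cayley_range :: 'a set))"
    by (intro open_Times open_cone open_cayley_range)+
  show "cone_plus \<sigma> \<times> cone_minus \<sigma> \<subseteq> \<Omega> \<times> \<Omega>" by (auto simp: cone_plus_def cone_minus_def)
  show "subspace ({x. \<sigma> x = x} \<times> {x. \<sigma> x = - x})"
    by (rule subspace_Times[OF subspace_fixed subspace_antifixed])
  have "(\<lambda>p. (fst p, cayley (snd p))) ` (cone_plus \<sigma> \<times> cone_minus \<sigma>) = cone_plus \<sigma> \<times> cayley ` cone_minus \<sigma>"
    by force
  then show "(\<lambda>p. (fst p, cayley (snd p))) ` (cone_plus \<sigma> \<times> cone_minus \<sigma>)
     = ({x. \<sigma> x = x} \<times> {x. \<sigma> x = - x}) \<inter> (\<Omega> \<times> cayley_range)"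
    unfolding cayley_image_cone_minus cone_plus_eq by blast
qed

lemma polar_map_bianalytic:
  "bianalytic (cone_plus \<sigma> \<times> cone_minus \<sigma>) \<Omega> polar_map \<and>
    (\<forall>x\<in>\<Omega>. inv_into (cone_plus \<sigma> \<times> cone_minus \<sigma>) polar_map x = (x \<sharp> \<sigma> x, x \<natural> \<sigma> (jinv x)))"
proof (rule bianalyticI[where g = "\<lambda>x. (x \<sharp> \<sigma> x, x \<natural> \<sigma> (jinv x))"])
  show "open (\<Omega> \<times> (\<Omega> :: 'a set))" by (intro open_Times open_cone)
  show "cone_plus \<sigma> \<times> cone_minus \<sigma> \<subseteq> \<Omega> \<times> \<Omega>" by (auto simp: cone_plus_def cone_minus_def)
  show "open (\<Omega> :: 'a set)" by (rule open_cone)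
  show "\<Omega> \<subseteq> (\<Omega> :: 'a set)" ..
  show "real_analytic_at polar_map p" if "p \<in> \<Omega> \<times> \<Omega>" for p :: "'a \<times> 'a"
    unfolding polar_map_def case_prod_unfold
    by (intro real_analytic_at_quad_rep real_analytic_at_jpow_compose real_analytic_at_fst
        real_analytic_at_snd real_analytic_at_ident) (use that in auto)
  show "real_analytic_at (\<lambda>x. (x \<sharp> \<sigma> x, x \<natural> \<sigma> (jinv x))) x" if x: "x \<in> \<Omega>" for x
    by (intro real_analytic_at_Pair real_analytic_at_metric_geometric_mean
        real_analytic_at_spectral_geometric_mean real_analytic_at_linear[OF involution_linear[OF \<sigma>]]
        real_analytic_at_jpow_compose real_analytic_at_ident x involution_in_cone[OF \<sigma>] jpow_in_cone)
  show "polar_map p \<in> \<Omega> \<and> (polar_map p \<sharp> \<sigma> (polar_map p), polar_map p \<natural> \<sigma> (jinv (polar_map p))) = p"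
    if "p \<in> cone_plus \<sigma> \<times> cone_minus \<sigma>" for p
    using that polar_map_components[OF \<sigma>] by (cases p) auto
  show "(x \<sharp> \<sigma> x, x \<natural> \<sigma> (jinv x)) \<in> cone_plus \<sigma> \<times> cone_minus \<sigma> \<and>
     polar_map (x \<sharp> \<sigma> x, x \<natural> \<sigma> (jinv x)) = x" if "x \<in> \<Omega>" for x
    using polar_map_decomposition[OF \<sigma> that] by simp
qed

end

lemma embedded_cone: "embedded_analytic_submanifold \<Omega>"
  using embedded_analytic_submanifold_subspace_Int_open[OF open_cone subspace_UNIV] by simp

theorem theorem5p1:
  fixes \<sigma> :: "'a::simple_euclidean_jordan_algebra \<Rightarrow> 'a"
  assumes "involutive_jordan_automorphism \<sigma>"
  shows "embedded_analytic_submanifold (cone_plus \<sigma>) \<and>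
    embedded_analytic_submanifold (cone_minus \<sigma>) \<and>
    real_analytic_diffeomorphism (cone_plus \<sigma> \<times> cone_minus \<sigma>) \<Omega> polar_map \<and>
    (\<forall>x\<in>\<Omega>. inv_into (cone_plus \<sigma> \<times> cone_minus \<sigma>) polar_map x = (x \<sharp> \<sigma> x, x \<natural> \<sigma> (jinv x)))"
  unfolding real_analytic_diffeomorphism_def
  using embedded_cone_plus[OF assms] embedded_cone_minus[OF assms]
    embedded_cone_plus_times_cone_minus[OF assms] embedded_cone polar_map_bianalytic[OF assms] by blast

end
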